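(* Let $R$ be a unital topological ring and let $\pi\colon\Lambda\to\Gamma$ be a continuous $R$-bundle. Assume that $\Gamma$ and $\mathcal{E}$ are locally $R$-normal étale semigroupoids. Then there exists a unique $R$-bimodule homomorphism $T\colon\mathcal{A}(\pi)\otimes_R R\mathcal{E}\to\mathcal{A}(\pi\times\mathcal{E})$ given on pure tensors by \[T(\alpha\otimes f)(\gamma,e)=(\alpha(\gamma)f(e),e)\] for all $\alpha\in\mathcal{A}(\pi)$, $f\in R\mathcal{E}$ and $(\gamma,e)\in\Gamma\times\mathcal{E}$. Moreover: (a) If $R$ is commutative and the $R$-bimodule $\pi^{-1}(\gamma)$ is symmetric for all $\gamma\in\Gamma$, then $T$ is an $R$-algebra homomorphism. (b) If $\Gamma$ and $\mathcal{E}$ are ample and $\pi$ is a local homeomorphism, then $T$ is surjective. (c) If $R$ is discrete and $\mathcal{E}$ is ample and Hausdorff, then $T$ is injective. (d) If $R$ is a field, then $T$ is injective.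
   Context: Rings and algebras are associative; (bi)modules over unital rings are unital. An $R$-bimodule $M$ is symmetric if $rm=mr$ for all $r\in R$, $m\in M$. For a right $R$-module $M$ and a left $R$-module $N$, $M\otimes_R N$ is the usual (algebraic) tensor product, universal for biadditive maps $B$ with $B(mr,n)=B(m,rn)$; if $M,N$ are $R$-bimodules it is an $R$-bimodule via $r(m\otimes n)=(rm)\otimes n$, $(m\otimes n)r=m\otimes(nr)$. If $R$ is commutative and $A,B$ are symmetric $R$-algebras, $A\otimes_R B$ is an algebra with $(a_1\otimes b_1)(a_2\otimes b_2)=a_1a_2\otimes b_1b_2$. An algebra over a (non-commutative) ring $R$ is a ring $A$ with an $R$-bimodule structure with $(ra)b=r(ab)$, $(ar)b=a(rb)$, $(ab)r=a(br)$. A space has a property "locally" if every point has a neighbourhood basis (neighbourhoods not necessarily open) of subsets having that property in the subspace topology. A space $X$ is $R$-normal if for any disjoint closed $A,B\subseteq X$ there is a continuous $f\colon X\to R$ with $f=0$ on $A$, $f=1$ on $B$. A semigroupoid $\Lambda$ is a directed graph with vertex set $\Lambda^{(0)}$, source and range maps $\mathfrak{s},\mathfrak{r}\colon\Lambda\to\Lambda^{(0)}$, and an associative product $\Lambda^{(2)}=\{(a,b)\in\Lambda\times\Lambda:\mathfrak{s}(a)=\mathfrak{r}(b)\}\to\Lambda$, $(a,b)\mapsto ab$, with $\mathfrak{s}(ab)=\mathfrak{s}(b)$, $\mathfrak{r}(ab)=\mathfrak{r}(a)$. A homomorphism $\phi\colon\Lambda_1\to\Lambda_2$ is a map such that $(a,b)\in\Lambda_1^{(2)}$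 implies $(\phi(a),\phi(b))\in\Lambda_2^{(2)}$ and $\phi(ab)=\phi(a)\phi(b)$; it is rigid if $(\phi\times\phi)^{-1}(\Lambda_2^{(2)})=\Lambda_1^{(2)}$. A topological semigroupoid has topologies on $\Lambda,\Lambda^{(0)}$ making $\mathfrak{s},\mathfrak{r}$ and the product continuous. It is étale if $\mathfrak{s},\mathfrak{r}$ are local homeomorphisms and $\Lambda^{(0)}$ is locally compact and Hausdorff ($\Lambda$ itself need not be Hausdorff). A bisection is a subset on which $\mathfrak{s}$ and $\mathfrak{r}$ are injective. An étale semigroupoid is ample if it is zero-dimensional, i.e. it has a basis of compact-open bisections. An $R$-bundle is a rigid semigroupoid homomorphism $\pi\colon\Lambda\to\Gamma$ with an $R$-bimodule structure on each fiber $\pi^{-1}(\gamma)$, $\gamma\in\Gamma$, such that for $(\gamma_1,\gamma_2)\in\Gamma^{(2)}$ the product $\pi^{-1}(\gamma_1)\times\pi^{-1}(\gamma_2)\to\pi^{-1}(\gamma_1\gamma_2)$ is biadditive, satisfies $(xr)y=x(ry)$, and induces an $R$-bimodule homomorphism on $\pi^{-1}(\gamma_1)\otimes_R\pi^{-1}(\gamma_2)$. Write $0_\gamma$ for the zero of $\pi^{-1}(\gamma)$. If $\Lambda,\Gamma$ are topological semigroupoids, the bundle is continuous if $\pi$ is continuous, addition $\{(x,y):\pi(x)=\pi(y)\}\to\Lambda$ is continuous, the left and right scalar multiplications by $R$ are (jointly) continuous, and $\gamma\mapsto0_\gamma$ is continuous. A section of $\pi$ is a map $\alpha\colon\Gamma\to\Lambda$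 with $\pi\circ\alpha=\mathrm{id}_\Gamma$; sections form an $R$-bimodule pointwise. $\operatorname{supp}(\alpha)$ is the closure of $\{\gamma:\alpha(\gamma)\ne0_\gamma\}$. For $V\subseteq\Gamma$ open, $C_c(V,\pi)$ is the set of sections $\alpha$ that are zero outside $V$, continuous on $V$, with $\operatorname{supp}(\alpha)\cap V$ compact. For $\Gamma$ étale and locally $R$-normal, the sectional algebra $\mathcal{A}(\pi)$ is the $R$-bimodule generated by the union of all $C_c(V,\pi)$, $V\subseteq\Gamma$ open Hausdorff, with convolution product $(\alpha\ast\beta)(\gamma)=\sum_{ab=\gamma}\alpha(a)\beta(b)$. $R\mathcal{E}$ is the algebra generated by (equivalently, additive span of) all functions $f\colon\mathcal{E}\to R$ for which there is an open Hausdorff $W\subseteq\mathcal{E}$ with $f=0$ outside $W$ and $f|_W$ continuous and compactly supported; bimodule structure pointwise, product $(f\ast g)(e)=\sum_{ab=e}f(a)g(b)$. $\Gamma\times\mathcal{E}$ and $\Lambda\times\mathcal{E}$ are product semigroupoids, and $\pi\times\mathcal{E}\colon\Lambda\times\mathcal{E}\to\Gamma\times\mathcal{E}$, $(\lambda,e)\mapsto(\pi(\lambda),e)$, is the $R$-bundle whose fiber $\pi^{-1}(\gamma)\times\{e\}$ has the bimodule structure of $\pi^{-1}(\gamma)$. *)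

theory Defs
  imports
    "HOL-Analysis.Analysis"
    "HOL-Algebra.Ring"
    "HOL-Algebra.Free_Abelian_Groups"
    "HOL-Algebra.Generated_Groups"
begin

section \<open>Bimodules and tensor products\<close>

text \<open>
  Rings and modules are structures in the sense of HOL-Algebra. Bimodules, like the library's
  modules, extend the record of rings; its field \<open>one\<close> is never used (the algebras below
  need not be unital), and \<open>mult\<close> is used only where the bimodule is an algebra.
\<close>

record ('r, 'm) bimod = "'m ring" +
  lscal :: "'r \<Rightarrow> 'm \<Rightarrow> 'm"
  rscal :: "'m \<Rightarrow> 'r \<Rightarrow> 'm"

locale bimodule = R: ring R + M: abelian_group M
  for R :: "'r ring" and M :: "('r, 'm) bimod" +
  assumes lscal_closed: "r \<in> carrier R \<Longrightarrow> m \<in> carrier M \<Longrightarrow> lscal M r m \<in> carrier M"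
    and lscal_add: "r \<in> carrier R \<Longrightarrow> m \<in> carrier M \<Longrightarrow> n \<in> carrier M \<Longrightarrow>
          lscal M r (m \<oplus>\<^bsub>M\<^esub> n) = lscal M r m \<oplus>\<^bsub>M\<^esub> lscal M r n"
    and lscal_add_scalar: "r \<in> carrier R \<Longrightarrow> s \<in> carrier R \<Longrightarrow> m \<in> carrier M \<Longrightarrow>
          lscal M (r \<oplus>\<^bsub>R\<^esub> s) m = lscal M r m \<oplus>\<^bsub>M\<^esub> lscal M s m"
    and lscal_mult: "r \<in> carrier R \<Longrightarrow> s \<in> carrier R \<Longrightarrow> m \<in> carrier M \<Longrightarrow>
          lscal M (r \<otimes>\<^bsub>R\<^esub> s) m = lscal M r (lscal M s m)"
    and lscal_one: "m \<in> carrier M \<Longrightarrow> lscal M \<one>\<^bsub>R\<^esub> m = m"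
    and rscal_closed: "r \<in> carrier R \<Longrightarrow> m \<in> carrier M \<Longrightarrow> rscal M m r \<in> carrier M"
    and rscal_add: "r \<in> carrier R \<Longrightarrow> m \<in> carrier M \<Longrightarrow> n \<in> carrier M \<Longrightarrow>
          rscal M (m \<oplus>\<^bsub>M\<^esub> n) r = rscal M m r \<oplus>\<^bsub>M\<^esub> rscal M n r"
    and rscal_add_scalar: "r \<in> carrier R \<Longrightarrow> s \<in> carrier R \<Longrightarrow> m \<in> carrier M \<Longrightarrow>
          rscal M m (r \<oplus>\<^bsub>R\<^esub> s) = rscal M m r \<oplus>\<^bsub>M\<^esub> rscal M m s"
    and rscal_mult: "r \<in> carrier R \<Longrightarrow> s \<in> carrier R \<Longrightarrow> m \<in> carrier M \<Longrightarrow>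
          rscal M m (r \<otimes>\<^bsub>R\<^esub> s) = rscal M (rscal M m r) s"
    and rscal_one: "m \<in> carrier M \<Longrightarrow> rscal M m \<one>\<^bsub>R\<^esub> = m"
    and lscal_rscal: "r \<in> carrier R \<Longrightarrow> s \<in> carrier R \<Longrightarrow> m \<in> carrier M \<Longrightarrow>
          rscal M (lscal M r m) s = lscal M r (rscal M m s)"

definition symmetric_bimodule :: "'r ring \<Rightarrow> ('r, 'm) bimod \<Rightarrow> bool" where
  "symmetric_bimodule R M \<longleftrightarrow> bimodule R M \<and>
     (\<forall>r\<in>carrier R. \<forall>m\<in>carrier M. lscal M r m = rscal M m r)"

text \<open>
  Homomorphisms are extensional functions, so that they are determined by their values on the
  carrier.
\<close>

definition bimod_hom :: "'r ring \<Rightarrow> ('r, 'm) bimod \<Rightarrow> ('r, 'n) bimod \<Rightarrow> ('m \<Rightarrow> 'n) set" where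
  "bimod_hom R M N = {h \<in> carrier M \<rightarrow>\<^sub>E carrier N.
     (\<forall>m\<in>carrier M. \<forall>n\<in>carrier M. h (m \<oplus>\<^bsub>M\<^esub> n) = h m \<oplus>\<^bsub>N\<^esub> h n) \<and>
     (\<forall>r\<in>carrier R. \<forall>m\<in>carrier M. h (lscal M r m) = lscal N r (h m)) \<and>
     (\<forall>r\<in>carrier R. \<forall>m\<in>carrier M. h (rscal M m r) = rscal N (h m) r)}"

definition algebra_hom :: "'r ring \<Rightarrow> ('r, 'm) bimod \<Rightarrow> ('r, 'n) bimod \<Rightarrow> ('m \<Rightarrow> 'n) set" where
  "algebra_hom R M N = {h \<in> bimod_hom R M N.
     \<forall>m\<in>carrier M. \<forall>n\<in>carrier M. h (m \<otimes>\<^bsub>M\<^esub> n) = h m \<otimes>\<^bsub>N\<^esub> h n}"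

inductive_set bimod_span :: "'r ring \<Rightarrow> ('r, 'm) bimod \<Rightarrow> 'm set \<Rightarrow> 'm set"
  for R :: "'r ring" and M :: "('r, 'm) bimod" and X :: "'m set" where
  zero: "\<zero>\<^bsub>M\<^esub> \<in> bimod_span R M X"
| incl: "x \<in> X \<Longrightarrow> x \<in> bimod_span R M X"
| add: "x \<in> bimod_span R M X \<Longrightarrow> y \<in> bimod_span R M X \<Longrightarrow> x \<oplus>\<^bsub>M\<^esub> y \<in> bimod_span R M X"
| lscal: "r \<in> carrier R \<Longrightarrow> x \<in> bimod_span R M X \<Longrightarrow> lscal M r x \<in> bimod_span R M X"
| rscal: "r \<in> carrier R \<Longrightarrow> x \<in> bimod_span R M X \<Longrightarrow> rscal M x r \<in> bimod_span R M X"

text \<open>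
  The tensor product of bimodules: the free abelian group on the pairs (written additively inside
  \<open>'m \<times> 'n \<Rightarrow>\<^sub>0 int\<close>), modulo the subgroup generated by the relations of a balanced biadditive map.
\<close>

definition tensor_free :: "('r, 'm) bimod \<Rightarrow> ('r, 'n) bimod \<Rightarrow> ('m \<times> 'n \<Rightarrow>\<^sub>0 int) monoid" where
  "tensor_free M N = free_Abelian_group (carrier M \<times> carrier N)"

definition tensor_rels ::
    "'r ring \<Rightarrow> ('r, 'm) bimod \<Rightarrow> ('r, 'n) bimod \<Rightarrow> ('m \<times> 'n \<Rightarrow>\<^sub>0 int) set" where
  "tensor_rels R M N = generate (tensor_free M N)
     ({frag_of (m \<oplus>\<^bsub>M\<^esub> m', n) - (frag_of (m, n) + frag_of (m', n)) | m m' n.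
         m \<in> carrier M \<and> m' \<in> carrier M \<and> n \<in> carrier N} \<union>
      {frag_of (m, n \<oplus>\<^bsub>N\<^esub> n') - (frag_of (m, n) + frag_of (m, n')) | m n n'.
         m \<in> carrier M \<and> n \<in> carrier N \<and> n' \<in> carrier N} \<union>
      {frag_of (rscal M m r, n) - frag_of (m, lscal N r n) | m r n.
         m \<in> carrier M \<and> r \<in> carrier R \<and> n \<in> carrier N})"

definition tensor_class ::
    "'r ring \<Rightarrow> ('r, 'm) bimod \<Rightarrow> ('r, 'n) bimod \<Rightarrow> ('m \<times> 'n \<Rightarrow>\<^sub>0 int) \<Rightarrow> ('m \<times> 'n \<Rightarrow>\<^sub>0 int) set" where
  "tensor_class R M N x = tensor_rels R M N #>\<^bsub>tensor_free M N\<^esub> x"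

definition pure_tensor ::
    "'r ring \<Rightarrow> ('r, 'm) bimod \<Rightarrow> ('r, 'n) bimod \<Rightarrow> 'm \<Rightarrow> 'n \<Rightarrow> ('m \<times> 'n \<Rightarrow>\<^sub>0 int) set" where
  "pure_tensor R M N m n = tensor_class R M N (frag_of (m, n))"

text \<open>
  The scalar multiplications and the product are the (bi)additive extensions of
  \<open>r(m \<otimes> n) = (rm) \<otimes> n\<close>, \<open>(m \<otimes> n)r = m \<otimes> (nr)\<close> and
  \<open>(m\<^sub>1 \<otimes> n\<^sub>1)(m\<^sub>2 \<otimes> n\<^sub>2) = m\<^sub>1m\<^sub>2 \<otimes> n\<^sub>1n\<^sub>2\<close>, computed on arbitrary representatives of the classes.
  The product is meaningful only if \<open>R\<close> is commutative and \<open>M\<close>, \<open>N\<close> are symmetric algebras: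
  then each union in its definition is a union of one and the same coset.
\<close>

definition tensor :: "'r ring \<Rightarrow> ('r, 'm) bimod \<Rightarrow> ('r, 'n) bimod \<Rightarrow>
    ('r, ('m \<times> 'n \<Rightarrow>\<^sub>0 int) set) bimod" where
  "tensor R M N =
    \<lparr>carrier = carrier (tensor_free M N Mod tensor_rels R M N),
     monoid.mult = (\<lambda>X Y. \<Union>x\<in>X. \<Union>y\<in>Y. tensor_class R M N
        (frag_extend (\<lambda>(m, n). frag_extend (\<lambda>(m', n'). frag_of (m \<otimes>\<^bsub>M\<^esub> m', n \<otimes>\<^bsub>N\<^esub> n')) y) x)),
     one = undefined,
     ring.zero = \<one>\<^bsub>tensor_free M N Mod tensor_rels R M N\<^esub>,
     ring.add = (\<lambda>X Y. X \<otimes>\<^bsub>tensor_free M N Mod tensor_rels R M N\<^esub> Y),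
     lscal = (\<lambda>r X. \<Union>x\<in>X. tensor_class R M N
        (frag_extend (\<lambda>(m, n). frag_of (lscal M r m, n)) x)),
     rscal = (\<lambda>X r. \<Union>x\<in>X. tensor_class R M N
        (frag_extend (\<lambda>(m, n). frag_of (m, rscal N n r)) x))\<rparr>"


section \<open>Topological notions\<close>

locale topological_ring = ring R for R :: "'r ring" (structure) +
  fixes RT :: "'r topology"
  assumes topspace_RT: "topspace RT = carrier R"
    and continuous_add: "continuous_map (prod_topology RT RT) RT (\<lambda>(r, s). r \<oplus> s)"
    and continuous_neg: "continuous_map RT RT (\<lambda>r. \<ominus> r)"
    and continuous_mult: "continuous_map (prod_topology RT RT) RT (\<lambda>(r, s). r \<otimes> s)"

definition R_normal :: "'r ring \<Rightarrow> 'r topology \<Rightarrow> 'a topology \<Rightarrow> bool" where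
  "R_normal R RT X \<longleftrightarrow>
     (\<forall>A B. closedin X A \<and> closedin X B \<and> A \<inter> B = {} \<longrightarrow>
        (\<exists>f. continuous_map X RT f \<and> (\<forall>x\<in>A. f x = \<zero>\<^bsub>R\<^esub>) \<and> (\<forall>x\<in>B. f x = \<one>\<^bsub>R\<^esub>)))"

definition locally_R_normal :: "'r ring \<Rightarrow> 'r topology \<Rightarrow> 'a topology \<Rightarrow> bool" where
  "locally_R_normal R RT X \<longleftrightarrow> neighbourhood_base_of (\<lambda>S. R_normal R RT (subtopology X S)) X"

definition local_homeomorphism :: "'a topology \<Rightarrow> 'b topology \<Rightarrow> ('a \<Rightarrow> 'b) \<Rightarrow> bool" where
  "local_homeomorphism X Y f \<longleftrightarrow>
     (\<forall>x\<in>topspace X. \<exists>U. openin X U \<and> x \<in> U \<and> openin Y (f ` U) \<and>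
        homeomorphic_map (subtopology X U) (subtopology Y (f ` U)) f)"


section \<open>Semigroupoids\<close>

record ('o, 'a) sgpd =
  vertices :: "'o set"
  arrows :: "'a set"
  source :: "'a \<Rightarrow> 'o"
  range_of :: "'a \<Rightarrow> 'o"
  sgpd_mult :: "'a \<Rightarrow> 'a \<Rightarrow> 'a"

definition composable :: "('o, 'a, 'k) sgpd_scheme \<Rightarrow> ('a \<times> 'a) set" where
  "composable S = {(a, b). a \<in> arrows S \<and> b \<in> arrows S \<and> source S a = range_of S b}"

locale semigroupoid =
  fixes S :: "('o, 'a, 'k) sgpd_scheme"
  assumes source_closed: "a \<in> arrows S \<Longrightarrow> source S a \<in> vertices S"
    and range_closed: "a \<in> arrows S \<Longrightarrow> range_of S a \<in> vertices S"
    and comp_closed: "(a, b) \<in> composable S \<Longrightarrow> sgpd_mult S a b \<in> arrows S"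
    and source_comp: "(a, b) \<in> composable S \<Longrightarrow> source S (sgpd_mult S a b) = source S b"
    and range_comp: "(a, b) \<in> composable S \<Longrightarrow> range_of S (sgpd_mult S a b) = range_of S a"
    and comp_assoc: "(a, b) \<in> composable S \<Longrightarrow> (b, c) \<in> composable S \<Longrightarrow>
          sgpd_mult S (sgpd_mult S a b) c = sgpd_mult S a (sgpd_mult S b c)"

definition sgpd_hom ::
    "('o, 'a, 'k) sgpd_scheme \<Rightarrow> ('p, 'b, 'j) sgpd_scheme \<Rightarrow> ('a \<Rightarrow> 'b) \<Rightarrow> bool" where
  "sgpd_hom S T \<phi> \<longleftrightarrow> \<phi> \<in> arrows S \<rightarrow> arrows T \<and>
     (\<forall>(a, b)\<in>composable S. (\<phi> a, \<phi> b) \<in> composable T \<and> \<phi> (sgpd_mult S a b) = sgpd_mult T (\<phi> a) (\<phi> b))"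

definition rigid_hom ::
    "('o, 'a, 'k) sgpd_scheme \<Rightarrow> ('p, 'b, 'j) sgpd_scheme \<Rightarrow> ('a \<Rightarrow> 'b) \<Rightarrow> bool" where
  "rigid_hom S T \<phi> \<longleftrightarrow> sgpd_hom S T \<phi> \<and>
     {(a, b) \<in> arrows S \<times> arrows S. (\<phi> a, \<phi> b) \<in> composable T} = composable S"

definition bisection :: "('o, 'a, 'k) sgpd_scheme \<Rightarrow> 'a set \<Rightarrow> bool" where
  "bisection S U \<longleftrightarrow> U \<subseteq> arrows S \<and> inj_on (source S) U \<and> inj_on (range_of S) U"

record ('o, 'a) top_sgpd = "('o, 'a) sgpd" +
  vtop :: "'o topology"
  atop :: "'a topology"

locale topological_semigroupoid = semigroupoid S for S :: "('o, 'a) top_sgpd" +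
  assumes topspace_vtop: "topspace (vtop S) = vertices S"
    and topspace_atop: "topspace (atop S) = arrows S"
    and continuous_source: "continuous_map (atop S) (vtop S) (source S)"
    and continuous_range: "continuous_map (atop S) (vtop S) (range_of S)"
    and continuous_comp: "continuous_map
          (subtopology (prod_topology (atop S) (atop S)) (composable S)) (atop S)
          (\<lambda>(a, b). sgpd_mult S a b)"

locale etale_semigroupoid = topological_semigroupoid +
  assumes local_homeomorphism_source: "local_homeomorphism (atop S) (vtop S) (source S)"
    and local_homeomorphism_range: "local_homeomorphism (atop S) (vtop S) (range_of S)"
    and locally_compact_vtop: "neighbourhood_base_of (compactin (vtop S)) (vtop S)"
    and Hausdorff_vtop: "Hausdorff_space (vtop S)"

locale ample_semigroupoid = etale_semigroupoid +
  assumes compact_open_bisections: "openin (atop S) W \<Longrightarrow> a \<in> W \<Longrightarrow>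
    \<exists>U. openin (atop S) U \<and> compactin (atop S) U \<and> bisection S U \<and> a \<in> U \<and> U \<subseteq> W"

definition prod_sgpd :: "('o, 'a) top_sgpd \<Rightarrow> ('p, 'b) top_sgpd \<Rightarrow> ('o \<times> 'p, 'a \<times> 'b) top_sgpd" where
  "prod_sgpd S T =
    \<lparr>vertices = vertices S \<times> vertices T,
     arrows = arrows S \<times> arrows T,
     source = (\<lambda>(a, b). (source S a, source T b)),
     range_of = (\<lambda>(a, b). (range_of S a, range_of T b)),
     sgpd_mult = (\<lambda>(a, b) (a', b'). (sgpd_mult S a a', sgpd_mult T b b')),
     vtop = prod_topology (vtop S) (vtop T),
     atop = prod_topology (atop S) (atop T)\<rparr>"


section \<open>Bundles\<close>

text \<open>
  The operations of all the fibres of a bundle are collected into single functions on the total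
  space; only their values on elements of a common fibre matter.
\<close>

record ('r, 'g, 'l) rbundle =
  proj :: "'l \<Rightarrow> 'g"
  fib_add :: "'l \<Rightarrow> 'l \<Rightarrow> 'l"
  fib_zero :: "'g \<Rightarrow> 'l"
  fib_lscal :: "'r \<Rightarrow> 'l \<Rightarrow> 'l"
  fib_rscal :: "'l \<Rightarrow> 'r \<Rightarrow> 'l"

definition fibre :: "('o, 'l, 'k) sgpd_scheme \<Rightarrow> ('r, 'g, 'l) rbundle \<Rightarrow> 'g \<Rightarrow> ('r, 'l) bimod" where
  "fibre \<Lambda> \<pi> \<gamma> =
    \<lparr>carrier = {x \<in> arrows \<Lambda>. proj \<pi> x = \<gamma>},
     monoid.mult = undefined, one = undefined,
     ring.zero = fib_zero \<pi> \<gamma>, ring.add = fib_add \<pi>,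
     lscal = fib_lscal \<pi>, rscal = fib_rscal \<pi>\<rparr>"

text \<open>
  The last two assumptions say that the additive map induced by the (balanced, biadditive) product
  on the tensor product of two fibres is left and right \<open>R\<close>-linear.
\<close>

locale R_bundle = R: ring R + \<Lambda>: semigroupoid \<Lambda> + \<Gamma>: semigroupoid \<Gamma>
  for R :: "'r ring" and \<Lambda> :: "('p, 'l, 'k) sgpd_scheme" and \<Gamma> :: "('o, 'g, 'j) sgpd_scheme"
    and \<pi> :: "('r, 'g, 'l) rbundle" +
  assumes rigid: "rigid_hom \<Lambda> \<Gamma> (proj \<pi>)"
    and fibre_bimodule: "\<gamma> \<in> arrows \<Gamma> \<Longrightarrow> bimodule R (fibre \<Lambda> \<pi> \<gamma>)"
    and comp_add_left: "(\<gamma>, \<delta>) \<in> composable \<Gamma> \<Longrightarrow> x \<in> carrier (fibre \<Lambda> \<pi> \<gamma>) \<Longrightarrow>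
          x' \<in> carrier (fibre \<Lambda> \<pi> \<gamma>) \<Longrightarrow> y \<in> carrier (fibre \<Lambda> \<pi> \<delta>) \<Longrightarrow>
          sgpd_mult \<Lambda> (fib_add \<pi> x x') y = fib_add \<pi> (sgpd_mult \<Lambda> x y) (sgpd_mult \<Lambda> x' y)"
    and comp_add_right: "(\<gamma>, \<delta>) \<in> composable \<Gamma> \<Longrightarrow> x \<in> carrier (fibre \<Lambda> \<pi> \<gamma>) \<Longrightarrow>
          y \<in> carrier (fibre \<Lambda> \<pi> \<delta>) \<Longrightarrow> y' \<in> carrier (fibre \<Lambda> \<pi> \<delta>) \<Longrightarrow>
          sgpd_mult \<Lambda> x (fib_add \<pi> y y') = fib_add \<pi> (sgpd_mult \<Lambda> x y) (sgpd_mult \<Lambda> x y')"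
    and comp_balanced: "(\<gamma>, \<delta>) \<in> composable \<Gamma> \<Longrightarrow> x \<in> carrier (fibre \<Lambda> \<pi> \<gamma>) \<Longrightarrow>
          y \<in> carrier (fibre \<Lambda> \<pi> \<delta>) \<Longrightarrow> r \<in> carrier R \<Longrightarrow>
          sgpd_mult \<Lambda> (fib_rscal \<pi> x r) y = sgpd_mult \<Lambda> x (fib_lscal \<pi> r y)"
    and comp_lscal: "(\<gamma>, \<delta>) \<in> composable \<Gamma> \<Longrightarrow> x \<in> carrier (fibre \<Lambda> \<pi> \<gamma>) \<Longrightarrow>
          y \<in> carrier (fibre \<Lambda> \<pi> \<delta>) \<Longrightarrow> r \<in> carrier R \<Longrightarrow>
          sgpd_mult \<Lambda> (fib_lscal \<pi> r x) y = fib_lscal \<pi> r (sgpd_mult \<Lambda> x y)"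
    and comp_rscal: "(\<gamma>, \<delta>) \<in> composable \<Gamma> \<Longrightarrow> x \<in> carrier (fibre \<Lambda> \<pi> \<gamma>) \<Longrightarrow>
          y \<in> carrier (fibre \<Lambda> \<pi> \<delta>) \<Longrightarrow> r \<in> carrier R \<Longrightarrow>
          sgpd_mult \<Lambda> x (fib_rscal \<pi> y r) = fib_rscal \<pi> (sgpd_mult \<Lambda> x y) r"

locale continuous_bundle =
  R: topological_ring R RT + \<Lambda>: topological_semigroupoid \<Lambda> + \<Gamma>: topological_semigroupoid \<Gamma> +
  R_bundle R \<Lambda> \<Gamma> \<pi>
  for R :: "'r ring" and RT :: "'r topology"
    and \<Lambda> :: "('p, 'l) top_sgpd" and \<Gamma> :: "('o, 'g) top_sgpd" and \<pi> :: "('r, 'g, 'l) rbundle" +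
  assumes continuous_proj: "continuous_map (atop \<Lambda>) (atop \<Gamma>) (proj \<pi>)"
    and continuous_fib_add: "continuous_map
          (subtopology (prod_topology (atop \<Lambda>) (atop \<Lambda>)) {(x, y). proj \<pi> x = proj \<pi> y}) (atop \<Lambda>)
          (\<lambda>(x, y). fib_add \<pi> x y)"
    and continuous_fib_lscal: "continuous_map (prod_topology RT (atop \<Lambda>)) (atop \<Lambda>)
          (\<lambda>(r, x). fib_lscal \<pi> r x)"
    and continuous_fib_rscal: "continuous_map (prod_topology (atop \<Lambda>) RT) (atop \<Lambda>)
          (\<lambda>(x, r). fib_rscal \<pi> x r)"
    and continuous_fib_zero: "continuous_map (atop \<Gamma>) (atop \<Lambda>) (fib_zero \<pi>)"

text \<open>The bundle \<open>\<pi> \<times> \<E>\<close> of \<open>\<Lambda> \<times> \<E>\<close> over \<open>\<Gamma> \<times> \<E>\<close>.\<close>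

definition prod_bundle :: "('r, 'g, 'l) rbundle \<Rightarrow> ('r, 'g \<times> 'e, 'l \<times> 'e) rbundle" where
  "prod_bundle \<pi> =
    \<lparr>proj = (\<lambda>(x, e). (proj \<pi> x, e)),
     fib_add = (\<lambda>(x, e) (y, _). (fib_add \<pi> x y, e)),
     fib_zero = (\<lambda>(\<gamma>, e). (fib_zero \<pi> \<gamma>, e)),
     fib_lscal = (\<lambda>r (x, e). (fib_lscal \<pi> r x, e)),
     fib_rscal = (\<lambda>(x, e) r. (fib_rscal \<pi> x r, e))\<rparr>"


section \<open>Sectional algebras\<close>

text \<open>
  Sections are extensional functions. In the convolution products below, only the pairs at which
  both factors are nonzero are summed: for elements of the algebras in question (over an etale
  base) these are finitely many, whereas \<open>finsum\<close> over an infinite index set is zero by convention.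
\<close>

definition sections :: "('p, 'l, 'k) sgpd_scheme \<Rightarrow> ('o, 'g, 'j) sgpd_scheme \<Rightarrow>
    ('r, 'g, 'l) rbundle \<Rightarrow> ('r, 'g \<Rightarrow> 'l) bimod" where
  "sections \<Lambda> \<Gamma> \<pi> =
    \<lparr>carrier = (\<Pi>\<^sub>E \<gamma>\<in>arrows \<Gamma>. carrier (fibre \<Lambda> \<pi> \<gamma>)),
     monoid.mult = (\<lambda>\<alpha> \<beta>. \<lambda>\<gamma>\<in>arrows \<Gamma>. finsum (fibre \<Lambda> \<pi> \<gamma>) (\<lambda>(a, b). sgpd_mult \<Lambda> (\<alpha> a) (\<beta> b))
        {(a, b) \<in> composable \<Gamma>. sgpd_mult \<Gamma> a b = \<gamma> \<and> \<alpha> a \<noteq> fib_zero \<pi> a \<and> \<beta> b \<noteq> fib_zero \<pi> b}),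
     one = undefined,
     ring.zero = (\<lambda>\<gamma>\<in>arrows \<Gamma>. fib_zero \<pi> \<gamma>),
     ring.add = (\<lambda>\<alpha> \<beta>. \<lambda>\<gamma>\<in>arrows \<Gamma>. fib_add \<pi> (\<alpha> \<gamma>) (\<beta> \<gamma>)),
     lscal = (\<lambda>r \<alpha>. \<lambda>\<gamma>\<in>arrows \<Gamma>. fib_lscal \<pi> r (\<alpha> \<gamma>)),
     rscal = (\<lambda>\<alpha> r. \<lambda>\<gamma>\<in>arrows \<Gamma>. fib_rscal \<pi> (\<alpha> \<gamma>) r)\<rparr>"

definition section_supp :: "('o, 'g) top_sgpd \<Rightarrow> ('r, 'g, 'l) rbundle \<Rightarrow> ('g \<Rightarrow> 'l) \<Rightarrow> 'g set" where
  "section_supp \<Gamma> \<pi> \<alpha> = atop \<Gamma> closure_of {\<gamma> \<in> arrows \<Gamma>. \<alpha> \<gamma> \<noteq> fib_zero \<pi> \<gamma>}"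

definition Cc_sections :: "('p, 'l) top_sgpd \<Rightarrow> ('o, 'g) top_sgpd \<Rightarrow> ('r, 'g, 'l) rbundle \<Rightarrow>
    'g set \<Rightarrow> ('g \<Rightarrow> 'l) set" where
  "Cc_sections \<Lambda> \<Gamma> \<pi> V = {\<alpha> \<in> carrier (sections \<Lambda> \<Gamma> \<pi>).
     (\<forall>\<gamma>\<in>arrows \<Gamma> - V. \<alpha> \<gamma> = fib_zero \<pi> \<gamma>) \<and>
     continuous_map (subtopology (atop \<Gamma>) V) (atop \<Lambda>) \<alpha> \<and>
     compactin (atop \<Gamma>) (section_supp \<Gamma> \<pi> \<alpha> \<inter> V)}"

definition sectional_algebra :: "'r ring \<Rightarrow> ('p, 'l) top_sgpd \<Rightarrow> ('o, 'g) top_sgpd \<Rightarrow>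
    ('r, 'g, 'l) rbundle \<Rightarrow> ('r, 'g \<Rightarrow> 'l) bimod" where
  "sectional_algebra R \<Lambda> \<Gamma> \<pi> = (sections \<Lambda> \<Gamma> \<pi>)
    \<lparr>carrier := bimod_span R (sections \<Lambda> \<Gamma> \<pi>)
       (\<Union>V \<in> {V. openin (atop \<Gamma>) V \<and> Hausdorff_space (subtopology (atop \<Gamma>) V)}.
          Cc_sections \<Lambda> \<Gamma> \<pi> V)\<rparr>"

definition R_functions :: "'r ring \<Rightarrow> ('o, 'e, 'k) sgpd_scheme \<Rightarrow> ('r, 'e \<Rightarrow> 'r) bimod" where
  "R_functions R \<E> =
    \<lparr>carrier = arrows \<E> \<rightarrow>\<^sub>E carrier R,
     monoid.mult = (\<lambda>f g. \<lambda>e\<in>arrows \<E>. finsum R (\<lambda>(a, b). f a \<otimes>\<^bsub>R\<^esub> g b)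
        {(a, b) \<in> composable \<E>. sgpd_mult \<E> a b = e \<and> f a \<noteq> \<zero>\<^bsub>R\<^esub> \<and> g b \<noteq> \<zero>\<^bsub>R\<^esub>}),
     one = undefined,
     ring.zero = (\<lambda>e\<in>arrows \<E>. \<zero>\<^bsub>R\<^esub>),
     ring.add = (\<lambda>f g. \<lambda>e\<in>arrows \<E>. f e \<oplus>\<^bsub>R\<^esub> g e),
     lscal = (\<lambda>r f. \<lambda>e\<in>arrows \<E>. r \<otimes>\<^bsub>R\<^esub> f e),
     rscal = (\<lambda>f r. \<lambda>e\<in>arrows \<E>. f e \<otimes>\<^bsub>R\<^esub> r)\<rparr>"

definition Cc_functions ::
    "'r ring \<Rightarrow> 'r topology \<Rightarrow> ('o, 'e) top_sgpd \<Rightarrow> 'e set \<Rightarrow> ('e \<Rightarrow> 'r) set" where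
  "Cc_functions R RT \<E> W = {f \<in> carrier (R_functions R \<E>).
     (\<forall>e\<in>arrows \<E> - W. f e = \<zero>\<^bsub>R\<^esub>) \<and>
     continuous_map (subtopology (atop \<E>) W) RT f \<and>
     compactin (subtopology (atop \<E>) W) (subtopology (atop \<E>) W closure_of {e \<in> W. f e \<noteq> \<zero>\<^bsub>R\<^esub>})}"

definition semigroupoid_algebra ::
    "'r ring \<Rightarrow> 'r topology \<Rightarrow> ('o, 'e) top_sgpd \<Rightarrow> ('r, 'e \<Rightarrow> 'r) bimod" where
  "semigroupoid_algebra R RT \<E> = (R_functions R \<E>)
    \<lparr>carrier := generate (add_monoid (R_functions R \<E>))
       (\<Union>W \<in> {W. openin (atop \<E>) W \<and> Hausdorff_space (subtopology (atop \<E>) W)}.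
          Cc_functions R RT \<E> W)\<rparr>"

text \<open>The map \<open>T\<close>, characterised by its values on pure tensors.\<close>

definition is_tensor_section_map :: "'r ring \<Rightarrow> 'r topology \<Rightarrow> ('p, 'l) top_sgpd \<Rightarrow>
    ('o, 'g) top_sgpd \<Rightarrow> ('r, 'g, 'l) rbundle \<Rightarrow> ('q, 'e) top_sgpd \<Rightarrow>
    ((('g \<Rightarrow> 'l) \<times> ('e \<Rightarrow> 'r) \<Rightarrow>\<^sub>0 int) set \<Rightarrow> 'g \<times> 'e \<Rightarrow> 'l \<times> 'e) \<Rightarrow> bool" where
  "is_tensor_section_map R RT \<Lambda> \<Gamma> \<pi> \<E> T \<longleftrightarrow>
     T \<in> bimod_hom R
       (tensor R (sectional_algebra R \<Lambda> \<Gamma> \<pi>) (semigroupoid_algebra R RT \<E>))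
       (sectional_algebra R (prod_sgpd \<Lambda> \<E>) (prod_sgpd \<Gamma> \<E>) (prod_bundle \<pi>)) \<and>
     (\<forall>\<alpha>\<in>carrier (sectional_algebra R \<Lambda> \<Gamma> \<pi>). \<forall>f\<in>carrier (semigroupoid_algebra R RT \<E>).
        \<forall>\<gamma>\<in>arrows \<Gamma>. \<forall>e\<in>arrows \<E>.
          T (pure_tensor R (sectional_algebra R \<Lambda> \<Gamma> \<pi>) (semigroupoid_algebra R RT \<E>) \<alpha> f) (\<gamma>, e) =
            (fib_rscal \<pi> (\<alpha> \<gamma>) (f e), e))"

end

theory Submission
  imports Defs
begin

text \<open>
  The section that corresponds to a pure tensor \<open>\<alpha> \<otimes> f\<close> is \<open>(\<gamma>, e) \<mapsto> (\<alpha>(\<gamma>)f(e), e)\<close>. If \<open>\<alpha>\<close> and \<open>f\<close>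
  have compact supports in \<open>V\<close> and \<open>W\<close>, then it is continuous on \<open>V \<times> W\<close> and vanishes outside of a
  product of two compact sets. It depends on \<open>\<alpha>\<close> and \<open>f\<close> in a biadditive and balanced way, so that
  the universal property (\<open>tensor_lift\<close>) yields the map; it is unique because pure tensors generate.
  Throughout, the algebras are treated as additive spans of their compactly supported generators,
  and the functions on \<open>\<E>\<close> as the sections of the trivial bundle \<open>R \<times> \<E>\<close>, so that one theory of
  sectional algebras serves both factors.

  Part (a) makes sense only because both factors are closed under convolution, and this is where
  local \<open>R\<close>-normality enters: bump functions decompose a generator into sections supported in open
  bisections (\<open>Cc_bisection_span\<close>). On the product of two bisections every arrow has exactly one
  factorisation, whose factors are continuous functions of the arrow, so that a product of two such
  sections is again a generator (\<open>conv_Cc_bisections\<close>). Multiplicativity is then the distributive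
  law, because a factorisation in \<open>\<Gamma> \<times> \<E>\<close> is a pair of factorisations (\<open>outer_mult\<close>).

  For (b), a continuous section of \<open>\<pi> \<times> \<E>\<close> is, locally, \<open>(\<gamma>, e) \<mapsto> (t(\<gamma>), e)\<close> with a local inverse \<open>t\<close>
  of \<open>\<pi>\<close>. On a box with compact open sides it is therefore \<open>t \<otimes> 1\<close>, and finitely many such boxes
  cover the support. Boxes that meet intersect in a box, so that inclusion and exclusion puts the
  pieces together (\<open>zero_outside_Union_pure_boxes\<close>).

  For (c) and (d), an element \<open>\<Sigma> \<alpha>\<^sub>i \<otimes> f\<^sub>i\<close> of the kernel is one with \<open>\<Sigma> \<alpha>\<^sub>i(\<gamma>)f\<^sub>i(e) = 0\<close> for all \<open>\<gamma>\<close> and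
  \<open>e\<close>. If \<open>R\<close> is discrete and \<open>\<E>\<close> is Hausdorff, then the \<open>f\<^sub>i\<close> are combinations of indicator functions of
  finitely many common level sets; rewritten in terms of these, the coefficients of the sum are values
  of the above kind, hence zero. If \<open>R\<close> is a field and \<open>f\<^sub>k(e) \<noteq> 0\<close>, then the relation at \<open>e\<close> expresses
  \<open>\<alpha>\<^sub>k\<close> by the other \<open>\<alpha>\<^sub>i\<close>, which shortens the sum.
\<close>

section \<open>Additive maps and additive spans\<close>

lemma additive_zero:
  assumes "abelian_group A" "abelian_group B" "h \<in> carrier A \<rightarrow> carrier B"
    and "\<And>x y. x \<in> carrier A \<Longrightarrow> y \<in> carrier A \<Longrightarrow> h (x \<oplus>\<^bsub>A\<^esub> y) = h x \<oplus>\<^bsub>B\<^esub> h y"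
  shows "h \<zero>\<^bsub>A\<^esub> = \<zero>\<^bsub>B\<^esub>"
proof -
  interpret A: abelian_group A by fact
  interpret B: abelian_group B by fact
  have "h \<zero>\<^bsub>A\<^esub> \<oplus>\<^bsub>B\<^esub> h \<zero>\<^bsub>A\<^esub> = h \<zero>\<^bsub>A\<^esub>" using assms(4)[of "\<zero>\<^bsub>A\<^esub>" "\<zero>\<^bsub>A\<^esub>"] by simp
  moreover have "h \<zero>\<^bsub>A\<^esub> \<in> carrier B" using assms(3) by auto
  ultimately show ?thesis by (metis B.add.l_cancel_one')
qed

lemma additive_neg:
  assumes "abelian_group A" "abelian_group B" "h \<in> carrier A \<rightarrow> carrier B"
    and add: "\<And>x y. x \<in> carrier A \<Longrightarrow> y \<in> carrier A \<Longrightarrow> h (x \<oplus>\<^bsub>A\<^esub> y) = h x \<oplus>\<^bsub>B\<^esub> h y"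
    and x: "x \<in> carrier A"
  shows "h (\<ominus>\<^bsub>A\<^esub> x) = \<ominus>\<^bsub>B\<^esub> h x"
proof -
  interpret A: abelian_group A by fact
  interpret B: abelian_group B by fact
  have "h (\<ominus>\<^bsub>A\<^esub> x) \<oplus>\<^bsub>B\<^esub> h x = \<zero>\<^bsub>B\<^esub>"
    using add[of "\<ominus>\<^bsub>A\<^esub> x" x] x additive_zero[OF assms(1-4)] by (simp add: A.l_neg)
  then show ?thesis
    using assms(3) x by (metis A.a_inv_closed B.minus_equality funcset_mem)
qed

lemma additive_finsum:
  assumes "abelian_group A" "abelian_group B" "h \<in> carrier A \<rightarrow> carrier B"
    and add: "\<And>x y. x \<in> carrier A \<Longrightarrow> y \<in> carrier A \<Longrightarrow> h (x \<oplus>\<^bsub>A\<^esub> y) = h x \<oplus>\<^bsub>B\<^esub> h y"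
    and f: "f \<in> I \<rightarrow> carrier A"
  shows "h (finsum A f I) = finsum B (\<lambda>i. h (f i)) I"
proof -
  interpret A: abelian_group A by fact
  interpret B: abelian_group B by fact
  note h0 = additive_zero[OF assms(1-4)]
  show ?thesis using f
  proof (induction I rule: infinite_finite_induct)
    case (insert i I)
    then have "f i \<in> carrier A" "f \<in> I \<rightarrow> carrier A" "(\<lambda>i. h (f i)) \<in> I \<rightarrow> carrier B" "h (f i) \<in> carrier B"
      using assms(3) by auto
    then show ?case using insert by (simp add: add)
  qed (simp_all add: h0)
qed

lemma finsum_Times:
  fixes G :: "('m, 'k) ring_scheme"
  assumes "abelian_group G" and "finite A" and B: "finite B"
    and F: "\<And>a b. a \<in> A \<Longrightarrow> b \<in> B \<Longrightarrow> F a b \<in> carrier G"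
  shows "finsum G (\<lambda>(a, b). F a b) (A \<times> B) = finsum G (\<lambda>a. finsum G (F a) B) A"
proof -
  interpret G: abelian_group G by fact
  show ?thesis
    using \<open>finite A\<close> F
  proof (induction A rule: finite_induct)
    case (insert x A)
    have "insert x A \<times> B = {x} \<times> B \<union> A \<times> B" by auto
    then have "finsum G (\<lambda>(a, b). F a b) (insert x A \<times> B) =
        finsum G (\<lambda>(a, b). F a b) ({x} \<times> B) \<oplus>\<^bsub>G\<^esub> finsum G (\<lambda>(a, b). F a b) (A \<times> B)"
      by (simp only:) (rule G.finsum_Un_disjoint; use insert B in auto)
    also have "finsum G (\<lambda>(a, b). F a b) ({x} \<times> B) = finsum G (F x) B"
    proof -
      have im: "{x} \<times> B = Pair x ` B" by auto
      have "finsum G (\<lambda>(a, b). F a b) (Pair x ` B) = finsum G (\<lambda>b. (\<lambda>(a, b). F a b) (x, b)) B"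
        by (rule G.finsum_reindex) (use insert in \<open>auto simp: inj_on_def\<close>)
      then show ?thesis unfolding im by simp
    qed
    also have "finsum G (\<lambda>(a, b). F a b) (A \<times> B) = finsum G (\<lambda>a. finsum G (F a) B) A"
      using insert by simp
    also have "finsum G (F x) B \<oplus>\<^bsub>G\<^esub> finsum G (\<lambda>a. finsum G (F a) B) A =
        finsum G (\<lambda>a. finsum G (F a) B) (insert x A)"
      by (rule G.finsum_insert[symmetric]) (use insert in \<open>auto intro!: G.finsum_closed\<close>)
    finally show ?case .
  qed simp
qed

lemma finsum_swap:
  fixes G :: "('m, 'k) ring_scheme"
  assumes "abelian_group G" and "finite A" and B: "finite B"
    and F: "\<And>a b. a \<in> A \<Longrightarrow> b \<in> B \<Longrightarrow> F a b \<in> carrier G"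
  shows "finsum G (\<lambda>a. finsum G (F a) B) A = finsum G (\<lambda>b. finsum G (\<lambda>a. F a b) A) B"
proof -
  interpret G: abelian_group G by fact
  show ?thesis
    using \<open>finite A\<close> F
  proof (induction A rule: finite_induct)
    case (insert x A)
    have "finsum G (\<lambda>a. finsum G (F a) B) (insert x A) =
        finsum G (F x) B \<oplus>\<^bsub>G\<^esub> finsum G (\<lambda>a. finsum G (F a) B) A"
      by (rule G.finsum_insert) (use insert in \<open>auto intro!: G.finsum_closed\<close>)
    also have "\<dots> = finsum G (F x) B \<oplus>\<^bsub>G\<^esub> finsum G (\<lambda>b. finsum G (\<lambda>a. F a b) A) B"
      using insert by simp
    also have "\<dots> = finsum G (\<lambda>b. F x b \<oplus>\<^bsub>G\<^esub> finsum G (\<lambda>a. F a b) A) B"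
      by (rule G.finsum_addf[symmetric]) (use insert in \<open>auto intro!: G.finsum_closed\<close>)
    also have "\<dots> = finsum G (\<lambda>b. finsum G (\<lambda>a. F a b) (insert x A)) B"
      by (rule G.finsum_cong'[OF refl]) (use insert in \<open>auto intro!: G.finsum_closed\<close>)
    finally show ?case .
  qed simp
qed

context bimodule
begin

lemma lscal_zero [simp]: "r \<in> carrier R \<Longrightarrow> lscal M r \<zero>\<^bsub>M\<^esub> = \<zero>\<^bsub>M\<^esub>"
  by (rule additive_zero[of M M]) (auto simp: lscal_closed lscal_add M.abelian_group_axioms)

lemma rscal_zero [simp]: "r \<in> carrier R \<Longrightarrow> rscal M \<zero>\<^bsub>M\<^esub> r = \<zero>\<^bsub>M\<^esub>"
  by (rule additive_zero[of M M "\<lambda>m. rscal M m r"]) (auto simp: rscal_closed rscal_add M.abelian_group_axioms)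

lemma lscal_zero_scalar [simp]: "m \<in> carrier M \<Longrightarrow> lscal M \<zero>\<^bsub>R\<^esub> m = \<zero>\<^bsub>M\<^esub>"
  by (rule additive_zero[of R M "\<lambda>r. lscal M r m"])
    (auto simp: lscal_closed lscal_add_scalar M.abelian_group_axioms R.abelian_group_axioms)

lemma rscal_zero_scalar [simp]: "m \<in> carrier M \<Longrightarrow> rscal M m \<zero>\<^bsub>R\<^esub> = \<zero>\<^bsub>M\<^esub>"
  by (rule additive_zero[of R M "\<lambda>r. rscal M m r"])
    (auto simp: rscal_closed rscal_add_scalar M.abelian_group_axioms R.abelian_group_axioms)

lemma lscal_minus_one: "m \<in> carrier M \<Longrightarrow> lscal M (\<ominus>\<^bsub>R\<^esub> \<one>\<^bsub>R\<^esub>) m = \<ominus>\<^bsub>M\<^esub> m"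
  using additive_neg[of R M "\<lambda>r. lscal M r m" "\<one>\<^bsub>R\<^esub>"]
  by (auto simp: lscal_closed lscal_add_scalar lscal_one M.abelian_group_axioms R.abelian_group_axioms)

end

text \<open>Both algebras are generated by sets that absorb scalars. For such a set the generated
  subbimodule and the generated subgroup are the same additive span, so that every property of
  their elements can be proved by induction on sums of generators.\<close>

inductive_set add_span :: "('m, 'k) ring_scheme \<Rightarrow> 'm set \<Rightarrow> 'm set"
  for M :: "('m, 'k) ring_scheme" and X :: "'m set" where
  zero: "\<zero>\<^bsub>M\<^esub> \<in> add_span M X"
| incl: "x \<in> X \<Longrightarrow> x \<in> add_span M X"
| add: "x \<in> add_span M X \<Longrightarrow> y \<in> add_span M X \<Longrightarrow> x \<oplus>\<^bsub>M\<^esub> y \<in> add_span M X"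

definition scalar_closed :: "'r ring \<Rightarrow> ('r, 'm) bimod \<Rightarrow> 'm set \<Rightarrow> bool" where
  "scalar_closed R M X \<longleftrightarrow> X \<subseteq> carrier M \<and>
     (\<forall>r\<in>carrier R. \<forall>x\<in>X. lscal M r x \<in> X \<and> rscal M x r \<in> X)"

text \<open>Negation is multiplication by \<open>-1\<close>, so that closure under scalars includes closure under
  negatives.\<close>

lemma sub_bimodule:
  assumes "bimodule R M" and S: "S \<subseteq> carrier M" and zero: "\<zero>\<^bsub>M\<^esub> \<in> S"
    and add: "\<And>x y. x \<in> S \<Longrightarrow> y \<in> S \<Longrightarrow> x \<oplus>\<^bsub>M\<^esub> y \<in> S"
    and lscal: "\<And>r x. r \<in> carrier R \<Longrightarrow> x \<in> S \<Longrightarrow> lscal M r x \<in> S"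
    and rscal: "\<And>r x. r \<in> carrier R \<Longrightarrow> x \<in> S \<Longrightarrow> rscal M x r \<in> S"
  shows "bimodule R (M\<lparr>carrier := S\<rparr>)"
proof -
  interpret bimodule R M by fact
  have "abelian_group (M\<lparr>carrier := S\<rparr>)"
  proof (rule abelian_groupI)
    fix x assume "x \<in> carrier (M\<lparr>carrier := S\<rparr>)"
    then have x: "x \<in> S" by simp
    have "lscal M (\<ominus>\<^bsub>R\<^esub> \<one>\<^bsub>R\<^esub>) x \<oplus>\<^bsub>M\<^esub> x = \<zero>\<^bsub>M\<^esub>"
      using x S by (auto simp: lscal_minus_one M.l_neg)
    then show "\<exists>y\<in>carrier (M\<lparr>carrier := S\<rparr>). y \<oplus>\<^bsub>M\<lparr>carrier := S\<rparr>\<^esub> x = \<zero>\<^bsub>M\<lparr>carrier := S\<rparr>\<^esub>"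
      using lscal[of "\<ominus>\<^bsub>R\<^esub> \<one>\<^bsub>R\<^esub>" x] x by (intro bexI[of _ "lscal M (\<ominus>\<^bsub>R\<^esub> \<one>\<^bsub>R\<^esub>) x"]) simp_all
  qed (use S zero add in \<open>auto simp: subset_iff M.a_assoc intro: M.a_comm\<close>)
  then show ?thesis
    by (intro bimodule.intro bimodule_axioms.intro R.ring_axioms)
      (use S lscal rscal in \<open>auto simp: subset_iff lscal_add lscal_add_scalar lscal_mult lscal_one
        rscal_add rscal_add_scalar rscal_mult rscal_one lscal_rscal\<close>)
qed

context bimodule
begin

lemma add_span_subset:
  assumes "X \<subseteq> carrier M"
  shows "add_span M X \<subseteq> carrier M"
proof
  fix x assume "x \<in> add_span M X"
  then show "x \<in> carrier M" by induction (use assms in auto)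
qed

lemma add_span_scal:
  assumes X: "scalar_closed R M X" and x: "x \<in> add_span M X" and r: "r \<in> carrier R"
  shows "lscal M r x \<in> add_span M X" "rscal M x r \<in> add_span M X"
proof -
  have "X \<subseteq> carrier M" using X by (simp add: scalar_closed_def)
  note sub = subsetD[OF add_span_subset[OF this]]
  have "lscal M r x \<in> add_span M X \<and> rscal M x r \<in> add_span M X"
    using x
  proof induction
    case zero
    then show ?case using r by (simp add: add_span.zero)
  next
    case (incl x)
    then show ?case using r X by (auto simp: scalar_closed_def intro: add_span.incl)
  next
    case (add x y)
    then show ?case using r sub by (auto simp: lscal_add rscal_add intro: add_span.add)
  qed
  then show "lscal M r x \<in> add_span M X" "rscal M x r \<in> add_span M X" by auto
qed

lemma add_span_neg:
  assumes "scalar_closed R M X" "x \<in> add_span M X"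
  shows "\<ominus>\<^bsub>M\<^esub> x \<in> add_span M X"
proof -
  have "x \<in> carrier M" using assms add_span_subset[of X] by (auto simp: scalar_closed_def)
  then show ?thesis
    using add_span_scal(1)[OF assms, of "\<ominus>\<^bsub>R\<^esub> \<one>\<^bsub>R\<^esub>"] by (simp add: lscal_minus_one)
qed

lemma bimod_span_eq_add_span:
  assumes "scalar_closed R M X"
  shows "bimod_span R M X = add_span M X"
proof (intro equalityI subsetI)
  fix x assume "x \<in> bimod_span R M X"
  then show "x \<in> add_span M X"
    by induction (auto intro: add_span.intros add_span_scal[OF assms])
next
  fix x assume "x \<in> add_span M X"
  then show "x \<in> bimod_span R M X" by induction (auto intro: bimod_span.intros)
qed

lemma generate_eq_add_span:
  assumes "scalar_closed R M X"
  shows "generate (add_monoid M) X = add_span M X"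
proof (intro equalityI subsetI)
  fix x assume "x \<in> generate (add_monoid M) X"
  then show "x \<in> add_span M X"
  proof induction
    case one
    then show ?case by (simp add: add_span.zero)
  next
    case (inv h)
    then show ?case using add_span_neg[OF assms add_span.incl[of h X]] by (simp add: a_inv_def)
  qed (auto intro: add_span.intros)
next
  fix x assume "x \<in> add_span M X"
  then show "x \<in> generate (add_monoid M) X"
  proof induction
    case zero
    then show ?case using generate.one[of "add_monoid M" X] by simp
  next
    case (add x y)
    then show ?case using generate.eng[of x "add_monoid M" X y] by simp
  qed (auto intro: generate.incl)
qed

lemma bimodule_add_span:
  assumes "scalar_closed R M X"
  shows "bimodule R (M\<lparr>carrier := add_span M X\<rparr>)"
  by (rule sub_bimodule[OF bimodule_axioms])
    (use assms add_span_subset[of X] add_span_scal[OF assms] in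
      \<open>auto simp: scalar_closed_def intro: add_span.intros\<close>)

end

section \<open>Tensor products\<close>

locale bimodule_pair = M: bimodule R M + N: bimodule R N
  for R :: "'r ring" and M :: "('r, 'm) bimod" and N :: "('r, 'n) bimod"
begin

abbreviation "F \<equiv> tensor_free M N"
abbreviation "K \<equiv> tensor_rels R M N"
abbreviation "cls \<equiv> tensor_class R M N"
abbreviation "MN \<equiv> tensor R M N"
abbreviation "pure \<equiv> pure_tensor R M N"

definition rel_gens :: "('m \<times> 'n \<Rightarrow>\<^sub>0 int) set" where
  "rel_gens = {frag_of (m \<oplus>\<^bsub>M\<^esub> m', n) - (frag_of (m, n) + frag_of (m', n)) | m m' n.
         m \<in> carrier M \<and> m' \<in> carrier M \<and> n \<in> carrier N} \<union>
      {frag_of (m, n \<oplus>\<^bsub>N\<^esub> n') - (frag_of (m, n) + frag_of (m, n')) | m n n'.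
         m \<in> carrier M \<and> n \<in> carrier N \<and> n' \<in> carrier N} \<union>
      {frag_of (rscal M m r, n) - frag_of (m, lscal N r n) | m r n.
         m \<in> carrier M \<and> r \<in> carrier R \<and> n \<in> carrier N}"

lemma rels_eq: "K = generate F rel_gens"
  by (simp add: tensor_rels_def rel_gens_def)

sublocale F: comm_group F
  unfolding tensor_free_def by (rule abelian_free_Abelian_group)

lemma F_simps [simp]:
  "x \<otimes>\<^bsub>F\<^esub> y = x + y" "\<one>\<^bsub>F\<^esub> = 0" "x \<in> carrier F \<Longrightarrow> inv\<^bsub>F\<^esub> x = - x"
  by (simp_all add: tensor_free_def)

lemma F_carrier: "x \<in> carrier F \<longleftrightarrow> Poly_Mapping.keys x \<subseteq> carrier M \<times> carrier N"
  by (simp add: tensor_free_def)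

lemma frag_of_F [simp]: "frag_of p \<in> carrier F \<longleftrightarrow> p \<in> carrier M \<times> carrier N"
  by (simp add: tensor_free_def)

lemma F_add [simp]: "x \<in> carrier F \<Longrightarrow> y \<in> carrier F \<Longrightarrow> x + y \<in> carrier F"
  using F.m_closed[of x y] by simp

lemma F_minus [simp]: "x \<in> carrier F \<Longrightarrow> - x \<in> carrier F"
  using F.inv_closed[of x] by simp

lemma F_diff [simp]: "x \<in> carrier F \<Longrightarrow> y \<in> carrier F \<Longrightarrow> x - y \<in> carrier F"
  using F_add[OF _ F_minus, of x y] by simp

lemma F_zero [simp]: "0 \<in> carrier F"
  using F.one_closed by simp

lemma F_induct [consumes 1, case_names zero diff of]:
  assumes "x \<in> carrier F" "P 0"
    "\<And>x y. x \<in> carrier F \<Longrightarrow> y \<in> carrier F \<Longrightarrow> P x \<Longrightarrow> P y \<Longrightarrow> P (x - y)"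
    "\<And>m n. m \<in> carrier M \<Longrightarrow> n \<in> carrier N \<Longrightarrow> P (frag_of (m, n))"
  shows "P x"
  using assms(1)[unfolded F_carrier]
  by (rule free_Abelian_group_induct) (use assms in \<open>auto simp: F_carrier\<close>)

lemma rel_gens_F: "rel_gens \<subseteq> carrier F"
  by (auto simp: rel_gens_def M.rscal_closed N.lscal_closed)

lemma K_subgroup: "subgroup K F"
  unfolding rels_eq by (rule F.generate_is_subgroup[OF rel_gens_F])

lemma K_F: "x \<in> K \<Longrightarrow> x \<in> carrier F"
  using subgroup.subset[OF K_subgroup] by auto

lemma K_zero: "0 \<in> K"
  using subgroup.one_closed[OF K_subgroup] by simp

lemma K_add: "x \<in> K \<Longrightarrow> y \<in> K \<Longrightarrow> x + y \<in> K"
  using subgroup.m_closed[OF K_subgroup, of x y] by simp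

lemma K_minus: "x \<in> K \<Longrightarrow> - x \<in> K"
  using subgroup.m_inv_closed[OF K_subgroup, of x] K_F[of x] by simp

lemma K_diff: "x \<in> K \<Longrightarrow> y \<in> K \<Longrightarrow> x - y \<in> K"
  using K_add[OF _ K_minus, of x y] by simp

lemma K_gen: "x \<in> rel_gens \<Longrightarrow> x \<in> K"
  unfolding rels_eq by (rule generate.incl)

lemma K_induct [consumes 1, case_names zero diff gen]:
  assumes "x \<in> K" "P 0"
    and diff: "\<And>x y. x \<in> K \<Longrightarrow> y \<in> K \<Longrightarrow> P x \<Longrightarrow> P y \<Longrightarrow> P (x - y)"
    and gen: "\<And>x. x \<in> rel_gens \<Longrightarrow> P x"
  shows "P x"
  using assms(1)[unfolded rels_eq]
proof induction
  case one
  then show ?case using assms(2) by simp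
next
  case (incl h)
  then show ?case by (rule gen)
next
  case (inv h)
  then have "h \<in> carrier F" using rel_gens_F by auto
  moreover have "P (0 - h)" using inv K_gen by (intro diff K_zero assms(2) gen) auto
  ultimately show ?case by simp
next
  case (eng h1 h2)
  then have K: "h1 \<in> K" "h2 \<in> K" by (simp_all add: rels_eq)
  have "P (0 - h2)" by (rule diff[OF K_zero K(2) assms(2) eng.IH(2)])
  then have "P (h1 - (0 - h2))" by (rule diff[OF K(1) K_diff[OF K_zero K(2)] eng.IH(1)])
  then show ?case by simp
qed

lemma mem_cls: "y \<in> cls x \<longleftrightarrow> (\<exists>k\<in>K. y = k + x)"
  by (auto simp: tensor_class_def r_coset_def)

lemma self_cls: "x \<in> cls x"
  using K_zero by (force simp: mem_cls)

lemma cls_eq_iff: "cls x = cls y \<longleftrightarrow> x - y \<in> K"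
proof
  assume "cls x = cls y"
  then have "x \<in> cls y" using self_cls by auto
  then show "x - y \<in> K" by (auto simp: mem_cls)
next
  have sub: "cls x \<subseteq> cls y" if "x - y \<in> K" for x y
  proof
    fix z assume "z \<in> cls x"
    then obtain k where "k \<in> K" "z = k + x" by (auto simp: mem_cls)
    then have "z = (k + (x - y)) + y" "k + (x - y) \<in> K" using that by (auto intro: K_add)
    then show "z \<in> cls y" unfolding mem_cls by blast
  qed
  assume "x - y \<in> K"
  moreover from this have "y - x \<in> K" using K_minus by force
  ultimately show "cls x = cls y" using sub by blast
qed

lemma tensor_carrier: "carrier MN = cls ` carrier F"
  by (auto simp: tensor_def FactGroup_def RCOSETS_def tensor_class_def)

lemma cls_closed [simp]: "x \<in> carrier F \<Longrightarrow> cls x \<in> carrier MN"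
  by (simp add: tensor_carrier)

lemma cls_cases [consumes 1]:
  assumes "X \<in> carrier MN"
  obtains x where "x \<in> carrier F" "X = cls x"
  using assms by (auto simp: tensor_carrier)

lemma cls_add: "x \<in> carrier F \<Longrightarrow> y \<in> carrier F \<Longrightarrow> cls x \<oplus>\<^bsub>MN\<^esub> cls y = cls (x + y)"
  using normal.rcos_sum[OF F.subgroup_imp_normal[OF K_subgroup], of x y]
  by (simp add: tensor_def FactGroup_def tensor_class_def)

lemma cls_zero: "\<zero>\<^bsub>MN\<^esub> = cls 0"
  by (auto simp: tensor_def FactGroup_def mem_cls)

lemma abelian_group_tensor: "abelian_group MN"
proof (rule abelian_groupI)
  fix X assume "X \<in> carrier MN"
  then obtain x where x: "x \<in> carrier F" "X = cls x" by (rule cls_cases)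
  then have "cls (- x) \<oplus>\<^bsub>MN\<^esub> X = \<zero>\<^bsub>MN\<^esub>" by (simp add: cls_add cls_zero)
  then show "\<exists>Y\<in>carrier MN. Y \<oplus>\<^bsub>MN\<^esub> X = \<zero>\<^bsub>MN\<^esub>" using x by (intro bexI[of _ "cls (- x)"]) auto
qed (auto elim!: cls_cases simp: cls_add cls_zero algebra_simps)

sublocale T: abelian_group MN by (rule abelian_group_tensor)

lemma pure_cls: "pure m n = cls (frag_of (m, n))"
  by (simp add: pure_tensor_def)

lemma pure_closed [simp]: "m \<in> carrier M \<Longrightarrow> n \<in> carrier N \<Longrightarrow> pure m n \<in> carrier MN"
  by (simp add: pure_cls)

lemma K_add_left: "m \<in> carrier M \<Longrightarrow> m' \<in> carrier M \<Longrightarrow> n \<in> carrier N \<Longrightarrow>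
    frag_of (m \<oplus>\<^bsub>M\<^esub> m', n) - (frag_of (m, n) + frag_of (m', n)) \<in> K"
  by (rule K_gen) (auto simp: rel_gens_def)

lemma K_add_right: "m \<in> carrier M \<Longrightarrow> n \<in> carrier N \<Longrightarrow> n' \<in> carrier N \<Longrightarrow>
    frag_of (m, n \<oplus>\<^bsub>N\<^esub> n') - (frag_of (m, n) + frag_of (m, n')) \<in> K"
  by (rule K_gen) (auto simp: rel_gens_def)

lemma K_balanced: "m \<in> carrier M \<Longrightarrow> r \<in> carrier R \<Longrightarrow> n \<in> carrier N \<Longrightarrow>
    frag_of (rscal M m r, n) - frag_of (m, lscal N r n) \<in> K"
  by (rule K_gen) (auto simp: rel_gens_def)

lemma pure_add_left:
  "m \<in> carrier M \<Longrightarrow> m' \<in> carrier M \<Longrightarrow> n \<in> carrier N \<Longrightarrow>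
    pure (m \<oplus>\<^bsub>M\<^esub> m') n = pure m n \<oplus>\<^bsub>MN\<^esub> pure m' n"
  by (simp add: pure_cls cls_add cls_eq_iff K_add_left)

lemma pure_add_right:
  "m \<in> carrier M \<Longrightarrow> n \<in> carrier N \<Longrightarrow> n' \<in> carrier N \<Longrightarrow>
    pure m (n \<oplus>\<^bsub>N\<^esub> n') = pure m n \<oplus>\<^bsub>MN\<^esub> pure m n'"
  by (simp add: pure_cls cls_add cls_eq_iff K_add_right)

lemma pure_balanced:
  "m \<in> carrier M \<Longrightarrow> r \<in> carrier R \<Longrightarrow> n \<in> carrier N \<Longrightarrow> pure (rscal M m r) n = pure m (lscal N r n)"
  by (simp add: pure_cls cls_eq_iff K_balanced)

lemma pure_zero_left: "n \<in> carrier N \<Longrightarrow> pure \<zero>\<^bsub>M\<^esub> n = \<zero>\<^bsub>MN\<^esub>"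
  by (rule additive_zero[of M MN "\<lambda>m. pure m n"])
    (auto simp: pure_add_left M.M.abelian_group_axioms T.abelian_group_axioms)

lemma pure_zero_right: "m \<in> carrier M \<Longrightarrow> pure m \<zero>\<^bsub>N\<^esub> = \<zero>\<^bsub>MN\<^esub>"
  by (rule additive_zero[of N MN "\<lambda>n. pure m n"])
    (auto simp: pure_add_right N.M.abelian_group_axioms T.abelian_group_axioms)

lemma pure_finsum_left:
  "h \<in> I \<rightarrow> carrier M \<Longrightarrow> n \<in> carrier N \<Longrightarrow> pure (finsum M h I) n = finsum MN (\<lambda>i. pure (h i) n) I"
  by (rule additive_finsum[OF M.M.abelian_group_axioms T.abelian_group_axioms, of "\<lambda>m. pure m n"])
    (auto simp: pure_add_left)

lemma pure_finsum_right:
  "m \<in> carrier M \<Longrightarrow> h \<in> I \<rightarrow> carrier N \<Longrightarrow> pure m (finsum N h I) = finsum MN (\<lambda>i. pure m (h i)) I"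
  by (rule additive_finsum[OF N.M.abelian_group_axioms T.abelian_group_axioms, of "pure m"])
    (auto simp: pure_add_right)

lemma pure_neg_left: "m \<in> carrier M \<Longrightarrow> n \<in> carrier N \<Longrightarrow> pure (\<ominus>\<^bsub>M\<^esub> m) n = \<ominus>\<^bsub>MN\<^esub> pure m n"
  by (rule additive_neg[of M MN "\<lambda>m. pure m n"])
    (auto simp: pure_add_left M.M.abelian_group_axioms T.abelian_group_axioms)

lemma cls_neg: "x \<in> carrier F \<Longrightarrow> cls (- x) = \<ominus>\<^bsub>MN\<^esub> cls x"
  by (rule sym, rule T.minus_equality) (simp_all add: cls_add cls_zero)

text \<open>Signs can be absorbed by the first factor, so that sums of pure tensors, without integer
  coefficients, exhaust the tensor product.\<close>

lemma tensor_span: "carrier MN = add_span MN {pure m n | m n. m \<in> carrier M \<and> n \<in> carrier N}"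
  (is "_ = add_span MN ?P")
proof (intro equalityI subsetI)
  fix X assume "X \<in> add_span MN ?P"
  then show "X \<in> carrier MN" by induction auto
next
  have neg: "\<ominus>\<^bsub>MN\<^esub> X \<in> add_span MN ?P \<and> X \<in> carrier MN" if "X \<in> add_span MN ?P" for X
    using that
  proof induction
    case zero
    have "\<ominus>\<^bsub>MN\<^esub> \<zero>\<^bsub>MN\<^esub> = \<zero>\<^bsub>MN\<^esub>" by (rule T.minus_equality) auto
    then show ?case by (simp only: add_span.zero T.zero_closed simp_thms)
  next
    case (incl x)
    then obtain m n where "x = pure m n" "m \<in> carrier M" "n \<in> carrier N" by auto
    then show ?case
      by (auto simp: pure_neg_left[symmetric] intro!: add_span.incl)
  next
    case (add x y)
    then show ?case by (auto simp: T.minus_add intro: add_span.add)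
  qed
  fix X assume "X \<in> carrier MN"
  then obtain x where x: "x \<in> carrier F" "X = cls x" by (rule cls_cases)
  have "cls x \<in> add_span MN ?P" using x(1)
  proof (induction rule: F_induct)
    case zero
    then show ?case by (simp add: add_span.zero flip: cls_zero)
  next
    case (diff x y)
    then have "cls x \<oplus>\<^bsub>MN\<^esub> (\<ominus>\<^bsub>MN\<^esub> cls y) \<in> add_span MN ?P" using neg by (blast intro: add_span.add)
    then show ?case using diff by (simp add: cls_add flip: cls_neg)
  next
    case (of m n)
    then show ?case by (auto simp: pure_cls intro!: add_span.incl)
  qed
  then show "X \<in> add_span MN ?P" using x by simp
qed

lemma tensor_induct [consumes 1, case_names zero pure add]:
  assumes "X \<in> carrier MN" "P \<zero>\<^bsub>MN\<^esub>"
    and "\<And>m n. m \<in> carrier M \<Longrightarrow> n \<in> carrier N \<Longrightarrow> P (pure m n)"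
    and "\<And>X Y. X \<in> carrier MN \<Longrightarrow> Y \<in> carrier MN \<Longrightarrow> P X \<Longrightarrow> P Y \<Longrightarrow> P (X \<oplus>\<^bsub>MN\<^esub> Y)"
  shows "P X"
  using assms(1)[unfolded tensor_span]
  by induction (use assms in \<open>auto simp flip: tensor_span\<close>)

lemma tensor_finite_sum:
  assumes "X \<in> carrier MN"
  shows "\<exists>(k::nat) m n. m \<in> {..<k} \<rightarrow> carrier M \<and> n \<in> {..<k} \<rightarrow> carrier N \<and>
    X = finsum MN (\<lambda>i. pure (m i) (n i)) {..<k}"
  using assms[unfolded tensor_span]
proof induction
  case zero
  show ?case by (intro exI[of _ 0]) auto
next
  case (incl x)
  then obtain m n where mn: "x = pure m n" "m \<in> carrier M" "n \<in> carrier N" by auto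
  then have "x = finsum MN (\<lambda>i. pure m n) {..<Suc 0}" by (simp add: lessThan_Suc)
  then show ?case using mn by (intro exI[of _ "Suc 0"] exI[of _ "\<lambda>_. m"] exI[of _ "\<lambda>_. n"]) auto
next
  case (add x y)
  then obtain k :: nat and m n where 1: "m \<in> {..<k} \<rightarrow> carrier M" "n \<in> {..<k} \<rightarrow> carrier N"
    "x = finsum MN (\<lambda>i. pure (m i) (n i)) {..<k}" by blast
  from add obtain l :: nat and m' n' where 2: "m' \<in> {..<l} \<rightarrow> carrier M" "n' \<in> {..<l} \<rightarrow> carrier N"
    "y = finsum MN (\<lambda>i. pure (m' i) (n' i)) {..<l}" by blast
  define a where "a i = (if i < k then m i else m' (i - k))" for i
  define b where "b i = (if i < k then n i else n' (i - k))" for i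
  have ab: "a \<in> {..<k + l} \<rightarrow> carrier M" "b \<in> {..<k + l} \<rightarrow> carrier N"
    using 1(1,2) 2(1,2) by (auto simp: a_def b_def Pi_iff)
  have cl: "(\<lambda>i. pure (a i) (b i)) \<in> A \<rightarrow> carrier MN" if "A \<subseteq> {..<k + l}" for A
    using ab that by (auto simp: Pi_iff subset_iff)
  have Un: "{..<k + l} = {..<k} \<union> {k..<k + l}" by auto
  have "finsum MN (\<lambda>i. pure (a i) (b i)) ({..<k} \<union> {k..<k + l}) =
    finsum MN (\<lambda>i. pure (a i) (b i)) {..<k} \<oplus>\<^bsub>MN\<^esub> finsum MN (\<lambda>i. pure (a i) (b i)) {k..<k + l}"
    by (rule T.finsum_Un_disjoint[OF finite_lessThan finite_atLeastLessThan _ cl cl]) auto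
  also have "finsum MN (\<lambda>i. pure (a i) (b i)) {..<k} = x"
    unfolding 1(3) by (rule T.finsum_cong') (use 1(1,2) in \<open>auto simp: Pi_iff a_def b_def\<close>)
  also have "finsum MN (\<lambda>i. pure (a i) (b i)) {k..<k + l} = y"
  proof -
    have im: "{k..<k + l} = (\<lambda>i. i + k) ` {..<l}"
      by (simp add: add.commute lessThan_atLeast0)
    have "finsum MN (\<lambda>i. pure (a i) (b i)) {k..<k + l} =
        finsum MN (\<lambda>i. pure (a (i + k)) (b (i + k))) {..<l}"
      unfolding im
      by (rule T.finsum_reindex) (use ab in \<open>auto simp: inj_on_def Pi_iff\<close>)
    also have "\<dots> = y"
      unfolding 2(3) by (rule T.finsum_cong') (use 2(1,2) in \<open>auto simp: Pi_iff a_def b_def\<close>)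
    finally show ?thesis .
  qed
  finally have "x \<oplus>\<^bsub>MN\<^esub> y = finsum MN (\<lambda>i. pure (a i) (b i)) {..<k + l}" by (simp only: Un)
  with ab show ?case by blast
qed

text \<open>The map is given on representatives by the universal property of the free abelian group; it
  factors through the classes because it kills the generators of the relations.\<close>

lemma tensor_lift:
  fixes P :: "('p, 'k) ring_scheme"
  assumes P: "abelian_group P"
    and closed: "\<And>m n. m \<in> carrier M \<Longrightarrow> n \<in> carrier N \<Longrightarrow> \<phi> m n \<in> carrier P"
    and add_left: "\<And>m m' n. m \<in> carrier M \<Longrightarrow> m' \<in> carrier M \<Longrightarrow> n \<in> carrier N \<Longrightarrow>
        \<phi> (m \<oplus>\<^bsub>M\<^esub> m') n = \<phi> m n \<oplus>\<^bsub>P\<^esub> \<phi> m' n"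
    and add_right: "\<And>m n n'. m \<in> carrier M \<Longrightarrow> n \<in> carrier N \<Longrightarrow> n' \<in> carrier N \<Longrightarrow>
        \<phi> m (n \<oplus>\<^bsub>N\<^esub> n') = \<phi> m n \<oplus>\<^bsub>P\<^esub> \<phi> m n'"
    and bal: "\<And>m r n. m \<in> carrier M \<Longrightarrow> r \<in> carrier R \<Longrightarrow> n \<in> carrier N \<Longrightarrow>
        \<phi> (rscal M m r) n = \<phi> m (lscal N r n)"
  shows "\<exists>h \<in> carrier MN \<rightarrow>\<^sub>E carrier P.
    (\<forall>X\<in>carrier MN. \<forall>Y\<in>carrier MN. h (X \<oplus>\<^bsub>MN\<^esub> Y) = h X \<oplus>\<^bsub>P\<^esub> h Y) \<and>
    (\<forall>m\<in>carrier M. \<forall>n\<in>carrier N. h (pure m n) = \<phi> m n)"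
proof -
  interpret P: abelian_group P by fact
  have "(\<lambda>(m, n). \<phi> m n) ` (carrier M \<times> carrier N) \<subseteq> carrier (add_monoid P)"
    using closed by auto
  from comm_group.free_Abelian_group_universal[OF P.a_comm_group this]
  obtain g where g: "g \<in> hom F (add_monoid P)"
    and g_of: "\<And>x. x \<in> carrier M \<times> carrier N \<Longrightarrow> g (frag_of x) = (\<lambda>(m, n). \<phi> m n) x"
    unfolding tensor_free_def by metis
  have g_cl: "g x \<in> carrier P" if "x \<in> carrier F" for x
    using g that by (auto simp: hom_def)
  have g_add: "g (x + y) = g x \<oplus>\<^bsub>P\<^esub> g y" if "x \<in> carrier F" "y \<in> carrier F" for x y
    using g that by (auto simp: hom_def)
  have g_eq: "g x = g (x - y) \<oplus>\<^bsub>P\<^esub> g y" if "x \<in> carrier F" "y \<in> carrier F" for x y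
    using g_add[of "x - y" y] that by simp
  have g_0: "g 0 = \<zero>\<^bsub>P\<^esub>"
    using g_eq[of 0 0] g_cl[of 0] by (metis F_zero P.add.l_cancel_one' diff_0_right)
  have g_eqI: "g (x - y) = \<zero>\<^bsub>P\<^esub>" if "x \<in> carrier F" "y \<in> carrier F" "g x = g y" for x y
    using g_eq[of x y] that g_cl by (metis F_diff P.add.r_cancel_one')
  have g_K: "g x = \<zero>\<^bsub>P\<^esub>" if "x \<in> K" for x
    using that
  proof (induction rule: K_induct)
    case zero
    then show ?case by (rule g_0)
  next
    case (diff x y)
    then show ?case using K_F by (intro g_eqI) auto
  next
    case (gen x)
    then show ?case unfolding rel_gens_def
      by (auto intro!: g_eqI simp: g_of g_add M.rscal_closed N.lscal_closed add_left add_right bal)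
  qed
  define h where "h = (\<lambda>X\<in>carrier MN. g (SOME x. x \<in> carrier F \<and> X = cls x))"
  have h_cls: "h (cls x) = g x" if "x \<in> carrier F" for x
  proof -
    define y where "y = (SOME y. y \<in> carrier F \<and> cls x = cls y)"
    have y: "y \<in> carrier F" "cls x = cls y"
      unfolding y_def using someI_ex[of "\<lambda>y. y \<in> carrier F \<and> cls x = cls y"] that by auto
    then have "g (y - x) = \<zero>\<^bsub>P\<^esub>" by (intro g_K) (simp flip: cls_eq_iff)
    then have "g y = g x" using g_eq[OF y(1) that] g_cl that by simp
    then show ?thesis using that by (simp add: h_def y_def)
  qed
  show ?thesis
  proof (intro bexI[of _ h] conjI ballI)
    show "h \<in> carrier MN \<rightarrow>\<^sub>E carrier P"
    proof (rule PiE_I)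
      show "h X \<in> carrier P" if "X \<in> carrier MN" for X
        using that by (elim cls_cases) (simp add: h_cls g_cl)
    qed (simp add: h_def)
    show "h (X \<oplus>\<^bsub>MN\<^esub> Y) = h X \<oplus>\<^bsub>P\<^esub> h Y" if "X \<in> carrier MN" "Y \<in> carrier MN" for X Y
      using that by (elim cls_cases) (simp add: h_cls cls_add g_add)
    show "h (pure m n) = \<phi> m n" if "m \<in> carrier M" "n \<in> carrier N" for m n
      using that by (simp add: pure_cls h_cls g_of)
  qed
qed

lemma frag_extend_F:
  assumes "x \<in> carrier F" "\<And>m n. m \<in> carrier M \<Longrightarrow> n \<in> carrier N \<Longrightarrow> f (m, n) \<in> carrier F"
  shows "frag_extend f x \<in> carrier F"
  using assms(1)
  by (induction rule: F_induct) (simp_all add: frag_extend_diff assms(2))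

text \<open>The operations of the tensor product are unions over all representatives. An additive
  operation that preserves the relations takes a single class as its value on each of them.\<close>

lemma cls_frag_extend:
  assumes f: "\<And>k. k \<in> K \<Longrightarrow> frag_extend f k \<in> K"
  shows "(\<Union>x'\<in>cls x. cls (frag_extend f x')) = cls (frag_extend f x)"
proof -
  have "cls (frag_extend f x') = cls (frag_extend f x)" if "x' \<in> cls x" for x'
    using that f by (auto simp: mem_cls cls_eq_iff frag_extend_add)
  then show ?thesis using self_cls by blast
qed

lemma frag_extend_K:
  assumes k: "k \<in> K"
    and 1: "\<And>m m' n. m \<in> carrier M \<Longrightarrow> m' \<in> carrier M \<Longrightarrow> n \<in> carrier N \<Longrightarrow>
       f (m \<oplus>\<^bsub>M\<^esub> m', n) - (f (m, n) + f (m', n)) \<in> K"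
    and 2: "\<And>m n n'. m \<in> carrier M \<Longrightarrow> n \<in> carrier N \<Longrightarrow> n' \<in> carrier N \<Longrightarrow>
       f (m, n \<oplus>\<^bsub>N\<^esub> n') - (f (m, n) + f (m, n')) \<in> K"
    and 3: "\<And>m r n. m \<in> carrier M \<Longrightarrow> r \<in> carrier R \<Longrightarrow> n \<in> carrier N \<Longrightarrow>
       f (rscal M m r, n) - f (m, lscal N r n) \<in> K"
  shows "frag_extend f k \<in> K"
  using k
proof (induction rule: K_induct)
  case (gen x)
  then show ?case unfolding rel_gens_def
    by (auto simp: frag_extend_diff frag_extend_add 1 2 3)
qed (simp_all add: K_zero K_diff frag_extend_diff)

lemma lscal_cls:
  assumes r: "r \<in> carrier R"
  shows "lscal MN r (cls x) = cls (frag_extend (\<lambda>(m, n). frag_of (lscal M r m, n)) x)"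
proof -
  have "frag_extend (\<lambda>(m, n). frag_of (lscal M r m, n)) k \<in> K" if "k \<in> K" for k
    using that
    by (rule frag_extend_K)
      (simp_all add: r M.lscal_add M.lscal_rscal[symmetric] M.lscal_closed K_add_left K_add_right K_balanced)
  from cls_frag_extend[OF this, of x] show ?thesis by (simp add: tensor_def)
qed

lemma rscal_cls:
  assumes r: "r \<in> carrier R"
  shows "rscal MN (cls x) r = cls (frag_extend (\<lambda>(m, n). frag_of (m, rscal N n r)) x)"
proof -
  have "frag_extend (\<lambda>(m, n). frag_of (m, rscal N n r)) k \<in> K" if "k \<in> K" for k
    using that
    by (rule frag_extend_K)
      (simp_all add: r N.rscal_add N.lscal_rscal N.rscal_closed K_add_left K_add_right K_balanced)
  from cls_frag_extend[OF this, of x] show ?thesis by (simp add: tensor_def)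
qed

lemma scal_pure:
  assumes "r \<in> carrier R"
  shows "lscal MN r (pure m n) = pure (lscal M r m) n"
    and "rscal MN (pure m n) r = pure m (rscal N n r)"
  using assms by (simp_all add: pure_cls lscal_cls rscal_cls)

lemma scal_zero:
  assumes "r \<in> carrier R"
  shows "lscal MN r \<zero>\<^bsub>MN\<^esub> = \<zero>\<^bsub>MN\<^esub>" "rscal MN \<zero>\<^bsub>MN\<^esub> r = \<zero>\<^bsub>MN\<^esub>"
  using assms by (simp_all add: cls_zero lscal_cls rscal_cls)

lemma scal_add:
  assumes r: "r \<in> carrier R" and XY: "X \<in> carrier MN" "Y \<in> carrier MN"
  shows "lscal MN r (X \<oplus>\<^bsub>MN\<^esub> Y) = lscal MN r X \<oplus>\<^bsub>MN\<^esub> lscal MN r Y"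
    and "rscal MN (X \<oplus>\<^bsub>MN\<^esub> Y) r = rscal MN X r \<oplus>\<^bsub>MN\<^esub> rscal MN Y r"
proof -
  show "lscal MN r (X \<oplus>\<^bsub>MN\<^esub> Y) = lscal MN r X \<oplus>\<^bsub>MN\<^esub> lscal MN r Y"
    using XY by (elim cls_cases)
      (simp add: cls_add lscal_cls frag_extend_add frag_extend_F M.lscal_closed r)
  show "rscal MN (X \<oplus>\<^bsub>MN\<^esub> Y) r = rscal MN X r \<oplus>\<^bsub>MN\<^esub> rscal MN Y r"
    using XY by (elim cls_cases)
      (simp add: cls_add rscal_cls frag_extend_add frag_extend_F N.rscal_closed r)
qed

end

text \<open>The product \<open>mm' \<otimes> nn'\<close> respects the relations in both arguments because a scalar can be moved
  out of either factor, to the right of \<open>mm'\<close> and to the left of \<open>nn'\<close>, where it is balanced.\<close>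

locale algebra_pair = bimodule_pair R M N
  for R :: "'r ring" and M :: "('r, 'm) bimod" and N :: "('r, 'n) bimod" +
  assumes multM_closed: "m \<in> carrier M \<Longrightarrow> m' \<in> carrier M \<Longrightarrow> m \<otimes>\<^bsub>M\<^esub> m' \<in> carrier M"
    and multM_add_left: "m \<in> carrier M \<Longrightarrow> m' \<in> carrier M \<Longrightarrow> k \<in> carrier M \<Longrightarrow>
      (m \<oplus>\<^bsub>M\<^esub> m') \<otimes>\<^bsub>M\<^esub> k = m \<otimes>\<^bsub>M\<^esub> k \<oplus>\<^bsub>M\<^esub> m' \<otimes>\<^bsub>M\<^esub> k"
    and multM_add_right: "m \<in> carrier M \<Longrightarrow> m' \<in> carrier M \<Longrightarrow> k \<in> carrier M \<Longrightarrow>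
      k \<otimes>\<^bsub>M\<^esub> (m \<oplus>\<^bsub>M\<^esub> m') = k \<otimes>\<^bsub>M\<^esub> m \<oplus>\<^bsub>M\<^esub> k \<otimes>\<^bsub>M\<^esub> m'"
    and multM_scal: "r \<in> carrier R \<Longrightarrow> m \<in> carrier M \<Longrightarrow> m' \<in> carrier M \<Longrightarrow>
      rscal M m r \<otimes>\<^bsub>M\<^esub> m' = rscal M (m \<otimes>\<^bsub>M\<^esub> m') r \<and> m \<otimes>\<^bsub>M\<^esub> rscal M m' r = rscal M (m \<otimes>\<^bsub>M\<^esub> m') r"
    and multN_closed: "n \<in> carrier N \<Longrightarrow> n' \<in> carrier N \<Longrightarrow> n \<otimes>\<^bsub>N\<^esub> n' \<in> carrier N"
    and multN_add_left: "n \<in> carrier N \<Longrightarrow> n' \<in> carrier N \<Longrightarrow> l \<in> carrier N \<Longrightarrow>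
      (n \<oplus>\<^bsub>N\<^esub> n') \<otimes>\<^bsub>N\<^esub> l = n \<otimes>\<^bsub>N\<^esub> l \<oplus>\<^bsub>N\<^esub> n' \<otimes>\<^bsub>N\<^esub> l"
    and multN_add_right: "n \<in> carrier N \<Longrightarrow> n' \<in> carrier N \<Longrightarrow> l \<in> carrier N \<Longrightarrow>
      l \<otimes>\<^bsub>N\<^esub> (n \<oplus>\<^bsub>N\<^esub> n') = l \<otimes>\<^bsub>N\<^esub> n \<oplus>\<^bsub>N\<^esub> l \<otimes>\<^bsub>N\<^esub> n'"
    and multN_scal: "r \<in> carrier R \<Longrightarrow> n \<in> carrier N \<Longrightarrow> n' \<in> carrier N \<Longrightarrow>
      lscal N r n \<otimes>\<^bsub>N\<^esub> n' = lscal N r (n \<otimes>\<^bsub>N\<^esub> n') \<and> n \<otimes>\<^bsub>N\<^esub> lscal N r n' = lscal N r (n \<otimes>\<^bsub>N\<^esub> n')"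
begin

abbreviation "frag_pair x y \<equiv>
  frag_extend (\<lambda>(m, n). frag_extend (\<lambda>(m', n'). frag_of (m \<otimes>\<^bsub>M\<^esub> m', n \<otimes>\<^bsub>N\<^esub> n')) y) x"

text \<open>Extending a function of two variables additively may be done in either order. This exchanges
  the roles of the two arguments of a product, so that each of them is seen to be additive.\<close>

lemma frag_extend_swap:
  "frag_extend (\<lambda>p. frag_extend (h p) y) x = frag_extend (\<lambda>q. frag_extend (\<lambda>p. h p q) x) y"
proof -
  have add: "frag_extend (\<lambda>p. u p - v p) x = frag_extend u x - frag_extend v x"
    for u v :: "'x \<Rightarrow> 'z \<Rightarrow>\<^sub>0 int" and x
    using subset_UNIV by (induction x rule: frag_induction) (simp_all add: frag_extend_diff)
  show ?thesis using subset_UNIV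
    by (induction x rule: frag_induction) (simp_all add: frag_extend_diff add frag_extend_eq_0[of _ "\<lambda>_. 0"])
qed

lemma frag_pair_swap:
  "frag_pair x y = frag_extend (\<lambda>(m', n'). frag_extend (\<lambda>(m, n). frag_of (m \<otimes>\<^bsub>M\<^esub> m', n \<otimes>\<^bsub>N\<^esub> n')) x) y"
  using frag_extend_swap[of "\<lambda>(m, n) (m', n'). frag_of (m \<otimes>\<^bsub>M\<^esub> m', n \<otimes>\<^bsub>N\<^esub> n')" y x]
  by (simp add: case_prod_unfold)

lemma frag_pair_F: "x \<in> carrier F \<Longrightarrow> y \<in> carrier F \<Longrightarrow> frag_pair x y \<in> carrier F"
  by (intro frag_extend_F) (auto intro!: frag_extend_F simp: multM_closed multN_closed)

lemma frag_pair_K_left: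
  assumes k: "k \<in> K" and y: "y \<in> carrier F"
  shows "frag_pair k y \<in> K"
  unfolding frag_pair_swap using y
proof (induction rule: F_induct)
  case (of m n)
  then show ?case using k
    by (simp, intro frag_extend_K)
      (simp_all add: multM_add_left multN_add_left multM_scal multN_scal multM_closed multN_closed
        M.rscal_closed N.lscal_closed K_add_left K_add_right K_balanced)
qed (simp_all add: K_zero K_diff frag_extend_diff)

lemma frag_pair_K_right:
  assumes k: "k \<in> K" and x: "x \<in> carrier F"
  shows "frag_pair x k \<in> K"
  using x
proof (induction rule: F_induct)
  case (of m n)
  then show ?case using k
    by (simp, intro frag_extend_K)
      (simp_all add: multM_add_right multN_add_right multM_scal multN_scal multM_closed multN_closed
        M.rscal_closed N.lscal_closed K_add_left K_add_right K_balanced)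
qed (simp_all add: K_zero K_diff frag_extend_diff)

lemma mult_cls:
  assumes x: "x \<in> carrier F" and y: "y \<in> carrier F"
  shows "cls x \<otimes>\<^bsub>MN\<^esub> cls y = cls (frag_pair x y)"
proof -
  have "cls (frag_pair x' y') = cls (frag_pair x y)" if xy': "x' \<in> cls x" "y' \<in> cls y" for x' y'
  proof -
    obtain k l where k: "k \<in> K" "x' = k + x" and l: "l \<in> K" "y' = l + y"
      using xy' unfolding mem_cls by blast
    have "frag_pair x' y' = frag_pair k y' + frag_pair x y'"
      by (simp add: k frag_extend_add)
    moreover have "frag_pair x y' = frag_pair x l + frag_pair x y"
      unfolding l frag_pair_swap by (rule frag_extend_add)
    ultimately have "frag_pair x' y' - frag_pair x y = frag_pair k y' + frag_pair x l" by simp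
    moreover have "frag_pair k y' \<in> K" by (rule frag_pair_K_left) (use k l y K_F in auto)
    moreover have "frag_pair x l \<in> K" by (rule frag_pair_K_right) (use l x in auto)
    ultimately show ?thesis by (simp add: cls_eq_iff K_add)
  qed
  then have "(\<Union>x'\<in>cls x. \<Union>y'\<in>cls y. cls (frag_pair x' y')) = cls (frag_pair x y)"
    using self_cls by blast
  then show ?thesis by (simp add: tensor_def)
qed

lemma mult_pure:
  assumes "m \<in> carrier M" "n \<in> carrier N" "m' \<in> carrier M" "n' \<in> carrier N"
  shows "pure m n \<otimes>\<^bsub>MN\<^esub> pure m' n' = pure (m \<otimes>\<^bsub>M\<^esub> m') (n \<otimes>\<^bsub>N\<^esub> n')"
  using assms by (simp add: pure_cls mult_cls)

lemma mult_closed: "X \<in> carrier MN \<Longrightarrow> Y \<in> carrier MN \<Longrightarrow> X \<otimes>\<^bsub>MN\<^esub> Y \<in> carrier MN"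
  by (elim cls_cases) (simp add: mult_cls frag_pair_F)

lemma mult_add:
  assumes "X \<in> carrier MN" "Y \<in> carrier MN" "Z \<in> carrier MN"
  shows "(X \<oplus>\<^bsub>MN\<^esub> Y) \<otimes>\<^bsub>MN\<^esub> Z = X \<otimes>\<^bsub>MN\<^esub> Z \<oplus>\<^bsub>MN\<^esub> Y \<otimes>\<^bsub>MN\<^esub> Z"
    and "Z \<otimes>\<^bsub>MN\<^esub> (X \<oplus>\<^bsub>MN\<^esub> Y) = Z \<otimes>\<^bsub>MN\<^esub> X \<oplus>\<^bsub>MN\<^esub> Z \<otimes>\<^bsub>MN\<^esub> Y"
proof -
  show "(X \<oplus>\<^bsub>MN\<^esub> Y) \<otimes>\<^bsub>MN\<^esub> Z = X \<otimes>\<^bsub>MN\<^esub> Z \<oplus>\<^bsub>MN\<^esub> Y \<otimes>\<^bsub>MN\<^esub> Z"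
    using assms by (elim cls_cases) (simp add: cls_add mult_cls frag_pair_F frag_extend_add)
  have "frag_pair z (x + y) = frag_pair z x + frag_pair z y" for x y z
    unfolding frag_pair_swap by (rule frag_extend_add)
  then show "Z \<otimes>\<^bsub>MN\<^esub> (X \<oplus>\<^bsub>MN\<^esub> Y) = Z \<otimes>\<^bsub>MN\<^esub> X \<oplus>\<^bsub>MN\<^esub> Z \<otimes>\<^bsub>MN\<^esub> Y"
    using assms by (elim cls_cases) (simp add: cls_add mult_cls frag_pair_F)
qed

lemma mult_zero:
  assumes "Z \<in> carrier MN"
  shows "\<zero>\<^bsub>MN\<^esub> \<otimes>\<^bsub>MN\<^esub> Z = \<zero>\<^bsub>MN\<^esub>" "Z \<otimes>\<^bsub>MN\<^esub> \<zero>\<^bsub>MN\<^esub> = \<zero>\<^bsub>MN\<^esub>"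
proof -
  obtain z where z: "z \<in> carrier F" "Z = cls z" using assms by (rule cls_cases)
  have "frag_pair z 0 = 0" unfolding frag_pair_swap by (rule frag_extend_0)
  then show "\<zero>\<^bsub>MN\<^esub> \<otimes>\<^bsub>MN\<^esub> Z = \<zero>\<^bsub>MN\<^esub>" "Z \<otimes>\<^bsub>MN\<^esub> \<zero>\<^bsub>MN\<^esub> = \<zero>\<^bsub>MN\<^esub>"
    using z by (simp_all only: cls_zero mult_cls F_zero frag_extend_0)
qed

end

section \<open>Sections and convolution\<close>

lemma fibre_simps [simp]:
  "x \<in> carrier (fibre \<Lambda> \<pi> \<gamma>) \<longleftrightarrow> x \<in> arrows \<Lambda> \<and> proj \<pi> x = \<gamma>"
  "\<zero>\<^bsub>fibre \<Lambda> \<pi> \<gamma>\<^esub> = fib_zero \<pi> \<gamma>" "x \<oplus>\<^bsub>fibre \<Lambda> \<pi> \<gamma>\<^esub> y = fib_add \<pi> x y"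
  "lscal (fibre \<Lambda> \<pi> \<gamma>) = fib_lscal \<pi>" "rscal (fibre \<Lambda> \<pi> \<gamma>) = fib_rscal \<pi>"
  by (simp_all add: fibre_def)

lemma sections_simps [simp]:
  "carrier (sections \<Lambda> \<Gamma> \<pi>) = (\<Pi>\<^sub>E \<gamma>\<in>arrows \<Gamma>. {x \<in> arrows \<Lambda>. proj \<pi> x = \<gamma>})"
  "\<zero>\<^bsub>sections \<Lambda> \<Gamma> \<pi>\<^esub> = (\<lambda>\<gamma>\<in>arrows \<Gamma>. fib_zero \<pi> \<gamma>)"
  "\<alpha> \<oplus>\<^bsub>sections \<Lambda> \<Gamma> \<pi>\<^esub> \<beta> = (\<lambda>\<gamma>\<in>arrows \<Gamma>. fib_add \<pi> (\<alpha> \<gamma>) (\<beta> \<gamma>))"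
  "lscal (sections \<Lambda> \<Gamma> \<pi>) r \<alpha> = (\<lambda>\<gamma>\<in>arrows \<Gamma>. fib_lscal \<pi> r (\<alpha> \<gamma>))"
  "rscal (sections \<Lambda> \<Gamma> \<pi>) \<alpha> r = (\<lambda>\<gamma>\<in>arrows \<Gamma>. fib_rscal \<pi> (\<alpha> \<gamma>) r)"
  by (simp_all add: sections_def fibre_def)

definition conv_pairs ::
  "('o, 'g, 'j) sgpd_scheme \<Rightarrow> ('r, 'g, 'l) rbundle \<Rightarrow> ('g \<Rightarrow> 'l) \<Rightarrow> ('g \<Rightarrow> 'l) \<Rightarrow> 'g \<Rightarrow> ('g \<times> 'g) set" where
  "conv_pairs \<Gamma> \<pi> \<alpha> \<beta> \<gamma> =
     {(a, b) \<in> composable \<Gamma>. sgpd_mult \<Gamma> a b = \<gamma> \<and> \<alpha> a \<noteq> fib_zero \<pi> a \<and> \<beta> b \<noteq> fib_zero \<pi> b}"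

lemma sections_mult:
  "\<alpha> \<otimes>\<^bsub>sections \<Lambda> \<Gamma> \<pi>\<^esub> \<beta> =
    (\<lambda>\<gamma>\<in>arrows \<Gamma>. finsum (fibre \<Lambda> \<pi> \<gamma>) (\<lambda>(a, b). sgpd_mult \<Lambda> (\<alpha> a) (\<beta> b)) (conv_pairs \<Gamma> \<pi> \<alpha> \<beta> \<gamma>))"
  by (simp add: sections_def conv_pairs_def)

text \<open>The convolution sums of such sections are finite. All sections in the algebras below have
  this property, being supported in finitely many bisections.\<close>

definition fibre_finite ::
  "('o, 'g, 'j) sgpd_scheme \<Rightarrow> ('r, 'g, 'l) rbundle \<Rightarrow> ('g \<Rightarrow> 'l) \<Rightarrow> bool" where
  "fibre_finite \<Gamma> \<pi> \<alpha> \<longleftrightarrow>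
    (\<forall>v. finite {a \<in> arrows \<Gamma>. range_of \<Gamma> a = v \<and> \<alpha> a \<noteq> fib_zero \<pi> a} \<and>
         finite {a \<in> arrows \<Gamma>. source \<Gamma> a = v \<and> \<alpha> a \<noteq> fib_zero \<pi> a})"

text \<open>In a factorisation \<open>\<gamma> = ab\<close>, the range of \<open>a\<close> and the source of \<open>b\<close> are those of \<open>\<gamma>\<close>.\<close>

lemma (in semigroupoid) finite_conv_pairs:
  assumes "fibre_finite S \<pi> \<alpha>" "fibre_finite S \<pi> \<beta>"
  shows "finite (conv_pairs S \<pi> \<alpha> \<beta> \<gamma>)"
proof (rule finite_subset)
  show "conv_pairs S \<pi> \<alpha> \<beta> \<gamma> \<subseteq>
      {a \<in> arrows S. range_of S a = range_of S \<gamma> \<and> \<alpha> a \<noteq> fib_zero \<pi> a} \<times>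
      {b \<in> arrows S. source S b = source S \<gamma> \<and> \<beta> b \<noteq> fib_zero \<pi> b}"
    using range_comp source_comp by (force simp: conv_pairs_def composable_def)
  show "finite \<dots>" using assms by (auto simp: fibre_finite_def)
qed

context R_bundle
begin

abbreviation "Sec \<equiv> sections \<Lambda> \<Gamma> \<pi>"

lemma fib_abelian: "\<gamma> \<in> arrows \<Gamma> \<Longrightarrow> abelian_group (fibre \<Lambda> \<pi> \<gamma>)"
  using fibre_bimodule bimodule.axioms(2) by blast

lemma fib_zero [simp]: "\<gamma> \<in> arrows \<Gamma> \<Longrightarrow> fib_zero \<pi> \<gamma> \<in> arrows \<Lambda>" "\<gamma> \<in> arrows \<Gamma> \<Longrightarrow> proj \<pi> (fib_zero \<pi> \<gamma>) = \<gamma>"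
  using abelian_monoid.zero_closed[OF abelian_group.axioms(1)[OF fib_abelian[of \<gamma>]]] by auto

context
  fixes \<gamma> assumes \<gamma>: "\<gamma> \<in> arrows \<Gamma>"
begin

interpretation B: bimodule R "fibre \<Lambda> \<pi> \<gamma>" by (rule fibre_bimodule[OF \<gamma>])

lemmas fib_ac = B.M.a_assoc B.M.a_comm

lemmas fib_facts = B.M.a_closed B.M.l_zero B.M.r_zero
  B.lscal_closed B.lscal_add B.lscal_add_scalar B.lscal_mult B.lscal_one
  B.rscal_closed B.rscal_add B.rscal_add_scalar B.rscal_mult B.rscal_one B.lscal_rscal
  B.lscal_zero B.rscal_zero B.lscal_zero_scalar B.rscal_zero_scalar

lemma fib_l_neg: "x \<in> arrows \<Lambda> \<Longrightarrow> proj \<pi> x = \<gamma> \<Longrightarrow>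
    fib_add \<pi> (fib_lscal \<pi> (\<ominus>\<^bsub>R\<^esub> \<one>\<^bsub>R\<^esub>) x) x = fib_zero \<pi> \<gamma>"
  using B.lscal_minus_one[of x] B.M.l_neg[of x] by auto

end

lemmas fib_rules = fib_facts[simplified fibre_simps]
lemmas fib_assoc = fib_ac(1)[simplified fibre_simps]
lemmas fib_comm = fib_ac(2)[simplified fibre_simps]

lemma bimodule_sections: "bimodule R Sec"
proof (intro bimodule.intro bimodule_axioms.intro R.ring_axioms abelian_groupI)
  fix \<alpha> assume "\<alpha> \<in> carrier Sec"
  then show "\<exists>\<beta>\<in>carrier Sec. \<beta> \<oplus>\<^bsub>Sec\<^esub> \<alpha> = \<zero>\<^bsub>Sec\<^esub>"
    by (intro bexI[of _ "lscal Sec (\<ominus>\<^bsub>R\<^esub> \<one>\<^bsub>R\<^esub>) \<alpha>"])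
      (auto simp: PiE_iff fib_l_neg fib_rules intro!: restrict_ext)
qed (auto simp: PiE_iff fib_rules fib_assoc extensional_def fun_eq_iff restrict_def intro: fib_comm)

lemma Sec_eqI:
  "\<alpha> \<in> carrier Sec \<Longrightarrow> \<beta> \<in> carrier Sec \<Longrightarrow> (\<And>\<gamma>. \<gamma> \<in> arrows \<Gamma> \<Longrightarrow> \<alpha> \<gamma> = \<beta> \<gamma>) \<Longrightarrow> \<alpha> = \<beta>"
  unfolding sections_simps by (rule PiE_ext)

lemma Sec_value:
  assumes "\<alpha> \<in> carrier Sec" "\<gamma> \<in> arrows \<Gamma>"
  shows "\<alpha> \<gamma> \<in> arrows \<Lambda>" "proj \<pi> (\<alpha> \<gamma>) = \<gamma>"
  using assms by auto

lemma comp_fibres: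
  assumes "(a, b) \<in> composable \<Gamma>" "x \<in> arrows \<Lambda>" "proj \<pi> x = a" "y \<in> arrows \<Lambda>" "proj \<pi> y = b"
  shows "(x, y) \<in> composable \<Lambda>" "sgpd_mult \<Lambda> x y \<in> arrows \<Lambda>" "proj \<pi> (sgpd_mult \<Lambda> x y) = sgpd_mult \<Gamma> a b"
proof -
  show c: "(x, y) \<in> composable \<Lambda>" using assms rigid by (auto simp: rigid_hom_def)
  then show "sgpd_mult \<Lambda> x y \<in> arrows \<Lambda>" by (rule \<Lambda>.comp_closed)
  show "proj \<pi> (sgpd_mult \<Lambda> x y) = sgpd_mult \<Gamma> a b"
    using c rigid assms by (auto simp: rigid_hom_def sgpd_hom_def)
qed

lemma comp_zero:
  assumes ab: "(a, b) \<in> composable \<Gamma>"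
  shows "y \<in> arrows \<Lambda> \<Longrightarrow> proj \<pi> y = b \<Longrightarrow> sgpd_mult \<Lambda> (fib_zero \<pi> a) y = fib_zero \<pi> (sgpd_mult \<Gamma> a b)"
    and "x \<in> arrows \<Lambda> \<Longrightarrow> proj \<pi> x = a \<Longrightarrow> sgpd_mult \<Lambda> x (fib_zero \<pi> b) = fib_zero \<pi> (sgpd_mult \<Gamma> a b)"
proof -
  have arr: "a \<in> arrows \<Gamma>" "b \<in> arrows \<Gamma>" "sgpd_mult \<Gamma> a b \<in> arrows \<Gamma>"
    using ab \<Gamma>.comp_closed by (auto simp: composable_def)
  note gr = fib_abelian[OF arr(1)] fib_abelian[OF arr(2)] fib_abelian[OF arr(3)]
  show "sgpd_mult \<Lambda> (fib_zero \<pi> a) y = fib_zero \<pi> (sgpd_mult \<Gamma> a b)" if "y \<in> arrows \<Lambda>" "proj \<pi> y = b"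
    using additive_zero[OF gr(1,3), of "\<lambda>x. sgpd_mult \<Lambda> x y"] comp_fibres[OF ab] comp_add_left[OF ab] that
    by auto
  show "sgpd_mult \<Lambda> x (fib_zero \<pi> b) = fib_zero \<pi> (sgpd_mult \<Gamma> a b)" if "x \<in> arrows \<Lambda>" "proj \<pi> x = a"
    using additive_zero[OF gr(2,3), of "\<lambda>y. sgpd_mult \<Lambda> x y"] comp_fibres[OF ab] comp_add_right[OF ab] that
    by auto
qed

lemma conv_summand_closed:
  assumes "\<alpha> \<in> carrier Sec" "\<beta> \<in> carrier Sec" "P \<subseteq> {(a, b) \<in> composable \<Gamma>. sgpd_mult \<Gamma> a b = \<gamma>}"
  shows "(\<lambda>(a, b). sgpd_mult \<Lambda> (\<alpha> a) (\<beta> b)) \<in> P \<rightarrow> carrier (fibre \<Lambda> \<pi> \<gamma>)"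
proof (clarify)
  fix a b assume "(a, b) \<in> P"
  then have ab: "(a, b) \<in> composable \<Gamma>" "sgpd_mult \<Gamma> a b = \<gamma>" using assms by auto
  then have "a \<in> arrows \<Gamma>" "b \<in> arrows \<Gamma>" by (auto simp: composable_def)
  then show "sgpd_mult \<Lambda> (\<alpha> a) (\<beta> b) \<in> carrier (fibre \<Lambda> \<pi> \<gamma>)"
    using comp_fibres[OF ab(1)] ab(2) assms by (auto simp: PiE_iff)
qed

text \<open>The index set in the definition of a convolution product depends on the two sections. Summation
  over a larger finite set of factorisations makes different products comparable.\<close>

lemma conv_eq:
  assumes \<gamma>: "\<gamma> \<in> arrows \<Gamma>" and sec: "\<alpha> \<in> carrier Sec" "\<beta> \<in> carrier Sec" and P: "finite P"
    "P \<subseteq> {(a, b) \<in> composable \<Gamma>. sgpd_mult \<Gamma> a b = \<gamma>}" "conv_pairs \<Gamma> \<pi> \<alpha> \<beta> \<gamma> \<subseteq> P"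
  shows "(\<alpha> \<otimes>\<^bsub>Sec\<^esub> \<beta>) \<gamma> = finsum (fibre \<Lambda> \<pi> \<gamma>) (\<lambda>(a, b). sgpd_mult \<Lambda> (\<alpha> a) (\<beta> b)) P"
proof -
  interpret G: abelian_group "fibre \<Lambda> \<pi> \<gamma>" by (rule fib_abelian[OF \<gamma>])
  have "finsum (fibre \<Lambda> \<pi> \<gamma>) (\<lambda>(a, b). sgpd_mult \<Lambda> (\<alpha> a) (\<beta> b)) (conv_pairs \<Gamma> \<pi> \<alpha> \<beta> \<gamma>) =
    finsum (fibre \<Lambda> \<pi> \<gamma>) (\<lambda>(a, b). sgpd_mult \<Lambda> (\<alpha> a) (\<beta> b)) P"
  proof (rule G.add.finprod_mono_neutral_cong_left)
    show "(case p of (a, b) \<Rightarrow> sgpd_mult \<Lambda> (\<alpha> a) (\<beta> b)) = \<zero>\<^bsub>fibre \<Lambda> \<pi> \<gamma>\<^esub>" if "p \<in> P - conv_pairs \<Gamma> \<pi> \<alpha> \<beta> \<gamma>" for p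
    proof -
      obtain a b where p: "p = (a, b)" by (cases p)
      then have ab: "(a, b) \<in> composable \<Gamma>" "sgpd_mult \<Gamma> a b = \<gamma>"
        using that P(2) by auto
      then have z: "\<alpha> a = fib_zero \<pi> a \<or> \<beta> b = fib_zero \<pi> b"
        using that by (auto simp: conv_pairs_def p)
      have "a \<in> arrows \<Gamma>" "b \<in> arrows \<Gamma>" using ab by (auto simp: composable_def)
      then show ?thesis using p z ab sec comp_zero[OF ab(1)] by (auto simp: PiE_iff)
    qed
    show "(\<lambda>(a, b). sgpd_mult \<Lambda> (\<alpha> a) (\<beta> b)) \<in> P \<rightarrow> carrier (fibre \<Lambda> \<pi> \<gamma>)"
      by (rule conv_summand_closed[OF sec P(2)])
  qed (use P in auto)
  then show ?thesis using \<gamma> by (simp add: sections_mult)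
qed

lemma conv_closed:
  assumes "\<alpha> \<in> carrier Sec" "\<beta> \<in> carrier Sec"
  shows "\<alpha> \<otimes>\<^bsub>Sec\<^esub> \<beta> \<in> carrier Sec"
proof -
  have "finsum (fibre \<Lambda> \<pi> \<gamma>) (\<lambda>(a, b). sgpd_mult \<Lambda> (\<alpha> a) (\<beta> b)) (conv_pairs \<Gamma> \<pi> \<alpha> \<beta> \<gamma>) \<in> carrier (fibre \<Lambda> \<pi> \<gamma>)"
    if "\<gamma> \<in> arrows \<Gamma>" for \<gamma>
  proof -
    interpret G: abelian_group "fibre \<Lambda> \<pi> \<gamma>" by (rule fib_abelian[OF that])
    show ?thesis
      by (rule G.finsum_closed, rule conv_summand_closed[OF assms]) (auto simp: conv_pairs_def)
  qed
  then show ?thesis by (auto simp: sections_mult)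
qed

lemma conv_pairs_subset: "conv_pairs \<Gamma> \<pi> \<alpha> \<beta> \<gamma> \<subseteq> {(a, b) \<in> composable \<Gamma>. sgpd_mult \<Gamma> a b = \<gamma>}"
  by (auto simp: conv_pairs_def)

text \<open>The index sets of the three sums differ, so that all sums are extended to a common finite
  set of pairs. Additivity in either factor is the case in which the other factors agree.\<close>

lemma conv_add:
  assumes sec: "\<alpha> \<in> carrier Sec" "\<beta> \<in> carrier Sec" "\<alpha>\<^sub>1 \<in> carrier Sec" "\<beta>\<^sub>1 \<in> carrier Sec"
      "\<alpha>\<^sub>2 \<in> carrier Sec" "\<beta>\<^sub>2 \<in> carrier Sec"
    and fin: "fibre_finite \<Gamma> \<pi> \<alpha>\<^sub>1" "fibre_finite \<Gamma> \<pi> \<beta>\<^sub>1" "fibre_finite \<Gamma> \<pi> \<alpha>\<^sub>2" "fibre_finite \<Gamma> \<pi> \<beta>\<^sub>2"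
    and pairs: "\<And>\<gamma>. conv_pairs \<Gamma> \<pi> \<alpha> \<beta> \<gamma> \<subseteq> conv_pairs \<Gamma> \<pi> \<alpha>\<^sub>1 \<beta>\<^sub>1 \<gamma> \<union> conv_pairs \<Gamma> \<pi> \<alpha>\<^sub>2 \<beta>\<^sub>2 \<gamma>"
    and sum: "\<And>a b. (a, b) \<in> composable \<Gamma> \<Longrightarrow> sgpd_mult \<Lambda> (\<alpha> a) (\<beta> b) =
      fib_add \<pi> (sgpd_mult \<Lambda> (\<alpha>\<^sub>1 a) (\<beta>\<^sub>1 b)) (sgpd_mult \<Lambda> (\<alpha>\<^sub>2 a) (\<beta>\<^sub>2 b))"
  shows "\<alpha> \<otimes>\<^bsub>Sec\<^esub> \<beta> = \<alpha>\<^sub>1 \<otimes>\<^bsub>Sec\<^esub> \<beta>\<^sub>1 \<oplus>\<^bsub>Sec\<^esub> \<alpha>\<^sub>2 \<otimes>\<^bsub>Sec\<^esub> \<beta>\<^sub>2"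
proof -
  interpret S: bimodule R Sec by (rule bimodule_sections)
  have "(\<alpha> \<otimes>\<^bsub>Sec\<^esub> \<beta>) \<gamma> = fib_add \<pi> ((\<alpha>\<^sub>1 \<otimes>\<^bsub>Sec\<^esub> \<beta>\<^sub>1) \<gamma>) ((\<alpha>\<^sub>2 \<otimes>\<^bsub>Sec\<^esub> \<beta>\<^sub>2) \<gamma>)" if \<gamma>: "\<gamma> \<in> arrows \<Gamma>" for \<gamma>
  proof -
    interpret G: abelian_group "fibre \<Lambda> \<pi> \<gamma>" by (rule fib_abelian[OF \<gamma>])
    let ?P = "conv_pairs \<Gamma> \<pi> \<alpha>\<^sub>1 \<beta>\<^sub>1 \<gamma> \<union> conv_pairs \<Gamma> \<pi> \<alpha>\<^sub>2 \<beta>\<^sub>2 \<gamma>"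
    have P: "finite ?P" "?P \<subseteq> {(a, b) \<in> composable \<Gamma>. sgpd_mult \<Gamma> a b = \<gamma>}"
      using \<Gamma>.finite_conv_pairs fin conv_pairs_subset by (blast, auto)
    note closed = conv_summand_closed[OF sec(3,4) P(2)] conv_summand_closed[OF sec(5,6) P(2)]
    have "(\<alpha> \<otimes>\<^bsub>Sec\<^esub> \<beta>) \<gamma> =
        finsum (fibre \<Lambda> \<pi> \<gamma>) (\<lambda>p. (case p of (a, b) \<Rightarrow> sgpd_mult \<Lambda> (\<alpha>\<^sub>1 a) (\<beta>\<^sub>1 b)) \<oplus>\<^bsub>fibre \<Lambda> \<pi> \<gamma>\<^esub>
          (case p of (a, b) \<Rightarrow> sgpd_mult \<Lambda> (\<alpha>\<^sub>2 a) (\<beta>\<^sub>2 b))) ?P"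
      unfolding conv_eq[OF \<gamma> sec(1,2) P pairs]
    proof (rule G.finsum_cong'[OF refl])
      show "(\<lambda>p. (case p of (a, b) \<Rightarrow> sgpd_mult \<Lambda> (\<alpha>\<^sub>1 a) (\<beta>\<^sub>1 b)) \<oplus>\<^bsub>fibre \<Lambda> \<pi> \<gamma>\<^esub>
          (case p of (a, b) \<Rightarrow> sgpd_mult \<Lambda> (\<alpha>\<^sub>2 a) (\<beta>\<^sub>2 b))) \<in> ?P \<rightarrow> carrier (fibre \<Lambda> \<pi> \<gamma>)"
        by (intro Pi_I G.a_closed funcset_mem[OF closed(1)] funcset_mem[OF closed(2)])
    qed (use sum P(2) in auto)
    also have "\<dots> = (\<alpha>\<^sub>1 \<otimes>\<^bsub>Sec\<^esub> \<beta>\<^sub>1) \<gamma> \<oplus>\<^bsub>fibre \<Lambda> \<pi> \<gamma>\<^esub> (\<alpha>\<^sub>2 \<otimes>\<^bsub>Sec\<^esub> \<beta>\<^sub>2) \<gamma>"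
      unfolding conv_eq[OF \<gamma> sec(3,4) P Un_upper1] conv_eq[OF \<gamma> sec(5,6) P Un_upper2]
      by (rule G.finsum_addf[OF closed])
    finally show ?thesis by simp
  qed
  then show ?thesis
    by (intro Sec_eqI[OF conv_closed[OF sec(1,2)]
          S.M.a_closed[OF conv_closed[OF sec(3,4)] conv_closed[OF sec(5,6)]]]) simp
qed

lemma conv_add_left:
  assumes sec: "\<alpha> \<in> carrier Sec" "\<alpha>' \<in> carrier Sec" "\<beta> \<in> carrier Sec"
    and fin: "fibre_finite \<Gamma> \<pi> \<alpha>" "fibre_finite \<Gamma> \<pi> \<alpha>'" "fibre_finite \<Gamma> \<pi> \<beta>"
  shows "(\<alpha> \<oplus>\<^bsub>Sec\<^esub> \<alpha>') \<otimes>\<^bsub>Sec\<^esub> \<beta> = \<alpha> \<otimes>\<^bsub>Sec\<^esub> \<beta> \<oplus>\<^bsub>Sec\<^esub> \<alpha>' \<otimes>\<^bsub>Sec\<^esub> \<beta>"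
proof (rule conv_add[OF _ sec(3,1,3,2,3) fin(1,3,2,3)])
  interpret S: bimodule R Sec by (rule bimodule_sections)
  show "\<alpha> \<oplus>\<^bsub>Sec\<^esub> \<alpha>' \<in> carrier Sec" by (rule S.M.a_closed[OF sec(1,2)])
  show "sgpd_mult \<Lambda> ((\<alpha> \<oplus>\<^bsub>Sec\<^esub> \<alpha>') a) (\<beta> b) =
      fib_add \<pi> (sgpd_mult \<Lambda> (\<alpha> a) (\<beta> b)) (sgpd_mult \<Lambda> (\<alpha>' a) (\<beta> b))" if ab: "(a, b) \<in> composable \<Gamma>" for a b
  proof -
    have "a \<in> arrows \<Gamma>" "b \<in> arrows \<Gamma>" using ab by (auto simp: composable_def)
    then show ?thesis using comp_add_left[OF ab] sec by (auto simp: PiE_iff)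
  qed
qed (auto simp: conv_pairs_def composable_def fib_rules)

lemma conv_add_right:
  assumes sec: "\<alpha> \<in> carrier Sec" "\<alpha>' \<in> carrier Sec" "\<beta> \<in> carrier Sec"
    and fin: "fibre_finite \<Gamma> \<pi> \<alpha>" "fibre_finite \<Gamma> \<pi> \<alpha>'" "fibre_finite \<Gamma> \<pi> \<beta>"
  shows "\<beta> \<otimes>\<^bsub>Sec\<^esub> (\<alpha> \<oplus>\<^bsub>Sec\<^esub> \<alpha>') = \<beta> \<otimes>\<^bsub>Sec\<^esub> \<alpha> \<oplus>\<^bsub>Sec\<^esub> \<beta> \<otimes>\<^bsub>Sec\<^esub> \<alpha>'"
proof (rule conv_add[OF sec(3) _ sec(3,1,3,2) fin(3,1,3,2)])
  interpret S: bimodule R Sec by (rule bimodule_sections)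
  show "\<alpha> \<oplus>\<^bsub>Sec\<^esub> \<alpha>' \<in> carrier Sec" by (rule S.M.a_closed[OF sec(1,2)])
  show "sgpd_mult \<Lambda> (\<beta> a) ((\<alpha> \<oplus>\<^bsub>Sec\<^esub> \<alpha>') b) =
      fib_add \<pi> (sgpd_mult \<Lambda> (\<beta> a) (\<alpha> b)) (sgpd_mult \<Lambda> (\<beta> a) (\<alpha>' b))" if ab: "(a, b) \<in> composable \<Gamma>" for a b
  proof -
    have "a \<in> arrows \<Gamma>" "b \<in> arrows \<Gamma>" using ab by (auto simp: composable_def)
    then show ?thesis using comp_add_right[OF ab] sec by (auto simp: PiE_iff)
  qed
qed (auto simp: conv_pairs_def composable_def fib_rules)

text \<open>Scalars pass through the sums of a convolution product because they act additively on the
  fibres. In the applications, \<open>h\<close> is such an action and \<open>\<alpha>'\<close>, \<open>\<beta>'\<close> are \<open>\<alpha>\<close>, \<open>\<beta>\<close> with a scalar put on one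
  of them.\<close>

lemma conv_scalar:
  assumes sec: "\<alpha> \<in> carrier Sec" "\<beta> \<in> carrier Sec" "\<alpha>' \<in> carrier Sec" "\<beta>' \<in> carrier Sec"
    and fin: "fibre_finite \<Gamma> \<pi> \<alpha>" "fibre_finite \<Gamma> \<pi> \<beta>"
    and zero: "\<And>a. a \<in> arrows \<Gamma> \<Longrightarrow> \<alpha> a = fib_zero \<pi> a \<Longrightarrow> \<alpha>' a = fib_zero \<pi> a"
      "\<And>a. a \<in> arrows \<Gamma> \<Longrightarrow> \<beta> a = fib_zero \<pi> a \<Longrightarrow> \<beta>' a = fib_zero \<pi> a"
    and h: "\<And>x. x \<in> arrows \<Lambda> \<Longrightarrow> h x \<in> arrows \<Lambda> \<and> proj \<pi> (h x) = proj \<pi> x"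
    and h_add: "\<And>x y. x \<in> arrows \<Lambda> \<Longrightarrow> y \<in> arrows \<Lambda> \<Longrightarrow> proj \<pi> x = proj \<pi> y \<Longrightarrow>
      h (fib_add \<pi> x y) = fib_add \<pi> (h x) (h y)"
    and h_mult: "\<And>a b. (a, b) \<in> composable \<Gamma> \<Longrightarrow>
      sgpd_mult \<Lambda> (\<alpha>' a) (\<beta>' b) = h (sgpd_mult \<Lambda> (\<alpha> a) (\<beta> b))"
  shows "\<alpha>' \<otimes>\<^bsub>Sec\<^esub> \<beta>' = (\<lambda>\<gamma>\<in>arrows \<Gamma>. h ((\<alpha> \<otimes>\<^bsub>Sec\<^esub> \<beta>) \<gamma>))"
proof -
  have "(\<alpha>' \<otimes>\<^bsub>Sec\<^esub> \<beta>') \<gamma> = h ((\<alpha> \<otimes>\<^bsub>Sec\<^esub> \<beta>) \<gamma>)" if \<gamma>: "\<gamma> \<in> arrows \<Gamma>" for \<gamma>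
  proof -
    interpret G: abelian_group "fibre \<Lambda> \<pi> \<gamma>" by (rule fib_abelian[OF \<gamma>])
    let ?P = "conv_pairs \<Gamma> \<pi> \<alpha> \<beta> \<gamma>"
    have P: "finite ?P" by (rule \<Gamma>.finite_conv_pairs[OF fin])
    have sub: "conv_pairs \<Gamma> \<pi> \<alpha>' \<beta>' \<gamma> \<subseteq> ?P"
      using zero by (auto simp: conv_pairs_def composable_def)
    have "h ((\<alpha> \<otimes>\<^bsub>Sec\<^esub> \<beta>) \<gamma>) = finsum (fibre \<Lambda> \<pi> \<gamma>) (\<lambda>p. h (case p of (a, b) \<Rightarrow> sgpd_mult \<Lambda> (\<alpha> a) (\<beta> b))) ?P"
      unfolding conv_eq[OF \<gamma> sec(1,2) P conv_pairs_subset subset_refl]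
      by (rule additive_finsum[OF G.abelian_group_axioms G.abelian_group_axioms])
        (use h h_add in \<open>auto intro!: conv_summand_closed[OF sec(1,2)] simp: conv_pairs_def\<close>)
    also have "\<dots> = finsum (fibre \<Lambda> \<pi> \<gamma>) (\<lambda>(a, b). sgpd_mult \<Lambda> (\<alpha>' a) (\<beta>' b)) ?P"
    proof (rule G.finsum_cong'[OF refl conv_summand_closed[OF sec(3,4) conv_pairs_subset]])
      fix p assume "p \<in> ?P"
      then show "h (case p of (a, b) \<Rightarrow> sgpd_mult \<Lambda> (\<alpha> a) (\<beta> b)) = (case p of (a, b) \<Rightarrow> sgpd_mult \<Lambda> (\<alpha>' a) (\<beta>' b))"
        using h_mult by (auto simp: conv_pairs_def)
    qed
    also have "\<dots> = (\<alpha>' \<otimes>\<^bsub>Sec\<^esub> \<beta>') \<gamma>"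
      by (rule conv_eq[OF \<gamma> sec(3,4) P conv_pairs_subset sub, symmetric])
    finally show ?thesis ..
  qed
  then show ?thesis
    using conv_closed[OF sec(3,4)] conv_closed[OF sec(1,2)] h
    by (intro Sec_eqI[OF conv_closed[OF sec(3,4)]]) (auto simp: PiE_iff)
qed

lemma conv_zero:
  assumes "\<alpha> \<in> carrier Sec"
  shows "\<zero>\<^bsub>Sec\<^esub> \<otimes>\<^bsub>Sec\<^esub> \<alpha> = \<zero>\<^bsub>Sec\<^esub>" "\<alpha> \<otimes>\<^bsub>Sec\<^esub> \<zero>\<^bsub>Sec\<^esub> = \<zero>\<^bsub>Sec\<^esub>"
proof -
  have "finsum (fibre \<Lambda> \<pi> \<gamma>) f {} = fib_zero \<pi> \<gamma>" if "\<gamma> \<in> arrows \<Gamma>" for \<gamma> f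
  proof -
    interpret G: abelian_group "fibre \<Lambda> \<pi> \<gamma>" by (rule fib_abelian[OF that])
    show ?thesis by simp
  qed
  moreover have "conv_pairs \<Gamma> \<pi> \<zero>\<^bsub>Sec\<^esub> \<alpha> \<gamma> = {}" "conv_pairs \<Gamma> \<pi> \<alpha> \<zero>\<^bsub>Sec\<^esub> \<gamma> = {}" for \<gamma>
    by (auto simp: conv_pairs_def composable_def)
  ultimately show "\<zero>\<^bsub>Sec\<^esub> \<otimes>\<^bsub>Sec\<^esub> \<alpha> = \<zero>\<^bsub>Sec\<^esub>" "\<alpha> \<otimes>\<^bsub>Sec\<^esub> \<zero>\<^bsub>Sec\<^esub> = \<zero>\<^bsub>Sec\<^esub>"
    by (auto simp: sections_mult intro!: restrict_ext)
qed

lemma fibre_finite_zero: "fibre_finite \<Gamma> \<pi> \<zero>\<^bsub>Sec\<^esub>"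
  by (auto simp: fibre_finite_def)

lemma fibre_finite_add:
  assumes "fibre_finite \<Gamma> \<pi> \<alpha>" "fibre_finite \<Gamma> \<pi> \<beta>"
  shows "fibre_finite \<Gamma> \<pi> (\<alpha> \<oplus>\<^bsub>Sec\<^esub> \<beta>)"
proof -
  have sub: "{a \<in> arrows \<Gamma>. Q a \<and> (\<alpha> \<oplus>\<^bsub>Sec\<^esub> \<beta>) a \<noteq> fib_zero \<pi> a} \<subseteq>
    {a \<in> arrows \<Gamma>. Q a \<and> \<alpha> a \<noteq> fib_zero \<pi> a} \<union> {a \<in> arrows \<Gamma>. Q a \<and> \<beta> a \<noteq> fib_zero \<pi> a}" for Q
    by (auto simp: fib_rules)
  show ?thesis
    unfolding fibre_finite_def
    by (intro allI conjI finite_subset[OF sub] finite_UnI) (use assms in \<open>auto simp: fibre_finite_def\<close>)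
qed

end

section \<open>Products with a semigroupoid\<close>

lemma prod_sgpd_simps [simp]:
  "vertices (prod_sgpd S T) = vertices S \<times> vertices T"
  "arrows (prod_sgpd S T) = arrows S \<times> arrows T"
  "source (prod_sgpd S T) (a, b) = (source S a, source T b)"
  "range_of (prod_sgpd S T) (a, b) = (range_of S a, range_of T b)"
  "sgpd_mult (prod_sgpd S T) (a, b) (a', b') = (sgpd_mult S a a', sgpd_mult T b b')"
  "vtop (prod_sgpd S T) = prod_topology (vtop S) (vtop T)"
  "atop (prod_sgpd S T) = prod_topology (atop S) (atop T)"
  by (simp_all add: prod_sgpd_def)

lemma prod_bundle_simps [simp]:
  "proj (prod_bundle \<pi>) (x, e) = (proj \<pi> x, e)"
  "fib_add (prod_bundle \<pi>) (x, e) (y, e') = (fib_add \<pi> x y, e)"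
  "fib_zero (prod_bundle \<pi>) (\<gamma>, e) = (fib_zero \<pi> \<gamma>, e)"
  "fib_lscal (prod_bundle \<pi>) r (x, e) = (fib_lscal \<pi> r x, e)"
  "fib_rscal (prod_bundle \<pi>) (x, e) r = (fib_rscal \<pi> x r, e)"
  by (simp_all add: prod_bundle_def)

lemma composable_prod:
  "((a, b), (a', b')) \<in> composable (prod_sgpd S T) \<longleftrightarrow> (a, a') \<in> composable S \<and> (b, b') \<in> composable T"
  by (auto simp: composable_def)

lemma semigroupoid_prod:
  assumes "semigroupoid S" "semigroupoid T"
  shows "semigroupoid (prod_sgpd S T)"
proof -
  interpret S: semigroupoid S by fact
  interpret T: semigroupoid T by fact
  show ?thesis
    by unfold_locales
      (auto simp: composable_prod S.source_closed T.source_closed S.range_closed T.range_closed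
        S.comp_closed T.comp_closed S.source_comp T.source_comp S.range_comp T.range_comp
        S.comp_assoc T.comp_assoc)
qed

lemma R_bundle_prod:
  assumes "R_bundle R \<Lambda> \<Gamma> \<pi>" "semigroupoid \<E>"
  shows "R_bundle R (prod_sgpd \<Lambda> \<E>) (prod_sgpd \<Gamma> \<E>) (prod_bundle \<pi>)"
proof -
  interpret R_bundle R \<Lambda> \<Gamma> \<pi> by fact
  interpret \<E>: semigroupoid \<E> by fact
  have comp: "(x, y) \<in> composable \<Lambda> \<longleftrightarrow> x \<in> arrows \<Lambda> \<and> y \<in> arrows \<Lambda> \<and> (proj \<pi> x, proj \<pi> y) \<in> composable \<Gamma>" for x y
    using rigid by (auto simp: rigid_hom_def composable_def)
  have proj_mult: "proj \<pi> (sgpd_mult \<Lambda> x y) = sgpd_mult \<Gamma> (proj \<pi> x) (proj \<pi> y)"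
    if "(x, y) \<in> composable \<Lambda>" for x y
    using that rigid by (auto simp: rigid_hom_def sgpd_hom_def)
  have proj_arr: "x \<in> arrows \<Lambda> \<Longrightarrow> proj \<pi> x \<in> arrows \<Gamma>" for x
    using rigid by (auto simp: rigid_hom_def sgpd_hom_def)
  have comp_arr: "(a, b) \<in> composable \<E> \<Longrightarrow> a \<in> arrows \<E> \<and> b \<in> arrows \<E>" for a b
    by (auto simp: composable_def)
  show ?thesis
  proof (intro R_bundle.intro R_bundle_axioms.intro R.ring_axioms
      semigroupoid_prod \<Lambda>.semigroupoid_axioms \<Gamma>.semigroupoid_axioms \<E>.semigroupoid_axioms)
    show "rigid_hom (prod_sgpd \<Lambda> \<E>) (prod_sgpd \<Gamma> \<E>) (proj (prod_bundle \<pi>))"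
      unfolding rigid_hom_def sgpd_hom_def
      by (auto simp: composable_prod comp proj_mult proj_arr comp_arr)
    show "bimodule R (fibre (prod_sgpd \<Lambda> \<E>) (prod_bundle \<pi>) \<gamma>)" if \<gamma>_arr: "\<gamma> \<in> arrows (prod_sgpd \<Gamma> \<E>)" for \<gamma>
    proof -
      obtain g e where \<gamma>: "\<gamma> = (g, e)" "g \<in> arrows \<Gamma>" "e \<in> arrows \<E>" using \<gamma>_arr by (cases \<gamma>) auto
      show ?thesis unfolding \<gamma>(1)
      proof (intro bimodule.intro bimodule_axioms.intro R.ring_axioms abelian_groupI)
        fix x assume "x \<in> carrier (fibre (prod_sgpd \<Lambda> \<E>) (prod_bundle \<pi>) (g, e))"
        then show "\<exists>y\<in>carrier (fibre (prod_sgpd \<Lambda> \<E>) (prod_bundle \<pi>) (g, e)).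
            y \<oplus>\<^bsub>fibre (prod_sgpd \<Lambda> \<E>) (prod_bundle \<pi>) (g, e)\<^esub> x =
            \<zero>\<^bsub>fibre (prod_sgpd \<Lambda> \<E>) (prod_bundle \<pi>) (g, e)\<^esub>"
          using \<gamma> by (intro bexI[of _ "lscal (fibre (prod_sgpd \<Lambda> \<E>) (prod_bundle \<pi>) (g, e)) (\<ominus>\<^bsub>R\<^esub> \<one>\<^bsub>R\<^esub>) x"])
            (auto simp: fib_l_neg fib_rules)
      qed (use \<gamma> in \<open>auto simp: fib_rules fib_assoc intro: fib_comm\<close>)
    qed
  qed (auto simp: composable_prod comp_arr comp_add_left comp_add_right comp_balanced comp_lscal comp_rscal)
qed

section \<open>Functions as sections of the trivial bundle\<close>

lemma R_functions_simps [simp]: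
  "carrier (R_functions R \<E>) = arrows \<E> \<rightarrow>\<^sub>E carrier R"
  "\<zero>\<^bsub>R_functions R \<E>\<^esub> = (\<lambda>e\<in>arrows \<E>. \<zero>\<^bsub>R\<^esub>)"
  "f \<oplus>\<^bsub>R_functions R \<E>\<^esub> g = (\<lambda>e\<in>arrows \<E>. f e \<oplus>\<^bsub>R\<^esub> g e)"
  "lscal (R_functions R \<E>) r f = (\<lambda>e\<in>arrows \<E>. r \<otimes>\<^bsub>R\<^esub> f e)"
  "rscal (R_functions R \<E>) f r = (\<lambda>e\<in>arrows \<E>. f e \<otimes>\<^bsub>R\<^esub> r)"
  by (simp_all add: R_functions_def)

lemma bimodule_R_functions:
  fixes R :: "'r ring"
  assumes "ring R"
  shows "bimodule R (R_functions R \<E>)"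
proof -
  interpret R: ring R by fact
  show ?thesis
  proof (intro bimodule.intro bimodule_axioms.intro R.ring_axioms abelian_groupI)
    fix f assume "f \<in> carrier (R_functions R \<E>)"
    then show "\<exists>g\<in>carrier (R_functions R \<E>). g \<oplus>\<^bsub>R_functions R \<E>\<^esub> f = \<zero>\<^bsub>R_functions R \<E>\<^esub>"
      by (intro bexI[of _ "\<lambda>e\<in>arrows \<E>. \<ominus>\<^bsub>R\<^esub> f e"]) (auto simp: PiE_iff R.l_neg intro!: restrict_ext)
  qed (auto simp: PiE_iff extensional_def fun_eq_iff restrict_def R.a_assoc R.m_assoc R.l_distr R.r_distr
        intro: R.a_comm)
qed

text \<open>The functions on \<open>\<E>\<close> are the sections of the bundle \<open>R \<times> \<E>\<close> over \<open>\<E>\<close>. In this way, facts about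
  sectional algebras carry over to the algebra of functions.\<close>

definition triv_sgpd :: "'r ring \<Rightarrow> 'r topology \<Rightarrow> ('q, 'e) top_sgpd \<Rightarrow> ('q, 'r \<times> 'e) top_sgpd" where
  "triv_sgpd R RT \<E> =
    \<lparr>vertices = vertices \<E>, arrows = carrier R \<times> arrows \<E>,
     source = (\<lambda>(r, e). source \<E> e), range_of = (\<lambda>(r, e). range_of \<E> e),
     sgpd_mult = (\<lambda>(r, e) (s, e'). (r \<otimes>\<^bsub>R\<^esub> s, sgpd_mult \<E> e e')),
     vtop = vtop \<E>, atop = prod_topology RT (atop \<E>)\<rparr>"

definition triv_bundle :: "'r ring \<Rightarrow> ('r, 'e, 'r \<times> 'e) rbundle" where
  "triv_bundle R =
    \<lparr>proj = snd, fib_add = (\<lambda>(r, e) (s, _). (r \<oplus>\<^bsub>R\<^esub> s, e)), fib_zero = (\<lambda>e. (\<zero>\<^bsub>R\<^esub>, e)),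
     fib_lscal = (\<lambda>r (s, e). (r \<otimes>\<^bsub>R\<^esub> s, e)), fib_rscal = (\<lambda>(s, e) r. (s \<otimes>\<^bsub>R\<^esub> r, e))\<rparr>"

definition graph_section :: "('q, 'e) top_sgpd \<Rightarrow> ('e \<Rightarrow> 'r) \<Rightarrow> 'e \<Rightarrow> 'r \<times> 'e" where
  "graph_section \<E> f = (\<lambda>e\<in>arrows \<E>. (f e, e))"

lemma triv_sgpd_simps [simp]:
  "vertices (triv_sgpd R RT \<E>) = vertices \<E>"
  "arrows (triv_sgpd R RT \<E>) = carrier R \<times> arrows \<E>"
  "source (triv_sgpd R RT \<E>) (r, e) = source \<E> e"
  "range_of (triv_sgpd R RT \<E>) (r, e) = range_of \<E> e"
  "sgpd_mult (triv_sgpd R RT \<E>) (r, e) (s, e') = (r \<otimes>\<^bsub>R\<^esub> s, sgpd_mult \<E> e e')"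
  "vtop (triv_sgpd R RT \<E>) = vtop \<E>"
  "atop (triv_sgpd R RT \<E>) = prod_topology RT (atop \<E>)"
  by (simp_all add: triv_sgpd_def)

lemma triv_bundle_simps [simp]:
  "proj (triv_bundle R) p = snd p"
  "fib_add (triv_bundle R) (r, e) (s, e') = (r \<oplus>\<^bsub>R\<^esub> s, e)"
  "fib_zero (triv_bundle R) e = (\<zero>\<^bsub>R\<^esub>, e)"
  "fib_lscal (triv_bundle R) r (s, e) = (r \<otimes>\<^bsub>R\<^esub> s, e)"
  "fib_rscal (triv_bundle R) (s, e) r = (s \<otimes>\<^bsub>R\<^esub> r, e)"
  by (simp_all add: triv_bundle_def)

lemma composable_triv:
  "((r, a), (s, b)) \<in> composable (triv_sgpd R RT \<E>) \<longleftrightarrow>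
    r \<in> carrier R \<and> s \<in> carrier R \<and> (a, b) \<in> composable \<E>"
  by (auto simp: composable_def)

lemma R_bundle_triv:
  assumes "ring R" "semigroupoid \<E>"
  shows "R_bundle R (triv_sgpd R RT \<E>) \<E> (triv_bundle R)"
proof -
  interpret R: ring R by fact
  interpret \<E>: semigroupoid \<E> by fact
  have "semigroupoid (triv_sgpd R RT \<E>)"
    by unfold_locales
      (auto simp: composable_triv \<E>.source_closed \<E>.range_closed \<E>.comp_closed \<E>.source_comp
        \<E>.range_comp \<E>.comp_assoc R.m_assoc)
  moreover have "bimodule R (fibre (triv_sgpd R RT \<E>) (triv_bundle R) e)" if "e \<in> arrows \<E>" for e
  proof (intro bimodule.intro bimodule_axioms.intro R.ring_axioms abelian_groupI)
    fix x assume "x \<in> carrier (fibre (triv_sgpd R RT \<E>) (triv_bundle R) e)"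
    then show "\<exists>y\<in>carrier (fibre (triv_sgpd R RT \<E>) (triv_bundle R) e).
        y \<oplus>\<^bsub>fibre (triv_sgpd R RT \<E>) (triv_bundle R) e\<^esub> x = \<zero>\<^bsub>fibre (triv_sgpd R RT \<E>) (triv_bundle R) e\<^esub>"
      by (intro bexI[of _ "(\<ominus>\<^bsub>R\<^esub> fst x, e)"]) (auto simp: R.l_neg)
  qed (use that in \<open>auto simp: R.a_assoc R.m_assoc R.l_distr R.r_distr intro: R.a_comm\<close>)
  moreover have "rigid_hom (triv_sgpd R RT \<E>) \<E> (proj (triv_bundle R))"
    unfolding rigid_hom_def sgpd_hom_def by (auto simp: composable_triv composable_def)
  ultimately show ?thesis
    by (intro R_bundle.intro R_bundle_axioms.intro R.ring_axioms \<E>.semigroupoid_axioms)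
      (auto simp: R.m_assoc R.l_distr R.r_distr)
qed

lemma graph_section_apply [simp]: "e \<in> arrows \<E> \<Longrightarrow> graph_section \<E> f e = (f e, e)"
  by (simp add: graph_section_def)

lemma graph_section_closed:
  "f \<in> carrier (R_functions R \<E>) \<Longrightarrow> graph_section \<E> f \<in> carrier (sections (triv_sgpd R RT \<E>) \<E> (triv_bundle R))"
  by (auto simp: graph_section_def)

lemma graph_section_inj:
  assumes "f \<in> carrier (R_functions R \<E>)" "g \<in> carrier (R_functions R \<E>)"
    "graph_section \<E> f = graph_section \<E> g"
  shows "f = g"
proof (rule PiE_ext)
  show "f \<in> arrows \<E> \<rightarrow>\<^sub>E carrier R" "g \<in> arrows \<E> \<rightarrow>\<^sub>E carrier R" using assms by simp_all
  show "f e = g e" if "e \<in> arrows \<E>" for e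
    using that fun_cong[OF assms(3), of e] by simp
qed

lemma graph_section_surj:
  assumes "s \<in> carrier (sections (triv_sgpd R RT \<E>) \<E> (triv_bundle R))"
  obtains f where "f \<in> carrier (R_functions R \<E>)" "s = graph_section \<E> f"
proof
  show "(\<lambda>e\<in>arrows \<E>. fst (s e)) \<in> carrier (R_functions R \<E>)" using assms by (auto simp: PiE_iff)
  show "s = graph_section \<E> (\<lambda>e\<in>arrows \<E>. fst (s e))"
    using assms by (auto simp: PiE_iff graph_section_def fun_eq_iff extensional_def restrict_def prod_eq_iff)
qed

lemma graph_section_ops:
  "graph_section \<E> (f \<oplus>\<^bsub>R_functions R \<E>\<^esub> g) =
    graph_section \<E> f \<oplus>\<^bsub>sections (triv_sgpd R RT \<E>) \<E> (triv_bundle R)\<^esub> graph_section \<E> g"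
  "graph_section \<E> \<zero>\<^bsub>R_functions R \<E>\<^esub> = \<zero>\<^bsub>sections (triv_sgpd R RT \<E>) \<E> (triv_bundle R)\<^esub>"
  "graph_section \<E> (lscal (R_functions R \<E>) r f) =
    lscal (sections (triv_sgpd R RT \<E>) \<E> (triv_bundle R)) r (graph_section \<E> f)"
  "graph_section \<E> (rscal (R_functions R \<E>) f r) =
    rscal (sections (triv_sgpd R RT \<E>) \<E> (triv_bundle R)) (graph_section \<E> f) r"
  by (auto simp: graph_section_def intro!: restrict_ext)

text \<open>All summands of the convolution product at \<open>e\<close> lie in the fibre \<open>R \<times> {e}\<close>, in which sums are
  computed in the first component.\<close>

lemma graph_section_mult:
  assumes "ring R" "semigroupoid \<E>"
    and fg: "f \<in> carrier (R_functions R \<E>)" "g \<in> carrier (R_functions R \<E>)"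
  shows "graph_section \<E> (f \<otimes>\<^bsub>R_functions R \<E>\<^esub> g) =
    graph_section \<E> f \<otimes>\<^bsub>sections (triv_sgpd R RT \<E>) \<E> (triv_bundle R)\<^esub> graph_section \<E> g"
proof -
  interpret R: ring R by fact
  interpret \<E>: semigroupoid \<E> by fact
  interpret T: R_bundle R "triv_sgpd R RT \<E>" \<E> "triv_bundle R" by (rule R_bundle_triv) fact+
  have "((f \<otimes>\<^bsub>R_functions R \<E>\<^esub> g) e, e) =
      finsum (fibre (triv_sgpd R RT \<E>) (triv_bundle R) e)
        (\<lambda>(a, b). sgpd_mult (triv_sgpd R RT \<E>) (graph_section \<E> f a) (graph_section \<E> g b))
        (conv_pairs \<E> (triv_bundle R) (graph_section \<E> f) (graph_section \<E> g) e)"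
    (is "_ = finsum ?F _ ?P") if e: "e \<in> arrows \<E>" for e
  proof -
    interpret G: abelian_group ?F by (rule T.fib_abelian[OF e])
    have P: "?P = {(a, b) \<in> composable \<E>. sgpd_mult \<E> a b = e \<and> f a \<noteq> \<zero>\<^bsub>R\<^esub> \<and> g b \<noteq> \<zero>\<^bsub>R\<^esub>}"
      by (auto simp: conv_pairs_def composable_def)
    have cl: "(\<lambda>(a, b). f a \<otimes>\<^bsub>R\<^esub> g b) \<in> ?P \<rightarrow> carrier R"
      using fg by (auto simp: P composable_def PiE_iff)
    have "((f \<otimes>\<^bsub>R_functions R \<E>\<^esub> g) e, e) = (finsum R (\<lambda>(a, b). f a \<otimes>\<^bsub>R\<^esub> g b) ?P, e)"
      using e unfolding P by (simp add: R_functions_def)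
    also have "\<dots> = finsum ?F (\<lambda>p. (case p of (a, b) \<Rightarrow> f a \<otimes>\<^bsub>R\<^esub> g b, e)) ?P"
      using additive_finsum[OF R.abelian_group_axioms G.abelian_group_axioms, of "\<lambda>r. (r, e)"
          "\<lambda>(a, b). f a \<otimes>\<^bsub>R\<^esub> g b" ?P] cl e by auto
    also have "\<dots> = finsum ?F
        (\<lambda>(a, b). sgpd_mult (triv_sgpd R RT \<E>) (graph_section \<E> f a) (graph_section \<E> g b)) ?P"
      by (rule G.finsum_cong'[OF refl])
        (use T.conv_summand_closed[OF graph_section_closed[OF fg(1)] graph_section_closed[OF fg(2)] T.conv_pairs_subset]
          in \<open>auto simp: conv_pairs_def composable_def\<close>)
    finally show ?thesis .
  qed
  then show ?thesis
    unfolding sections_mult by (auto simp: graph_section_def[of \<E> "f \<otimes>\<^bsub>R_functions R \<E>\<^esub> g"] intro!: restrict_ext)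
qed

section \<open>Local properties of continuous maps\<close>

lemma continuous_map_compose2:
  assumes h: "continuous_map (subtopology (prod_topology X Y) S) Z (\<lambda>(a, b). h a b)"
    and f: "continuous_map W X f" and g: "continuous_map W Y g"
    and S: "\<And>w. w \<in> topspace W \<Longrightarrow> (f w, g w) \<in> S"
  shows "continuous_map W Z (\<lambda>w. h (f w) (g w))"
proof -
  have "continuous_map W (subtopology (prod_topology X Y) S) (\<lambda>w. (f w, g w))"
    using S by (auto simp: continuous_map_in_subtopology intro: continuous_map_pairedI f g)
  from continuous_map_compose[OF this h] show ?thesis by (simp add: o_def)
qed

lemma continuous_map_compose2':
  assumes "continuous_map (prod_topology X Y) Z (\<lambda>(a, b). h a b)"
    and "continuous_map W X f" and "continuous_map W Y g"
  shows "continuous_map W Z (\<lambda>w. h (f w) (g w))"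
  using continuous_map_compose2[of X Y UNIV Z h W f g] assms by simp

lemma continuous_map_locally:
  assumes "\<And>x. x \<in> topspace X \<Longrightarrow> \<exists>U. openin X U \<and> x \<in> U \<and> continuous_map (subtopology X U) Y f"
  shows "continuous_map X Y f"
proof -
  have f: "f ` topspace X \<subseteq> topspace Y"
  proof (clarify)
    fix x assume "x \<in> topspace X"
    then obtain U where "x \<in> U" "continuous_map (subtopology X U) Y f" "x \<in> topspace X"
      using assms by blast
    then show "f x \<in> topspace Y"
      using continuous_map_image_subset_topspace[of "subtopology X U" Y f] by auto
  qed
  have "openin X {x \<in> topspace X. f x \<in> W}" if W: "openin Y W" for W
  proof (subst openin_subopen, clarify)
    fix x assume x: "x \<in> topspace X" "f x \<in> W"
    obtain U where U: "openin X U" "x \<in> U" "continuous_map (subtopology X U) Y f"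
      using assms x by blast
    have "openin (subtopology X U) {x \<in> topspace (subtopology X U). f x \<in> W}"
      by (rule openin_continuous_map_preimage[OF U(3) W])
    then have "openin X {x \<in> topspace (subtopology X U). f x \<in> W}"
      using U(1) openin_open_subtopology by blast
    then show "\<exists>T. openin X T \<and> x \<in> T \<and> T \<subseteq> {x \<in> topspace X. f x \<in> W}"
      using x U by (intro exI[of _ "{x \<in> topspace (subtopology X U). f x \<in> W}"]) auto
  qed
  then show ?thesis using f by (auto simp: continuous_map_def)
qed

lemma compactin_finite_subcover:
  assumes "compactin X K" "\<forall>x\<in>K. \<exists>U. openin X U \<and> x \<in> U \<and> P U"
  obtains \<F> where "finite \<F>" "\<forall>U\<in>\<F>. openin X U \<and> P U" "K \<subseteq> \<Union>\<F>"
proof -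
  let ?\<U> = "{U. openin X U \<and> P U}"
  have "K \<subseteq> \<Union>?\<U>" using assms(2) by blast
  then obtain \<F> where "finite \<F>" "\<F> \<subseteq> ?\<U>" "K \<subseteq> \<Union>\<F>"
    using assms(1) unfolding compactin_def by (metis (no_types, lifting) mem_Collect_eq)
  then show thesis using that by auto
qed

lemma local_homeomorphism_open_map:
  assumes "local_homeomorphism X Y f"
  shows "open_map X Y f"
  unfolding open_map_def
proof (intro allI impI)
  fix W assume W: "openin X W"
  show "openin Y (f ` W)"
  proof (subst openin_subopen, clarify)
    fix x assume x: "x \<in> W"
    then have "x \<in> topspace X" using W openin_subset by blast
    then obtain U where U: "openin X U" "x \<in> U" "openin Y (f ` U)"
      "homeomorphic_map (subtopology X U) (subtopology Y (f ` U)) f"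
      using assms unfolding local_homeomorphism_def by blast
    have "openin (subtopology X U) (U \<inter> W)" using U(1) W by (simp add: openin_open_subtopology openin_Int)
    then have "openin (subtopology Y (f ` U)) (f ` (U \<inter> W))"
      using homeomorphic_imp_open_map[OF U(4)] by (simp add: open_map_def)
    then have "openin Y (f ` (U \<inter> W))" using U(3) openin_open_subtopology by blast
    then show "\<exists>T. openin Y T \<and> f x \<in> T \<and> T \<subseteq> f ` W" using x U(2) by blast
  qed
qed

text \<open>Being open, a local homeomorphism restricts to a homeomorphism onto an open set wherever it is
  injective.\<close>

lemma local_homeomorphism_local_section:
  assumes lh: "local_homeomorphism X Y f" and cont: "continuous_map X Y f"
    and U: "openin X U" "inj_on f U"
  obtains t where "continuous_map (subtopology Y (f ` U)) (subtopology X U) t"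
    "\<And>x. x \<in> U \<Longrightarrow> t (f x) = x"
proof -
  note om = local_homeomorphism_open_map[OF lh]
  have sub: "U \<subseteq> topspace X" using U(1) openin_subset by blast
  have fU: "openin Y (f ` U)" using om U(1) by (simp add: open_map_def)
  have "homeomorphic_map (subtopology X U) (subtopology Y (f ` U)) f"
  proof (rule bijective_open_imp_homeomorphic_map)
    show "continuous_map (subtopology X U) (subtopology Y (f ` U)) f"
      using cont by (auto simp: continuous_map_in_subtopology continuous_map_from_subtopology)
    show "open_map (subtopology X U) (subtopology Y (f ` U)) f"
      using om U(1) fU by (auto simp: open_map_def openin_open_subtopology)
    show "f ` topspace (subtopology X U) = topspace (subtopology Y (f ` U))"
      using sub fU openin_subset[OF fU] by auto
    show "inj_on f (topspace (subtopology X U))" using U(2) sub by (simp add: Int_absorb1)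
  qed
  then obtain t where "homeomorphic_maps (subtopology X U) (subtopology Y (f ` U)) f t"
    by (auto simp: homeomorphic_map_maps)
  then show thesis using that[of t] sub unfolding homeomorphic_maps_def by auto
qed

text \<open>The support of a section is a closure in the whole space, that of a function a closure in the
  open subspace. In either case its compactness means that a compact subset of the subspace contains
  the points with nonzero values, since compact sets are closed in a Hausdorff space.\<close>

lemma closure_in_open_subspace:
  "N \<subseteq> V \<Longrightarrow> subtopology X V closure_of N = X closure_of N \<inter> V"
  by (metis closure_of_subtopology inf.absorb_iff2 inf_commute)

lemma compactin_closure_in_Hausdorff_iff:
  assumes V: "V \<subseteq> topspace X" and H: "Hausdorff_space (subtopology X V)" and N: "N \<subseteq> V"
  shows "compactin X (X closure_of N \<inter> V) \<longleftrightarrow> (\<exists>K. compactin X K \<and> K \<subseteq> V \<and> N \<subseteq> K)"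
proof
  assume "compactin X (X closure_of N \<inter> V)"
  moreover have "N \<subseteq> X closure_of N" using closure_of_subset[of N X] N V by auto
  ultimately show "\<exists>K. compactin X K \<and> K \<subseteq> V \<and> N \<subseteq> K" using N by blast
next
  assume "\<exists>K. compactin X K \<and> K \<subseteq> V \<and> N \<subseteq> K"
  then obtain K where K: "compactin X K" "K \<subseteq> V" "N \<subseteq> K" by blast
  then have KV: "compactin (subtopology X V) K" by (simp add: compactin_subtopology)
  have "subtopology X V closure_of N \<subseteq> K"
    by (rule closure_of_minimal[OF K(3) compactin_imp_closedin[OF H KV]])
  from closed_compactin[OF KV this closedin_closure_of]
  show "compactin X (X closure_of N \<inter> V)"
    by (simp add: compactin_subtopology closure_in_open_subspace[OF N])
qed

section \<open>Etale semigroupoids\<close>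

context etale_semigroupoid
begin

lemma open_arrows: "openin (atop S) U \<Longrightarrow> U \<subseteq> arrows S"
  using openin_subset topspace_atop by blast

lemma open_bisection_nbhd:
  assumes W: "openin (atop S) W" and a: "a \<in> W"
  obtains U where "openin (atop S) U" "bisection S U" "a \<in> U" "U \<subseteq> W"
proof -
  have top: "a \<in> topspace (atop S)" using assms openin_subset by blast
  obtain U1 where U1: "openin (atop S) U1" "a \<in> U1"
      "homeomorphic_map (subtopology (atop S) U1) (subtopology (vtop S) (source S ` U1)) (source S)"
    using local_homeomorphism_source top unfolding local_homeomorphism_def by blast
  obtain U2 where U2: "openin (atop S) U2" "a \<in> U2"
      "homeomorphic_map (subtopology (atop S) U2) (subtopology (vtop S) (range_of S ` U2)) (range_of S)"
    using local_homeomorphism_range top unfolding local_homeomorphism_def by blast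
  have "inj_on (source S) U1" "inj_on (range_of S) U2"
    using U1(1,3) U2(1,3) open_arrows topspace_atop by (auto simp: homeomorphic_map_def Int_absorb1)
  then have "bisection S (U1 \<inter> U2 \<inter> W)"
    using open_arrows[OF U1(1)] by (auto simp: bisection_def inj_on_def)
  moreover have "openin (atop S) (U1 \<inter> U2 \<inter> W)" using U1 U2 W by auto
  ultimately show thesis using that[of "U1 \<inter> U2 \<inter> W"] U1(2) U2(2) a by blast
qed

text \<open>The source map sends a bisection injectively into the Hausdorff space of vertices.\<close>

lemma Hausdorff_bisection:
  assumes "bisection S U"
  shows "Hausdorff_space (subtopology (atop S) U)"
  by (rule Hausdorff_space_injective_preimage[OF Hausdorff_vtop
        continuous_map_from_subtopology[OF continuous_source]])
    (use assms in \<open>auto simp: bisection_def inj_on_def\<close>)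

lemma source_section:
  assumes "openin (atop S) U" "bisection S U"
  obtains t where "continuous_map (subtopology (vtop S) (source S ` U)) (subtopology (atop S) U) t"
    "\<forall>x\<in>U. t (source S x) = x"
  by (rule local_homeomorphism_local_section[OF local_homeomorphism_source continuous_source assms(1)])
    (use assms(2) that in \<open>auto simp: bisection_def\<close>)

lemma range_section:
  assumes "openin (atop S) U" "bisection S U"
  obtains t where "continuous_map (subtopology (vtop S) (range_of S ` U)) (subtopology (atop S) U) t"
    "\<forall>x\<in>U. t (range_of S x) = x"
  by (rule local_homeomorphism_local_section[OF local_homeomorphism_range continuous_range assms(1)])
    (use assms(2) that in \<open>auto simp: bisection_def\<close>)

lemma open_source_image: "openin (atop S) U \<Longrightarrow> openin (vtop S) (source S ` U)"
  using local_homeomorphism_open_map[OF local_homeomorphism_source] by (simp add: open_map_def)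

text \<open>Local compactness of the vertex space is transported by local sections of the source map.\<close>

lemma compact_nbhd:
  assumes W: "openin (atop S) W" and a: "a \<in> W"
  obtains C K where "openin (atop S) C" "compactin (atop S) K" "a \<in> C" "C \<subseteq> K" "K \<subseteq> W"
proof -
  obtain U where U: "openin (atop S) U" "bisection S U" "a \<in> U" "U \<subseteq> W"
    using open_bisection_nbhd[OF assms] .
  obtain t where t: "continuous_map (subtopology (vtop S) (source S ` U)) (subtopology (atop S) U) t"
    "\<forall>x\<in>U. t (source S x) = x"
    using source_section[OF U(1,2)] .
  obtain D L where D: "openin (vtop S) D" "compactin (vtop S) L" "source S a \<in> D" "D \<subseteq> L" "L \<subseteq> source S ` U"
    using locally_compact_vtop open_source_image[OF U(1)] U(3)
    unfolding neighbourhood_base_of by (metis imageI)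
  have "compactin (subtopology (vtop S) (source S ` U)) L" using D by (simp add: compactin_subtopology)
  from image_compactin[OF this t(1)]
  have K: "compactin (atop S) (t ` L)" "t ` L \<subseteq> U" by (simp_all add: compactin_subtopology)
  have "openin (atop S) {x \<in> U. source S x \<in> D}"
    by (rule openin_continuous_map_preimage_gen[OF continuous_source U(1) D(1)])
  moreover have "{x \<in> U. source S x \<in> D} \<subseteq> t ` L"
  proof clarify
    fix x assume "x \<in> U" "source S x \<in> D"
    then show "x \<in> t ` L" using t(2) D(4) by (metis imageI subsetD)
  qed
  ultimately show thesis
    using that[of "{x \<in> U. source S x \<in> D}" "t ` L"] K U D by auto
qed

text \<open>A bump function on an \<open>R\<close>-normal neighbourhood of a point vanishes near the boundary of that
  neighbourhood, hence extends by zero.\<close>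

lemma bump_function:
  assumes "topological_ring R RT" and normal: "locally_R_normal R RT (atop S)"
    and V: "openin (atop S) V" "Hausdorff_space (subtopology (atop S) V)"
    and U: "openin (atop S) U" "x \<in> U" "U \<subseteq> V"
  obtains f C K where "continuous_map (subtopology (atop S) V) RT f"
    "openin (atop S) C" "x \<in> C" "\<forall>y\<in>C. f y = \<one>\<^bsub>R\<^esub>"
    "compactin (atop S) K" "K \<subseteq> U" "\<forall>y\<in>V - K. f y = \<zero>\<^bsub>R\<^esub>"
proof -
  interpret R: topological_ring R RT by fact
  let ?X = "atop S"
  obtain C1 N where N: "openin ?X C1" "R_normal R RT (subtopology ?X N)" "x \<in> C1" "C1 \<subseteq> N" "N \<subseteq> U"
    using normal U(1,2) unfolding locally_R_normal_def neighbourhood_base_of by metis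
  obtain C2 K1 where 1: "openin ?X C2" "compactin ?X K1" "x \<in> C2" "C2 \<subseteq> K1" "K1 \<subseteq> C1"
    using compact_nbhd[OF N(1,3)] .
  obtain C3 K2 where 2: "openin ?X C3" "compactin ?X K2" "x \<in> C3" "C3 \<subseteq> K2" "K2 \<subseteq> C2"
    using compact_nbhd[OF 1(1,3)] .
  have NV: "N \<subseteq> V" using N U by blast
  have "subtopology ?X N = subtopology (subtopology ?X V) N"
    using NV by (simp add: subtopology_subtopology Int_absorb1)
  then have H: "Hausdorff_space (subtopology ?X N)" using V(2) Hausdorff_space_subtopology by metis
  have "compactin (subtopology ?X N) K2" using 1 2 N by (auto simp: compactin_subtopology)
  then have cl2: "closedin (subtopology ?X N) K2" by (rule compactin_imp_closedin[OF H])
  have topN: "topspace (subtopology ?X N) = N"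
    using NV openin_subset[OF V(1)] by auto
  have "openin (subtopology ?X N) (N \<inter> C2)" using 1(1) by (auto simp: openin_subtopology)
  then have "closedin (subtopology ?X N) (N - C2)"
    using topN by (metis Diff_Int_distrib2 Diff_Int closedin_diff closedin_topspace Diff_cancel Un_empty_left)
  then obtain f where f: "continuous_map (subtopology ?X N) RT f"
    "\<forall>y\<in>N - C2. f y = \<zero>\<^bsub>R\<^esub>" "\<forall>y\<in>K2. f y = \<one>\<^bsub>R\<^esub>"
    using N(2)[unfolded R_normal_def, rule_format, of "N - C2" K2] cl2 2(5) by blast
  \<comment> \<open>continuous on \<open>C1\<close>, where it agrees with \<open>f\<close>, and on the complement of \<open>K1\<close>, where it is zero\<close>
  define g where "g y = (if y \<in> C2 then f y else \<zero>\<^bsub>R\<^esub>)" for y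
  have zeroRT: "\<zero>\<^bsub>R\<^esub> \<in> topspace RT" by (simp add: R.topspace_RT)
  have "continuous_map (subtopology ?X V) RT g"
  proof (rule continuous_map_locally)
    fix y assume y: "y \<in> topspace (subtopology ?X V)"
    have sub: "subtopology (subtopology ?X V) A = subtopology ?X A" if "A \<subseteq> V" for A
      using that by (simp add: subtopology_subtopology Int_absorb1)
    show "\<exists>U. openin (subtopology ?X V) U \<and> y \<in> U \<and> continuous_map (subtopology (subtopology ?X V) U) RT g"
    proof (cases "y \<in> C1")
      case True
      have "continuous_map (subtopology ?X C1) RT f"
        by (rule continuous_map_from_subtopology_mono[OF f(1) N(4)])
      then have "continuous_map (subtopology ?X C1) RT g"
        by (rule continuous_map_eq) (use f(2) N(4) in \<open>auto simp: g_def\<close>)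
      moreover have "openin (subtopology ?X V) C1" "C1 \<subseteq> V"
        using N NV V(1) by (auto simp: openin_open_subtopology)
      ultimately show ?thesis using True sub by (intro exI[of _ C1]) auto
    next
      case False
      have "compactin (subtopology ?X V) K1" using 1 N NV by (auto simp: compactin_subtopology)
      then have "closedin (subtopology ?X V) K1" by (rule compactin_imp_closedin[OF V(2)])
      then have op: "openin (subtopology ?X V) (V - K1)"
        using openin_subset[OF V(1)] by (metis openin_diff openin_topspace topspace_subtopology_subset)
      have "continuous_map (subtopology ?X (V - K1)) RT (\<lambda>_. \<zero>\<^bsub>R\<^esub>)" using zeroRT by simp
      then have "continuous_map (subtopology ?X (V - K1)) RT g"
        by (rule continuous_map_eq) (use 1 in \<open>auto simp: g_def\<close>)
      then show ?thesis using op y False 1 sub by (intro exI[of _ "V - K1"]) auto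
    qed
  qed
  then show thesis
    by (rule that[of g C3 K1]) (use 1 2 N f in \<open>auto simp: g_def\<close>)
qed

end

section \<open>Sectional algebras\<close>

context continuous_bundle
begin

abbreviation "Cc \<equiv> Cc_sections \<Lambda> \<Gamma> \<pi>"
abbreviation "Alg \<equiv> sectional_algebra R \<Lambda> \<Gamma> \<pi>"

definition open_Hausdorff :: "'g set \<Rightarrow> bool" where
  "open_Hausdorff V \<longleftrightarrow> openin (atop \<Gamma>) V \<and> Hausdorff_space (subtopology (atop \<Gamma>) V)"

text \<open>Containment of the support in a compact set, unlike compactness of the support itself, is
  visibly inherited by the sections constructed below.\<close>

lemma Cc_iff:
  assumes V: "open_Hausdorff V"
  shows "\<alpha> \<in> Cc V \<longleftrightarrow> \<alpha> \<in> carrier Sec \<and> continuous_map (subtopology (atop \<Gamma>) V) (atop \<Lambda>) \<alpha> \<and>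
    (\<exists>K. compactin (atop \<Gamma>) K \<and> K \<subseteq> V \<and> (\<forall>\<gamma>\<in>arrows \<Gamma> - K. \<alpha> \<gamma> = fib_zero \<pi> \<gamma>))"
proof -
  have Vtop: "V \<subseteq> topspace (atop \<Gamma>)" and H: "Hausdorff_space (subtopology (atop \<Gamma>) V)"
    using V openin_subset by (auto simp: open_Hausdorff_def)
  let ?N = "{\<gamma> \<in> arrows \<Gamma>. \<alpha> \<gamma> \<noteq> fib_zero \<pi> \<gamma>}"
  have N: "?N \<subseteq> V \<longleftrightarrow> (\<forall>\<gamma>\<in>arrows \<Gamma> - V. \<alpha> \<gamma> = fib_zero \<pi> \<gamma>)"
    and N': "?N \<subseteq> K \<longleftrightarrow> (\<forall>\<gamma>\<in>arrows \<Gamma> - K. \<alpha> \<gamma> = fib_zero \<pi> \<gamma>)" for K by auto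
  show ?thesis
  proof (cases "?N \<subseteq> V")
    case True
    show ?thesis
      unfolding Cc_sections_def section_supp_def mem_Collect_eq
        compactin_closure_in_Hausdorff_iff[OF Vtop H True] N' using True N by blast
  next
    case False
    then have "\<not> (\<forall>\<gamma>\<in>arrows \<Gamma> - V. \<alpha> \<gamma> = fib_zero \<pi> \<gamma>)" using N by blast
    moreover have "\<not> (\<exists>K. compactin (atop \<Gamma>) K \<and> K \<subseteq> V \<and> (\<forall>\<gamma>\<in>arrows \<Gamma> - K. \<alpha> \<gamma> = fib_zero \<pi> \<gamma>))"
      using False N' by blast
    ultimately show ?thesis unfolding Cc_sections_def by blast
  qed
qed

lemma Cc_Sec: "\<alpha> \<in> Cc V \<Longrightarrow> \<alpha> \<in> carrier Sec"
  by (simp add: Cc_sections_def)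

lemma Cc_cont: "\<alpha> \<in> Cc V \<Longrightarrow> continuous_map (subtopology (atop \<Gamma>) V) (atop \<Lambda>) \<alpha>"
  by (simp add: Cc_sections_def)

lemma open_Hausdorff_arrows: "open_Hausdorff V \<Longrightarrow> V \<subseteq> arrows \<Gamma>"
  using openin_subset \<Gamma>.topspace_atop by (fastforce simp: open_Hausdorff_def)

lemma open_Hausdorff_mono: "open_Hausdorff V \<Longrightarrow> openin (atop \<Gamma>) U \<Longrightarrow> U \<subseteq> V \<Longrightarrow> open_Hausdorff U"
  using Hausdorff_space_subtopology[of "subtopology (atop \<Gamma>) V" U]
  by (auto simp: open_Hausdorff_def subtopology_subtopology Int_absorb1)

text \<open>Multiplication by a scalar function can shrink the support; \<open>U\<close> is an open set in which it still
  lies.\<close>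

lemma Cc_times:
  assumes V: "open_Hausdorff V" and \<alpha>: "\<alpha> \<in> Cc V"
    and g: "continuous_map (subtopology (atop \<Gamma>) V) RT g"
    and U: "openin (atop \<Gamma>) U" "U \<subseteq> V"
    and K: "compactin (atop \<Gamma>) K" "K \<subseteq> U" "\<And>\<gamma>. \<gamma> \<in> V - K \<Longrightarrow> \<alpha> \<gamma> = fib_zero \<pi> \<gamma> \<or> g \<gamma> = \<zero>\<^bsub>R\<^esub>"
  shows "(\<lambda>\<gamma>\<in>arrows \<Gamma>. if \<gamma> \<in> V then fib_rscal \<pi> (\<alpha> \<gamma>) (g \<gamma>) else fib_zero \<pi> \<gamma>) \<in> Cc U"
    (is "?\<beta> \<in> _")
  unfolding Cc_iff[OF open_Hausdorff_mono[OF V U]]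
proof (intro conjI exI[of _ K] K(1,2) ballI)
  have Varr: "V \<subseteq> arrows \<Gamma>" by (rule open_Hausdorff_arrows[OF V])
  have gR: "g \<gamma> \<in> carrier R" if "\<gamma> \<in> V" for \<gamma>
    using continuous_map_image_subset_topspace[OF g] that Varr
    by (auto simp: R.topspace_RT \<Gamma>.topspace_atop)
  have \<alpha>\<Lambda>: "\<alpha> \<gamma> \<in> arrows \<Lambda>" "proj \<pi> (\<alpha> \<gamma>) = \<gamma>" if "\<gamma> \<in> arrows \<Gamma>" for \<gamma>
    using Cc_Sec[OF \<alpha>] that by (auto simp: PiE_iff)
  show "?\<beta> \<in> carrier Sec"
    using gR \<alpha>\<Lambda> fib_rules Varr by (auto simp: fib_rules)
  show "?\<beta> \<gamma> = fib_zero \<pi> \<gamma>" if "\<gamma> \<in> arrows \<Gamma> - K" for \<gamma>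
    using that K(3)[of \<gamma>] gR[of \<gamma>] \<alpha>\<Lambda>[of \<gamma>] by (auto simp: fib_rules)
  have "continuous_map (subtopology (atop \<Gamma>) V) (atop \<Lambda>) (\<lambda>\<gamma>. fib_rscal \<pi> (\<alpha> \<gamma>) (g \<gamma>))"
    by (rule continuous_map_compose2'[OF continuous_fib_rscal Cc_cont[OF \<alpha>] g])
  then have "continuous_map (subtopology (atop \<Gamma>) U) (atop \<Lambda>) (\<lambda>\<gamma>. fib_rscal \<pi> (\<alpha> \<gamma>) (g \<gamma>))"
    using continuous_map_from_subtopology_mono U(2) by blast
  then show "continuous_map (subtopology (atop \<Gamma>) U) (atop \<Lambda>) ?\<beta>"
    by (rule continuous_map_eq) (use U Varr in auto)
qed

lemma Cc_scal:
  assumes V: "open_Hausdorff V" and \<alpha>: "\<alpha> \<in> Cc V" and r: "r \<in> carrier R"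
  shows "lscal Sec r \<alpha> \<in> Cc V" "rscal Sec \<alpha> r \<in> Cc V"
proof -
  interpret S: bimodule R Sec by (rule bimodule_sections)
  obtain K where K: "compactin (atop \<Gamma>) K" "K \<subseteq> V" "\<forall>\<gamma>\<in>arrows \<Gamma> - K. \<alpha> \<gamma> = fib_zero \<pi> \<gamma>"
    using \<alpha> unfolding Cc_iff[OF V] by blast
  have Varr: "V \<subseteq> arrows \<Gamma>" by (rule open_Hausdorff_arrows[OF V])
  have c: "continuous_map (subtopology (atop \<Gamma>) V) RT (\<lambda>_. r)" using r by (simp add: R.topspace_RT)
  show "lscal Sec r \<alpha> \<in> Cc V"
    unfolding Cc_iff[OF V]
  proof (intro conjI exI[of _ K] K(1,2) S.lscal_closed r Cc_Sec[OF \<alpha>])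
    have "continuous_map (subtopology (atop \<Gamma>) V) (atop \<Lambda>) (\<lambda>\<gamma>. fib_lscal \<pi> r (\<alpha> \<gamma>))"
      by (rule continuous_map_compose2'[OF continuous_fib_lscal c Cc_cont[OF \<alpha>]])
    then show "continuous_map (subtopology (atop \<Gamma>) V) (atop \<Lambda>) (lscal Sec r \<alpha>)"
      by (rule continuous_map_eq) (use Varr in auto)
  qed (use K r in \<open>auto simp: fib_rules\<close>)
  show "rscal Sec \<alpha> r \<in> Cc V"
    unfolding Cc_iff[OF V]
  proof (intro conjI exI[of _ K] K(1,2) S.rscal_closed r Cc_Sec[OF \<alpha>])
    have "continuous_map (subtopology (atop \<Gamma>) V) (atop \<Lambda>) (\<lambda>\<gamma>. fib_rscal \<pi> (\<alpha> \<gamma>) r)"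
      by (rule continuous_map_compose2'[OF continuous_fib_rscal Cc_cont[OF \<alpha>] c])
    then show "continuous_map (subtopology (atop \<Gamma>) V) (atop \<Lambda>) (rscal Sec \<alpha> r)"
      by (rule continuous_map_eq) (use Varr in auto)
  qed (use K r in \<open>auto simp: fib_rules\<close>)
qed

definition gens :: "('g \<Rightarrow> 'l) set" where
  "gens = (\<Union>V\<in>{V. open_Hausdorff V}. Cc V)"

lemma scalar_closed_gens: "scalar_closed R Sec gens"
  using Cc_scal Cc_Sec unfolding scalar_closed_def gens_def by blast

lemma Alg_eq: "Alg = Sec\<lparr>carrier := add_span Sec gens\<rparr>"
  using bimodule.bimod_span_eq_add_span[OF bimodule_sections scalar_closed_gens]
  by (simp add: sectional_algebra_def gens_def open_Hausdorff_def)

lemma Alg_simps [simp]: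
  "carrier Alg = add_span Sec gens" "\<alpha> \<oplus>\<^bsub>Alg\<^esub> \<beta> = \<alpha> \<oplus>\<^bsub>Sec\<^esub> \<beta>" "\<zero>\<^bsub>Alg\<^esub> = \<zero>\<^bsub>Sec\<^esub>"
  "\<alpha> \<otimes>\<^bsub>Alg\<^esub> \<beta> = \<alpha> \<otimes>\<^bsub>Sec\<^esub> \<beta>" "lscal Alg = lscal Sec" "rscal Alg = rscal Sec"
  by (simp_all add: Alg_eq del: sections_simps)

lemma bimodule_Alg: "bimodule R Alg"
  unfolding Alg_eq by (rule bimodule.bimodule_add_span[OF bimodule_sections scalar_closed_gens])

lemma Alg_Sec: "\<alpha> \<in> carrier Alg \<Longrightarrow> \<alpha> \<in> carrier Sec"
  using bimodule.add_span_subset[OF bimodule_sections, of gens] scalar_closed_gens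
  by (auto simp: scalar_closed_def simp del: sections_simps)

lemma Cc_Alg: "open_Hausdorff V \<Longrightarrow> \<alpha> \<in> Cc V \<Longrightarrow> \<alpha> \<in> carrier Alg"
  by (auto simp: gens_def intro: add_span.incl)

lemma Alg_induct [consumes 1, case_names zero Cc add]:
  assumes "\<alpha> \<in> carrier Alg" "P \<zero>\<^bsub>Sec\<^esub>"
    and "\<And>\<alpha> V. open_Hausdorff V \<Longrightarrow> \<alpha> \<in> Cc V \<Longrightarrow> P \<alpha>"
    and "\<And>\<alpha> \<beta>. \<alpha> \<in> carrier Alg \<Longrightarrow> \<beta> \<in> carrier Alg \<Longrightarrow> P \<alpha> \<Longrightarrow> P \<beta> \<Longrightarrow> P (\<alpha> \<oplus>\<^bsub>Sec\<^esub> \<beta>)"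
  shows "P \<alpha>"
  using assms(1)[simplified]
  by induction (use assms in \<open>auto simp: gens_def simp del: sections_simps\<close>)

end

locale etale_bundle = continuous_bundle R RT \<Lambda> \<Gamma> \<pi> + E: etale_semigroupoid \<Gamma>
  for R :: "'r ring" and RT :: "'r topology"
    and \<Lambda> :: "('p, 'l) top_sgpd" and \<Gamma> :: "('o, 'g) top_sgpd" and \<pi> :: "('r, 'g, 'l) rbundle"
begin

text \<open>A compact set is covered by finitely many bisections, each of which has at most one arrow with a
  given source, and at most one with a given range.\<close>

lemma fibre_finite_Alg:
  assumes "\<alpha> \<in> carrier Alg"
  shows "fibre_finite \<Gamma> \<pi> \<alpha>"
  using assms
proof (induction rule: Alg_induct)
  case zero
  show ?case by (rule fibre_finite_zero)
next
  case (Cc \<alpha> V)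
  then obtain K where K: "compactin (atop \<Gamma>) K" "K \<subseteq> V" "\<forall>\<gamma>\<in>arrows \<Gamma> - K. \<alpha> \<gamma> = fib_zero \<pi> \<gamma>"
    by (auto simp: Cc_iff)
  have Varr: "V \<subseteq> arrows \<Gamma>" by (rule open_Hausdorff_arrows[OF Cc(1)])
  have "\<forall>x\<in>K. \<exists>U. openin (atop \<Gamma>) U \<and> x \<in> U \<and> bisection \<Gamma> U"
    using E.open_bisection_nbhd[of "arrows \<Gamma>"] K(2) Varr \<Gamma>.topspace_atop
    by (metis openin_topspace subsetD)
  then obtain \<F> where \<F>: "finite \<F>" "\<forall>U\<in>\<F>. openin (atop \<Gamma>) U \<and> bisection \<Gamma> U" "K \<subseteq> \<Union>\<F>"
    by (rule compactin_finite_subcover[OF K(1)])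
  have fin: "finite {a \<in> arrows \<Gamma>. h a = v \<and> \<alpha> a \<noteq> fib_zero \<pi> a}"
    if h: "\<And>U. U \<in> \<F> \<Longrightarrow> inj_on h U" for h :: "_ \<Rightarrow> 'o" and v
  proof (rule finite_subset)
    show "{a \<in> arrows \<Gamma>. h a = v \<and> \<alpha> a \<noteq> fib_zero \<pi> a} \<subseteq> (\<Union>U\<in>\<F>. {a \<in> U. h a = v})"
      using K(3) \<F>(3) by blast
    have "finite {a \<in> U. h a = v}" if "U \<in> \<F>" for U
    proof (rule inj_on_finite[where B = "{v}" and f = h])
      show "inj_on h {a \<in> U. h a = v}" using h[OF that] by (auto simp: inj_on_def)
    qed auto
    then show "finite (\<Union>U\<in>\<F>. {a \<in> U. h a = v})" using \<F>(1) by blast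
  qed
  show ?case
    unfolding fibre_finite_def using fin[of "range_of \<Gamma>"] fin[of "source \<Gamma>"] \<F>(2)
    by (auto simp: bisection_def)
next
  case (add \<alpha> \<beta>)
  then show ?case by (intro fibre_finite_add)
qed

end

section \<open>Convolution products of compactly supported sections\<close>

definition arrow_set_mult :: "('o, 'a, 'k) sgpd_scheme \<Rightarrow> 'a set \<Rightarrow> 'a set \<Rightarrow> 'a set" where
  "arrow_set_mult S U W = {sgpd_mult S a b | a b. a \<in> U \<and> b \<in> W \<and> (a, b) \<in> composable S}"

context etale_semigroupoid
begin

text \<open>Arrows of a product of bisections factor uniquely, and the factors depend continuously on
  the product: one is found from its range, the other one from its source.\<close>

lemma factorisation:
  assumes U: "openin (atop S) U" "bisection S U" and W: "openin (atop S) W" "bisection S W"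
  obtains p q where "continuous_map (subtopology (atop S) (arrow_set_mult S U W)) (subtopology (atop S) U) p"
    "continuous_map (subtopology (atop S) (arrow_set_mult S U W)) (subtopology (atop S) W) q"
    "\<forall>a\<in>U. \<forall>b\<in>W. (a, b) \<in> composable S \<longrightarrow> p (sgpd_mult S a b) = a \<and> q (sgpd_mult S a b) = b"
proof -
  obtain t where t: "continuous_map (subtopology (vtop S) (source S ` W)) (subtopology (atop S) W) t"
    "\<forall>x\<in>W. t (source S x) = x" using source_section[OF W] .
  obtain u where u: "continuous_map (subtopology (vtop S) (range_of S ` U)) (subtopology (atop S) U) u"
    "\<forall>x\<in>U. u (range_of S x) = x" using range_section[OF U] .
  have "continuous_map (subtopology (atop S) (arrow_set_mult S U W)) (subtopology (vtop S) (source S ` W)) (source S)"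
    using continuous_source source_comp
    by (auto simp: continuous_map_in_subtopology continuous_map_from_subtopology arrow_set_mult_def)
  from continuous_map_compose[OF this t(1)]
  have q: "continuous_map (subtopology (atop S) (arrow_set_mult S U W)) (subtopology (atop S) W) (t \<circ> source S)" .
  have "continuous_map (subtopology (atop S) (arrow_set_mult S U W)) (subtopology (vtop S) (range_of S ` U)) (range_of S)"
    using continuous_range range_comp
    by (auto simp: continuous_map_in_subtopology continuous_map_from_subtopology arrow_set_mult_def)
  from continuous_map_compose[OF this u(1)]
  have p: "continuous_map (subtopology (atop S) (arrow_set_mult S U W)) (subtopology (atop S) U) (u \<circ> range_of S)" .
  show thesis
    by (rule that[OF p q]) (use t(2) u(2) source_comp range_comp in auto)
qed

text \<open>The inverses of the source map on the two bisections produce a continuous local section of the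
  source map through a given product \<open>ab\<close>, with values in the product set. Arrows with the same source
  in a bisection around \<open>ab\<close> coincide, so that near \<open>ab\<close> every arrow is a value of that section.\<close>

lemma open_arrow_set_mult:
  assumes U: "openin (atop S) U" "bisection S U" and W: "openin (atop S) W" "bisection S W"
  shows "openin (atop S) (arrow_set_mult S U W)"
proof (subst openin_subopen, clarify)
  fix c assume "c \<in> arrow_set_mult S U W"
  then obtain a b where ab: "c = sgpd_mult S a b" "a \<in> U" "b \<in> W" "(a, b) \<in> composable S"
    by (auto simp: arrow_set_mult_def)
  have "c \<in> arrows S" using ab comp_closed by simp
  then obtain Z where Z: "openin (atop S) Z" "bisection S Z" "c \<in> Z"
    using open_bisection_nbhd[of "arrows S" c] topspace_atop by (metis openin_topspace)
  obtain t where t: "continuous_map (subtopology (vtop S) (source S ` W)) (subtopology (atop S) W) t"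
    "\<forall>x\<in>W. t (source S x) = x" using source_section[OF W] .
  obtain u where u: "continuous_map (subtopology (vtop S) (source S ` U)) (subtopology (atop S) U) u"
    "\<forall>x\<in>U. u (source S x) = x" using source_section[OF U] .
  define D1 where "D1 = {x \<in> Z. source S x \<in> source S ` W}"
  define q where "q x = t (source S x)" for x
  have D1: "openin (atop S) D1" unfolding D1_def
    by (rule openin_continuous_map_preimage_gen[OF continuous_source Z(1) open_source_image[OF W(1)]])
  have "continuous_map (subtopology (atop S) D1) (subtopology (vtop S) (source S ` W)) (source S)"
    using continuous_source
    by (auto simp: continuous_map_in_subtopology continuous_map_from_subtopology D1_def)
  from continuous_map_compose[OF this t(1)]
  have q: "continuous_map (subtopology (atop S) D1) (atop S) q"
    by (simp add: continuous_map_in_subtopology q_def[abs_def] o_def)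
  have qW: "q x \<in> W" "source S (q x) = source S x" if "x \<in> D1" for x
    using that t(2) by (auto simp: D1_def q_def)
  define D2 where "D2 = {x \<in> D1. range_of S (q x) \<in> source S ` U}"
  define p where "p x = u (range_of S (q x))" for x
  have rq: "continuous_map (subtopology (atop S) D1) (vtop S) (\<lambda>x. range_of S (q x))"
    using continuous_map_compose[OF q continuous_range] by (simp add: o_def)
  have "openin (subtopology (atop S) D1) D2" unfolding D2_def
    by (rule openin_continuous_map_preimage_gen[OF rq _ open_source_image[OF U(1)]])
      (use D1 openin_subset in \<open>simp add: openin_open_subtopology\<close>)
  then have D2: "openin (atop S) D2" using D1 openin_open_subtopology by blast
  have D21: "D2 \<subseteq> D1" by (auto simp: D2_def)
  have "continuous_map (subtopology (atop S) D2) (subtopology (vtop S) (source S ` U)) (\<lambda>x. range_of S (q x))"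
    using continuous_map_from_subtopology_mono[OF rq D21]
    by (auto simp: continuous_map_in_subtopology D2_def)
  from continuous_map_compose[OF this u(1)]
  have p: "continuous_map (subtopology (atop S) D2) (atop S) p"
    by (simp add: continuous_map_in_subtopology p_def[abs_def] o_def)
  have pU: "p x \<in> U" "source S (p x) = range_of S (q x)" if "x \<in> D2" for x
    using that u(2) by (auto simp: D2_def p_def)
  have comp: "(p x, q x) \<in> composable S" if "x \<in> D2" for x
    using pU[OF that] qW[of x] that D21 open_arrows[OF U(1)] open_arrows[OF W(1)]
    by (auto simp: composable_def)
  have m: "continuous_map (subtopology (atop S) D2) (atop S) (\<lambda>x. sgpd_mult S (p x) (q x))"
    by (rule continuous_map_compose2[OF continuous_comp p continuous_map_from_subtopology_mono[OF q D21]])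
      (use comp in auto)
  define D3 where "D3 = {x \<in> D2. sgpd_mult S (p x) (q x) \<in> Z}"
  have "openin (subtopology (atop S) D2) D3" unfolding D3_def
    by (rule openin_continuous_map_preimage_gen[OF m _ Z(1)])
      (use D2 openin_subset in \<open>simp add: openin_open_subtopology\<close>)
  then have D3: "openin (atop S) D3" using D2 openin_open_subtopology by blast
  have "x \<in> arrow_set_mult S U W" if x: "x \<in> D3" for x
  proof -
    have x2: "x \<in> D2" "x \<in> D1" "x \<in> Z" "sgpd_mult S (p x) (q x) \<in> Z"
      using x by (auto simp: D3_def D2_def D1_def)
    have "source S (sgpd_mult S (p x) (q x)) = source S x"
      using source_comp[OF comp[OF x2(1)]] qW(2)[OF x2(2)] by simp
    then have "sgpd_mult S (p x) (q x) = x"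
      using Z(2) x2 by (auto simp: bisection_def inj_on_def)
    then show ?thesis
      unfolding arrow_set_mult_def using comp[OF x2(1)] pU(1)[OF x2(1)] qW(1)[OF x2(2)] by force
  qed
  moreover have "c \<in> D3"
  proof -
    have sc: "source S c = source S b" using source_comp[OF ab(4)] ab(1) by simp
    then have qc: "q c = b" using t(2) ab(3) by (simp add: q_def)
    have "source S a = range_of S b" using ab(4) by (simp add: composable_def)
    then have pc: "p c = a" using u(2) ab(2) by (metis p_def qc)
    have "c \<in> D1" using Z(3) sc ab(3) by (auto simp: D1_def)
    then have "c \<in> D2" using qc \<open>source S a = range_of S b\<close> ab(2) by (auto simp: D2_def) (metis imageI)
    then show ?thesis using pc qc Z(3) ab(1) by (simp add: D3_def)
  qed
  ultimately show "\<exists>T. openin (atop S) T \<and> c \<in> T \<and> T \<subseteq> arrow_set_mult S U W"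
    using D3 by blast
qed

text \<open>The range of \<open>ab\<close> determines \<open>a\<close>, hence the range of \<open>b\<close>, hence \<open>b\<close>. Starting from the source of
  \<open>ab\<close>, the argument runs in the opposite order.\<close>

lemma bisection_arrow_set_mult:
  assumes U: "bisection S U" and W: "bisection S W"
  shows "bisection S (arrow_set_mult S U W)"
proof -
  have "a = a' \<and> b = b'"
    if "a \<in> U" "a' \<in> U" "b \<in> W" "b' \<in> W" "(a, b) \<in> composable S" "(a', b') \<in> composable S"
      "range_of S a = range_of S a' \<or> source S b = source S b'" for a b a' b'
  proof -
    have "inj_on (range_of S) U" "inj_on (source S) U" "inj_on (range_of S) W" "inj_on (source S) W"
      using U W by (simp_all add: bisection_def)
    moreover have "source S a = range_of S b" "source S a' = range_of S b'"
      using that(5,6) by (simp_all add: composable_def)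
    ultimately show ?thesis using that(1-4,7) by (metis inj_onD)
  qed
  note uniq = this
  have eq: "x = y" if xy: "x \<in> arrow_set_mult S U W" "y \<in> arrow_set_mult S U W"
      "range_of S x = range_of S y \<or> source S x = source S y" for x y
  proof -
    obtain a b where ab: "x = sgpd_mult S a b" "a \<in> U" "b \<in> W" "(a, b) \<in> composable S"
      using xy(1) by (auto simp: arrow_set_mult_def)
    obtain a' b' where ab': "y = sgpd_mult S a' b'" "a' \<in> U" "b' \<in> W" "(a', b') \<in> composable S"
      using xy(2) by (auto simp: arrow_set_mult_def)
    show ?thesis
      using uniq[OF ab(2) ab'(2) ab(3) ab'(3) ab(4) ab'(4)] xy(3)
      by (simp add: ab(1) ab'(1) range_comp[OF ab(4)] range_comp[OF ab'(4)]
          source_comp[OF ab(4)] source_comp[OF ab'(4)])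
  qed
  have "arrow_set_mult S U W \<subseteq> arrows S" using comp_closed by (auto simp: arrow_set_mult_def)
  then show ?thesis using eq by (auto simp: bisection_def inj_on_def)
qed

text \<open>Composability is a closed condition because the vertices form a Hausdorff space, so that the
  composable pairs in a product of compact sets form a compact set.\<close>

lemma compact_arrow_set_mult:
  assumes K: "compactin (atop S) K" and L: "compactin (atop S) L"
  shows "compactin (atop S) (arrow_set_mult S K L)"
proof -
  have arr: "K \<subseteq> arrows S" "L \<subseteq> arrows S"
    using K L compactin_subset_topspace topspace_atop by blast+
  let ?P = "prod_topology (atop S) (atop S)"
  have 1: "continuous_map ?P (vtop S) (\<lambda>p. source S (fst p))"
    using continuous_map_compose[OF continuous_map_fst continuous_source] by (simp add: o_def)
  have 2: "continuous_map ?P (vtop S) (\<lambda>p. range_of S (snd p))"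
    using continuous_map_compose[OF continuous_map_snd continuous_range] by (simp add: o_def)
  have "composable S = {p \<in> topspace ?P. source S (fst p) = range_of S (snd p)}"
    by (auto simp: composable_def topspace_atop)
  then have "closedin ?P (composable S)"
    using closedin_continuous_maps_eq[OF Hausdorff_vtop 1 2] by simp
  moreover have "compactin ?P (K \<times> L)" using K L by (simp add: compactin_Times)
  ultimately have "compactin ?P (K \<times> L \<inter> composable S)" by (simp add: compact_Int_closedin)
  then have "compactin (subtopology ?P (composable S)) (K \<times> L \<inter> composable S)"
    by (simp add: compactin_subtopology)
  from image_compactin[OF this continuous_comp]
  have "compactin (atop S) ((\<lambda>(a, b). sgpd_mult S a b) ` (K \<times> L \<inter> composable S))" .
  moreover have "(\<lambda>(a, b). sgpd_mult S a b) ` (K \<times> L \<inter> composable S) = arrow_set_mult S K L"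
    by (force simp: arrow_set_mult_def image_iff)
  ultimately show ?thesis by simp
qed

end

context etale_bundle
begin

definition open_bisection :: "'g set \<Rightarrow> bool" where
  "open_bisection U \<longleftrightarrow> openin (atop \<Gamma>) U \<and> bisection \<Gamma> U"

lemma open_bisection_Hausdorff: "open_bisection U \<Longrightarrow> open_Hausdorff U"
  using E.Hausdorff_bisection by (auto simp: open_bisection_def open_Hausdorff_def)

text \<open>At an arrow of the product of the bisections, the convolution sum has a single summand, which
  belongs to the unique factorisation of the arrow.\<close>

lemma conv_Cc_bisections:
  assumes U: "open_bisection U" and W: "open_bisection W" and \<alpha>: "\<alpha> \<in> Cc U" and \<beta>: "\<beta> \<in> Cc W"
  shows "\<alpha> \<otimes>\<^bsub>Sec\<^esub> \<beta> \<in> Cc (arrow_set_mult \<Gamma> U W)" and "open_bisection (arrow_set_mult \<Gamma> U W)"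
proof -
  show UW: "open_bisection (arrow_set_mult \<Gamma> U W)"
    using U W E.open_arrow_set_mult E.bisection_arrow_set_mult by (auto simp: open_bisection_def)
  note HU = open_bisection_Hausdorff[OF U] and HW = open_bisection_Hausdorff[OF W]
  obtain K where K: "compactin (atop \<Gamma>) K" "K \<subseteq> U" "\<forall>\<gamma>\<in>arrows \<Gamma> - K. \<alpha> \<gamma> = fib_zero \<pi> \<gamma>"
    using \<alpha> unfolding Cc_iff[OF HU] by blast
  obtain L where L: "compactin (atop \<Gamma>) L" "L \<subseteq> W" "\<forall>\<gamma>\<in>arrows \<Gamma> - L. \<beta> \<gamma> = fib_zero \<pi> \<gamma>"
    using \<beta> unfolding Cc_iff[OF HW] by blast
  note sec = Cc_Sec[OF \<alpha>] Cc_Sec[OF \<beta>]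
  obtain p q where p: "continuous_map (subtopology (atop \<Gamma>) (arrow_set_mult \<Gamma> U W)) (subtopology (atop \<Gamma>) U) p"
    and q: "continuous_map (subtopology (atop \<Gamma>) (arrow_set_mult \<Gamma> U W)) (subtopology (atop \<Gamma>) W) q"
    and pq: "\<forall>a\<in>U. \<forall>b\<in>W. (a, b) \<in> composable \<Gamma> \<longrightarrow> p (sgpd_mult \<Gamma> a b) = a \<and> q (sgpd_mult \<Gamma> a b) = b"
    using E.factorisation U W unfolding open_bisection_def by metis
  have UWarr: "arrow_set_mult \<Gamma> U W \<subseteq> arrows \<Gamma>" using UW by (simp add: open_bisection_def bisection_def)
  have pairs: "conv_pairs \<Gamma> \<pi> \<alpha> \<beta> \<gamma> \<subseteq> (K \<times> L) \<inter> {(a, b) \<in> composable \<Gamma>. sgpd_mult \<Gamma> a b = \<gamma>}" for \<gamma>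
    using K(3) L(3) by (auto simp: conv_pairs_def composable_def)
  have value_in: "(\<alpha> \<otimes>\<^bsub>Sec\<^esub> \<beta>) \<gamma> = sgpd_mult \<Lambda> (\<alpha> (p \<gamma>)) (\<beta> (q \<gamma>))" if \<gamma>_in: "\<gamma> \<in> arrow_set_mult \<Gamma> U W" for \<gamma>
  proof -
    obtain a b where ab: "\<gamma> = sgpd_mult \<Gamma> a b" "a \<in> U" "b \<in> W" "(a, b) \<in> composable \<Gamma>"
      using \<gamma>_in by (auto simp: arrow_set_mult_def)
    have \<gamma>: "\<gamma> \<in> arrows \<Gamma>" using \<gamma>_in UWarr by blast
    interpret G: abelian_group "fibre \<Lambda> \<pi> \<gamma>" by (rule fib_abelian[OF \<gamma>])
    have P: "{(a, b)} \<subseteq> {(a, b) \<in> composable \<Gamma>. sgpd_mult \<Gamma> a b = \<gamma>}" using ab by auto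
    have "conv_pairs \<Gamma> \<pi> \<alpha> \<beta> \<gamma> \<subseteq> {(a, b)}"
    proof
      fix z assume z: "z \<in> conv_pairs \<Gamma> \<pi> \<alpha> \<beta> \<gamma>"
      obtain a' b' where z': "z = (a', b')" by (cases z)
      then have "a' \<in> U" "b' \<in> W" "(a', b') \<in> composable \<Gamma>" "sgpd_mult \<Gamma> a' b' = \<gamma>"
        using z pairs K(2) L(2) by blast+
      then show "z \<in> {(a, b)}" using pq ab z' by (metis singletonI)
    qed
    from conv_eq[OF \<gamma> sec _ P this]
    have "(\<alpha> \<otimes>\<^bsub>Sec\<^esub> \<beta>) \<gamma> = finsum (fibre \<Lambda> \<pi> \<gamma>) (\<lambda>(a, b). sgpd_mult \<Lambda> (\<alpha> a) (\<beta> b)) {(a, b)}" by simp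
    also have "\<dots> = sgpd_mult \<Lambda> (\<alpha> a) (\<beta> b)"
      using conv_summand_closed[OF sec P] G.r_zero[of "sgpd_mult \<Lambda> (\<alpha> a) (\<beta> b)"]
      by (subst G.finsum_insert) auto
    finally show ?thesis using pq ab by auto
  qed
  have K': "arrow_set_mult \<Gamma> K L \<subseteq> arrow_set_mult \<Gamma> U W" using K(2) L(2) unfolding arrow_set_mult_def by blast
  show "\<alpha> \<otimes>\<^bsub>Sec\<^esub> \<beta> \<in> Cc (arrow_set_mult \<Gamma> U W)"
    unfolding Cc_iff[OF open_bisection_Hausdorff[OF UW]]
  proof (intro conjI exI[of _ "arrow_set_mult \<Gamma> K L"] ballI E.compact_arrow_set_mult K(1) L(1) K' conv_closed sec)
    have c\<alpha>: "continuous_map (subtopology (atop \<Gamma>) (arrow_set_mult \<Gamma> U W)) (atop \<Lambda>) (\<lambda>\<gamma>. \<alpha> (p \<gamma>))"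
      using continuous_map_compose[OF p Cc_cont[OF \<alpha>]] by (simp add: o_def)
    have c\<beta>: "continuous_map (subtopology (atop \<Gamma>) (arrow_set_mult \<Gamma> U W)) (atop \<Lambda>) (\<lambda>\<gamma>. \<beta> (q \<gamma>))"
      using continuous_map_compose[OF q Cc_cont[OF \<beta>]] by (simp add: o_def)
    have "(\<alpha> (p \<gamma>), \<beta> (q \<gamma>)) \<in> composable \<Lambda>" if \<gamma>_in: "\<gamma> \<in> arrow_set_mult \<Gamma> U W" for \<gamma>
    proof -
      obtain a b where ab: "\<gamma> = sgpd_mult \<Gamma> a b" "a \<in> U" "b \<in> W" "(a, b) \<in> composable \<Gamma>"
        using \<gamma>_in by (auto simp: arrow_set_mult_def)
      then have "p \<gamma> = a" "q \<gamma> = b" "a \<in> arrows \<Gamma>" "b \<in> arrows \<Gamma>" using pq by (auto simp: composable_def)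
      then show ?thesis using comp_fibres(1)[OF ab(4)] sec by (auto simp: PiE_iff)
    qed
    then have "continuous_map (subtopology (atop \<Gamma>) (arrow_set_mult \<Gamma> U W)) (atop \<Lambda>)
        (\<lambda>\<gamma>. sgpd_mult \<Lambda> (\<alpha> (p \<gamma>)) (\<beta> (q \<gamma>)))"
      by (intro continuous_map_compose2[OF \<Lambda>.continuous_comp c\<alpha> c\<beta>]) auto
    then show "continuous_map (subtopology (atop \<Gamma>) (arrow_set_mult \<Gamma> U W)) (atop \<Lambda>) (\<alpha> \<otimes>\<^bsub>Sec\<^esub> \<beta>)"
      by (rule continuous_map_eq) (use value_in in auto)
    show "(\<alpha> \<otimes>\<^bsub>Sec\<^esub> \<beta>) \<gamma> = fib_zero \<pi> \<gamma>" if \<gamma>: "\<gamma> \<in> arrows \<Gamma> - arrow_set_mult \<Gamma> K L" for \<gamma>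
    proof -
      interpret G: abelian_group "fibre \<Lambda> \<pi> \<gamma>" using \<gamma> by (intro fib_abelian) auto
      have "conv_pairs \<Gamma> \<pi> \<alpha> \<beta> \<gamma> \<subseteq> {}" using pairs[of \<gamma>] \<gamma> by (auto simp: arrow_set_mult_def)
      from conv_eq[OF _ sec _ _ this] show ?thesis using \<gamma> by simp
    qed
  qed
qed

end

locale normal_bundle = etale_bundle R RT \<Lambda> \<Gamma> \<pi>
  for R :: "'r ring" and RT :: "'r topology"
    and \<Lambda> :: "('p, 'l) top_sgpd" and \<Gamma> :: "('o, 'g) top_sgpd" and \<pi> :: "('r, 'g, 'l) rbundle" +
  assumes normal: "locally_R_normal R RT (atop \<Gamma>)"
begin

text \<open>A partition of unity, applied one bump function at a time: if \<open>f\<close> is a bump function,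
  then \<open>\<alpha>\<close> is the sum of \<open>\<alpha> f\<close> and \<open>\<alpha> (1 - f)\<close>, the first being supported in a bisection
  and the second one vanishing where \<open>f\<close> is one.\<close>

lemma Cc_bisection_span:
  assumes V: "open_Hausdorff V" and \<alpha>: "\<alpha> \<in> Cc V"
  shows "\<alpha> \<in> add_span Sec (\<Union>U\<in>{U. open_bisection U}. Cc U)"
proof -
  let ?B = "\<Union>U\<in>{U. open_bisection U}. Cc U"
  interpret S: bimodule R Sec by (rule bimodule_sections)
  have Varr: "V \<subseteq> arrows \<Gamma>" by (rule open_Hausdorff_arrows[OF V])
  define small where "small C \<longleftrightarrow> (\<exists>f K U. continuous_map (subtopology (atop \<Gamma>) V) RT f \<and>
     (\<forall>y\<in>C. f y = \<one>\<^bsub>R\<^esub>) \<and> compactin (atop \<Gamma>) K \<and> K \<subseteq> U \<and> U \<subseteq> V \<and> open_bisection U \<and>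
     (\<forall>y\<in>V - K. f y = \<zero>\<^bsub>R\<^esub>))" for C
  have span: "\<beta> \<in> add_span Sec ?B"
    if "finite \<F>" "\<And>C. C \<in> \<F> \<Longrightarrow> small C" "\<beta> \<in> Cc V" "{\<gamma> \<in> arrows \<Gamma>. \<beta> \<gamma> \<noteq> fib_zero \<pi> \<gamma>} \<subseteq> \<Union>\<F>" for \<F> \<beta>
    using that
  proof (induction \<F> arbitrary: \<beta> rule: finite_induct)
    case empty
    have "\<beta> = \<zero>\<^bsub>Sec\<^esub>"
      by (rule Sec_eqI[OF Cc_Sec[OF empty(2)] S.M.zero_closed]) (use empty in auto)
    then show ?case by (simp add: add_span.zero del: sections_simps)
  next
    case (insert C \<F>)
    obtain f K U where f: "continuous_map (subtopology (atop \<Gamma>) V) RT f" "\<forall>y\<in>C. f y = \<one>\<^bsub>R\<^esub>"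
      "compactin (atop \<Gamma>) K" "K \<subseteq> U" "U \<subseteq> V" "open_bisection U" "\<forall>y\<in>V - K. f y = \<zero>\<^bsub>R\<^esub>"
      using insert.prems(1)[of C] unfolding small_def by auto
    obtain L where L: "compactin (atop \<Gamma>) L" "L \<subseteq> V" "\<forall>\<gamma>\<in>arrows \<Gamma> - L. \<beta> \<gamma> = fib_zero \<pi> \<gamma>"
      using insert.prems(2) unfolding Cc_iff[OF V] by blast
    have fR: "f \<gamma> \<in> carrier R" if "\<gamma> \<in> V" for \<gamma>
      using continuous_map_image_subset_topspace[OF f(1)] that Varr
      by (auto simp: R.topspace_RT \<Gamma>.topspace_atop)
    let ?g = "\<lambda>\<gamma>. \<one>\<^bsub>R\<^esub> \<oplus>\<^bsub>R\<^esub> \<ominus>\<^bsub>R\<^esub> f \<gamma>"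
    have one: "continuous_map (subtopology (atop \<Gamma>) V) RT (\<lambda>_. \<one>\<^bsub>R\<^esub>)" by (simp add: R.topspace_RT)
    have neg: "continuous_map (subtopology (atop \<Gamma>) V) RT (\<lambda>\<gamma>. \<ominus>\<^bsub>R\<^esub> f \<gamma>)"
      using continuous_map_compose[OF f(1) R.continuous_neg] by (simp add: o_def)
    have g: "continuous_map (subtopology (atop \<Gamma>) V) RT ?g"
      by (rule continuous_map_compose2'[OF R.continuous_add one neg])
    let ?times = "\<lambda>h. \<lambda>\<gamma>\<in>arrows \<Gamma>. if \<gamma> \<in> V then fib_rscal \<pi> (\<beta> \<gamma>) (h \<gamma>) else fib_zero \<pi> \<gamma>"
    have 1: "?times f \<in> Cc U"
      by (rule Cc_times[OF V insert.prems(2) f(1) _ f(5,3,4)])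
        (use f in \<open>auto simp: open_bisection_def\<close>)
    have 2: "?times ?g \<in> Cc V"
      by (rule Cc_times[OF V insert.prems(2) g _ subset_refl L(1,2)])
        (use V L Varr in \<open>auto simp: open_Hausdorff_def\<close>)
    have \<beta>\<Lambda>: "\<beta> \<gamma> \<in> arrows \<Lambda>" "proj \<pi> (\<beta> \<gamma>) = \<gamma>" if "\<gamma> \<in> arrows \<Gamma>" for \<gamma>
      using Cc_Sec[OF insert.prems(2)] that by (auto simp: PiE_iff)
    have "{\<gamma> \<in> arrows \<Gamma>. ?times ?g \<gamma> \<noteq> fib_zero \<pi> \<gamma>} \<subseteq> \<Union>\<F>"
    proof clarify
      fix \<gamma> assume \<gamma>: "\<gamma> \<in> arrows \<Gamma>" "?times ?g \<gamma> \<noteq> fib_zero \<pi> \<gamma>"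
      then have "\<gamma> \<in> V" by (auto split: if_splits)
      have "\<gamma> \<notin> C"
      proof
        assume "\<gamma> \<in> C"
        then have "fib_rscal \<pi> (\<beta> \<gamma>) (\<one>\<^bsub>R\<^esub> \<oplus>\<^bsub>R\<^esub> \<ominus>\<^bsub>R\<^esub> f \<gamma>) = fib_zero \<pi> \<gamma>"
          using \<gamma>(1) f(2) \<beta>\<Lambda> by (simp add: R.r_neg fib_rules)
        then show False using \<gamma> by (simp split: if_splits)
      qed
      moreover have "\<beta> \<gamma> \<noteq> fib_zero \<pi> \<gamma>" using \<gamma> fR[of \<gamma>] by (auto simp: fib_rules split: if_splits)
      ultimately show "\<gamma> \<in> \<Union>\<F>" using insert.prems(3) \<gamma>(1) by auto
    qed
    then have span2: "?times ?g \<in> add_span Sec ?B"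
      using insert.IH[OF _ 2] insert.prems(1) by blast
    have span1: "?times f \<in> add_span Sec ?B" using 1 f(6) by (blast intro: add_span.incl)
    have sum: "\<beta> = ?times f \<oplus>\<^bsub>Sec\<^esub> ?times ?g"
    proof (rule Sec_eqI[OF Cc_Sec[OF insert.prems(2)] S.M.a_closed[OF Cc_Sec[OF 1] Cc_Sec[OF 2]]])
      fix \<gamma> assume \<gamma>: "\<gamma> \<in> arrows \<Gamma>"
      show "\<beta> \<gamma> = (?times f \<oplus>\<^bsub>Sec\<^esub> ?times ?g) \<gamma>"
      proof (cases "\<gamma> \<in> V")
        case True
        have "f \<gamma> \<oplus>\<^bsub>R\<^esub> (\<one>\<^bsub>R\<^esub> \<oplus>\<^bsub>R\<^esub> \<ominus>\<^bsub>R\<^esub> f \<gamma>) = \<one>\<^bsub>R\<^esub>"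
          using fR[OF True] by (simp add: R.add.m_lcomm R.r_neg)
        then have "fib_add \<pi> (fib_rscal \<pi> (\<beta> \<gamma>) (f \<gamma>)) (fib_rscal \<pi> (\<beta> \<gamma>) (?g \<gamma>)) = \<beta> \<gamma>"
          using fib_rules(11)[OF \<gamma>, of "f \<gamma>" "?g \<gamma>" "\<beta> \<gamma>"] fib_rules(13)[OF \<gamma>, of "\<beta> \<gamma>"] \<beta>\<Lambda>[OF \<gamma>] fR[OF True]
          by auto
        then show ?thesis using True \<gamma> by simp
      next
        case False
        then show ?thesis using \<gamma> L by (auto simp: fib_rules)
      qed
    qed
    show ?case by (subst sum) (rule add_span.add[OF span1 span2])
  qed
  obtain K where K: "compactin (atop \<Gamma>) K" "K \<subseteq> V" "\<forall>\<gamma>\<in>arrows \<Gamma> - K. \<alpha> \<gamma> = fib_zero \<pi> \<gamma>"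
    using \<alpha> unfolding Cc_iff[OF V] by blast
  have "\<forall>x\<in>K. \<exists>C. openin (atop \<Gamma>) C \<and> x \<in> C \<and> small C"
  proof
    fix x assume "x \<in> K"
    have V': "openin (atop \<Gamma>) V" "Hausdorff_space (subtopology (atop \<Gamma>) V)" using V by (auto simp: open_Hausdorff_def)
    have "x \<in> V" using \<open>x \<in> K\<close> K(2) by blast
    then obtain U where U: "openin (atop \<Gamma>) U" "bisection \<Gamma> U" "x \<in> U" "U \<subseteq> V"
      by (rule E.open_bisection_nbhd[OF V'(1)])
    obtain f C L where f: "continuous_map (subtopology (atop \<Gamma>) V) RT f"
      "openin (atop \<Gamma>) C" "x \<in> C" "\<forall>y\<in>C. f y = \<one>\<^bsub>R\<^esub>"
      "compactin (atop \<Gamma>) L" "L \<subseteq> U" "\<forall>y\<in>V - L. f y = \<zero>\<^bsub>R\<^esub>"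
      by (rule E.bump_function[OF R.topological_ring_axioms normal V' U(1,3,4)])
    then have "small C" using U(1,2,4) unfolding small_def open_bisection_def by blast
    then show "\<exists>C. openin (atop \<Gamma>) C \<and> x \<in> C \<and> small C" using f(2,3) by blast
  qed
  then obtain \<F> where \<F>: "finite \<F>" "\<forall>C\<in>\<F>. openin (atop \<Gamma>) C \<and> small C" "K \<subseteq> \<Union>\<F>"
    by (rule compactin_finite_subcover[OF K(1)])
  show ?thesis by (rule span[OF \<F>(1)]) (use \<F> K \<alpha> in auto)
qed

lemma Alg_bisection_span:
  assumes "\<alpha> \<in> carrier Alg"
  shows "\<alpha> \<in> add_span Sec (\<Union>U\<in>{U. open_bisection U}. Cc U)"
  using assms
proof (induction rule: Alg_induct)
  case zero
  then show ?case by (rule add_span.zero)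
next
  case (Cc \<alpha> V)
  then show ?case by (rule Cc_bisection_span)
next
  case (add \<alpha> \<beta>)
  then show ?case by (blast intro: add_span.add)
qed

text \<open>By biadditivity of convolution it suffices to multiply sections supported in bisections.\<close>

lemma conv_Alg:
  assumes "\<alpha> \<in> carrier Alg" "\<beta> \<in> carrier Alg"
  shows "\<alpha> \<otimes>\<^bsub>Sec\<^esub> \<beta> \<in> carrier Alg"
proof -
  let ?B = "\<Union>U\<in>{U. open_bisection U}. Cc U"
  interpret A: bimodule R Alg by (rule bimodule_Alg)
  note closed = A.M.zero_closed A.M.a_closed
  have B: "\<alpha> \<in> carrier Alg" if "\<alpha> \<in> add_span Sec ?B" for \<alpha>
    using that
  proof induction
    case zero
    then show ?case using A.M.zero_closed by (simp del: sections_simps Alg_simps(1))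
  next
    case (incl x)
    then show ?case using Cc_Alg open_bisection_Hausdorff by blast
  next
    case (add x y)
    then show ?case using A.M.a_closed[of x y] by (simp del: sections_simps Alg_simps(1))
  qed
  have 1: "\<alpha> \<otimes>\<^bsub>Sec\<^esub> \<beta> \<in> carrier Alg" if "\<alpha> \<in> Cc U" "open_bisection U" "\<beta> \<in> add_span Sec ?B" for \<alpha> \<beta> U
    using that(3)
  proof induction
    case zero
    then show ?case using A.M.zero_closed conv_zero(2)[OF Cc_Sec[OF that(1)]]
      by (simp del: sections_simps Alg_simps(1))
  next
    case (incl x)
    then show ?case
      using conv_Cc_bisections[OF that(2) _ that(1)] Cc_Alg open_bisection_Hausdorff by blast
  next
    case (add x y)
    note xy = B[OF add(1)] B[OF add(2)] Cc_Alg[OF open_bisection_Hausdorff[OF that(2)] that(1)]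
    have "\<alpha> \<otimes>\<^bsub>Sec\<^esub> (x \<oplus>\<^bsub>Sec\<^esub> y) = \<alpha> \<otimes>\<^bsub>Sec\<^esub> x \<oplus>\<^bsub>Sec\<^esub> \<alpha> \<otimes>\<^bsub>Sec\<^esub> y"
      by (intro conv_add_right Alg_Sec fibre_finite_Alg xy)
    then show ?case using add A.M.a_closed[of "\<alpha> \<otimes>\<^bsub>Sec\<^esub> x" "\<alpha> \<otimes>\<^bsub>Sec\<^esub> y"]
      by (simp del: sections_simps Alg_simps(1))
  qed
  have \<beta>: "\<beta> \<in> add_span Sec ?B" by (rule Alg_bisection_span[OF assms(2)])
  show ?thesis
    using Alg_bisection_span[OF assms(1)]
  proof induction
    case zero
    then show ?case using A.M.zero_closed conv_zero(1)[OF Alg_Sec[OF assms(2)]]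
      by (simp del: sections_simps Alg_simps(1))
  next
    case (incl x)
    then show ?case using 1[OF _ _ \<beta>] by blast
  next
    case (add x y)
    note xy = B[OF add(1)] B[OF add(2)] assms(2)
    have "(x \<oplus>\<^bsub>Sec\<^esub> y) \<otimes>\<^bsub>Sec\<^esub> \<beta> = x \<otimes>\<^bsub>Sec\<^esub> \<beta> \<oplus>\<^bsub>Sec\<^esub> y \<otimes>\<^bsub>Sec\<^esub> \<beta>"
      by (intro conv_add_left Alg_Sec fibre_finite_Alg xy)
    then show ?case using add A.M.a_closed[of "x \<otimes>\<^bsub>Sec\<^esub> \<beta>" "y \<otimes>\<^bsub>Sec\<^esub> \<beta>"]
      by (simp del: sections_simps Alg_simps(1))
  qed
qed

end

section \<open>Continuity of the trivial bundle and of the product bundle\<close>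

lemma continuous_map_fstI: "continuous_map Z (prod_topology X Y) f \<Longrightarrow> continuous_map Z X (\<lambda>z. fst (f z))"
  using continuous_map_compose[OF _ continuous_map_fst] by (fastforce simp: o_def)

lemma continuous_map_sndI: "continuous_map Z (prod_topology X Y) f \<Longrightarrow> continuous_map Z Y (\<lambda>z. snd (f z))"
  using continuous_map_compose[OF _ continuous_map_snd] by (fastforce simp: o_def)

lemma continuous_map_sub_id: "continuous_map (subtopology X S) X (\<lambda>x. x)"
  by (simp add: continuous_map_from_subtopology)

lemma continuous_map_idI: "continuous_map X X (\<lambda>x. x)"
  using continuous_map_id by (simp add: id_def)

lemma continuous_map_compose1: "continuous_map X Y g \<Longrightarrow> continuous_map Z X f \<Longrightarrow> continuous_map Z Y (\<lambda>z. g (f z))"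
  using continuous_map_compose[of Z X f Y g] by (simp add: o_def)

lemmas continuous_pair_intros = continuous_map_pairedI continuous_map_fstI continuous_map_sndI

lemma topological_semigroupoid_prod:
  assumes "topological_semigroupoid S" "topological_semigroupoid T"
  shows "topological_semigroupoid (prod_sgpd S T)"
proof -
  interpret S: topological_semigroupoid S by fact
  interpret T: topological_semigroupoid T by fact
  show ?thesis
  proof (intro topological_semigroupoid.intro topological_semigroupoid_axioms.intro
      semigroupoid_prod S.semigroupoid_axioms T.semigroupoid_axioms)
    show "continuous_map (atop (prod_sgpd S T)) (vtop (prod_sgpd S T)) (source (prod_sgpd S T))"
      unfolding prod_sgpd_def case_prod_unfold sgpd.simps top_sgpd.simps
      by (intro continuous_pair_intros continuous_map_compose1[OF S.continuous_source]
          continuous_map_compose1[OF T.continuous_source];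
          (rule continuous_map_sub_id continuous_map_idI)?)
    show "continuous_map (atop (prod_sgpd S T)) (vtop (prod_sgpd S T)) (range_of (prod_sgpd S T))"
      unfolding prod_sgpd_def case_prod_unfold sgpd.simps top_sgpd.simps
      by (intro continuous_pair_intros continuous_map_compose1[OF S.continuous_range]
          continuous_map_compose1[OF T.continuous_range];
          (rule continuous_map_sub_id continuous_map_idI)?)
    have *: "(\<lambda>(a, b). sgpd_mult (prod_sgpd S T) a b) =
        (\<lambda>p. (sgpd_mult S (fst (fst p)) (fst (snd p)), sgpd_mult T (snd (fst p)) (snd (snd p))))"
      by (simp add: prod_sgpd_def case_prod_unfold)
    show "continuous_map (subtopology (prod_topology (atop (prod_sgpd S T)) (atop (prod_sgpd S T)))
        (composable (prod_sgpd S T))) (atop (prod_sgpd S T)) (\<lambda>(a, b). sgpd_mult (prod_sgpd S T) a b)"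
      unfolding * prod_sgpd_simps
      by (intro continuous_pair_intros continuous_map_compose2[OF S.continuous_comp]
          continuous_map_compose2[OF T.continuous_comp];
          (rule continuous_map_sub_id continuous_map_idI)?) (auto simp: composable_prod)
  qed (simp_all add: S.topspace_vtop T.topspace_vtop S.topspace_atop T.topspace_atop)
qed

lemma continuous_bundle_prod:
  assumes "continuous_bundle R RT \<Lambda> \<Gamma> \<pi>" "topological_semigroupoid \<E>"
  shows "continuous_bundle R RT (prod_sgpd \<Lambda> \<E>) (prod_sgpd \<Gamma> \<E>) (prod_bundle \<pi>)"
proof -
  interpret continuous_bundle R RT \<Lambda> \<Gamma> \<pi> by fact
  interpret \<E>: topological_semigroupoid \<E> by fact
  show ?thesis
  proof (intro continuous_bundle.intro continuous_bundle_axioms.intro topological_semigroupoid_prod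
      R_bundle_prod R_bundle_axioms R.topological_ring_axioms \<Lambda>.topological_semigroupoid_axioms
      \<Gamma>.topological_semigroupoid_axioms \<E>.topological_semigroupoid_axioms \<E>.semigroupoid_axioms)
    show "continuous_map (atop (prod_sgpd \<Lambda> \<E>)) (atop (prod_sgpd \<Gamma> \<E>)) (proj (prod_bundle \<pi>))"
      unfolding prod_bundle_def case_prod_unfold rbundle.simps prod_sgpd_simps
      by (intro continuous_pair_intros continuous_map_compose1[OF continuous_proj];
          (rule continuous_map_sub_id continuous_map_idI)?)
    have *: "(\<lambda>(x, y). fib_add (prod_bundle \<pi>) x y) =
        (\<lambda>p. (fib_add \<pi> (fst (fst p)) (fst (snd p)), snd (fst p)))"
      by (simp add: prod_bundle_def case_prod_unfold)
    show "continuous_map (subtopology (prod_topology (atop (prod_sgpd \<Lambda> \<E>)) (atop (prod_sgpd \<Lambda> \<E>)))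
        {(x, y). proj (prod_bundle \<pi>) x = proj (prod_bundle \<pi>) y}) (atop (prod_sgpd \<Lambda> \<E>))
        (\<lambda>(x, y). fib_add (prod_bundle \<pi>) x y)"
      unfolding * prod_sgpd_simps
      by (intro continuous_pair_intros continuous_map_compose2[OF continuous_fib_add];
          (rule continuous_map_sub_id continuous_map_idI)?) auto
    have *: "(\<lambda>(r, x). fib_lscal (prod_bundle \<pi>) r x) =
        (\<lambda>p. (fib_lscal \<pi> (fst p) (fst (snd p)), snd (snd p)))"
      by (simp add: prod_bundle_def case_prod_unfold)
    show "continuous_map (prod_topology RT (atop (prod_sgpd \<Lambda> \<E>))) (atop (prod_sgpd \<Lambda> \<E>))
        (\<lambda>(r, x). fib_lscal (prod_bundle \<pi>) r x)"
      unfolding * prod_sgpd_simps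
      by (intro continuous_pair_intros continuous_map_compose2'[OF continuous_fib_lscal];
          (rule continuous_map_sub_id continuous_map_idI)?)
    have *: "(\<lambda>(x, r). fib_rscal (prod_bundle \<pi>) x r) =
        (\<lambda>p. (fib_rscal \<pi> (fst (fst p)) (snd p), snd (fst p)))"
      by (simp add: prod_bundle_def case_prod_unfold)
    show "continuous_map (prod_topology (atop (prod_sgpd \<Lambda> \<E>)) RT) (atop (prod_sgpd \<Lambda> \<E>))
        (\<lambda>(x, r). fib_rscal (prod_bundle \<pi>) x r)"
      unfolding * prod_sgpd_simps
      by (intro continuous_pair_intros continuous_map_compose2'[OF continuous_fib_rscal];
          (rule continuous_map_sub_id continuous_map_idI)?)
    show "continuous_map (atop (prod_sgpd \<Gamma> \<E>)) (atop (prod_sgpd \<Lambda> \<E>)) (fib_zero (prod_bundle \<pi>))"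
      unfolding prod_bundle_def case_prod_unfold rbundle.simps prod_sgpd_simps
      by (intro continuous_pair_intros continuous_map_compose1[OF continuous_fib_zero];
          (rule continuous_map_sub_id continuous_map_idI)?)
  qed
qed

lemma continuous_bundle_triv:
  assumes "topological_ring R RT" "topological_semigroupoid \<E>"
  shows "continuous_bundle R RT (triv_sgpd R RT \<E>) \<E> (triv_bundle R)"
proof -
  interpret R: topological_ring R RT by fact
  interpret \<E>: topological_semigroupoid \<E> by fact
  interpret T: R_bundle R "triv_sgpd R RT \<E>" \<E> "triv_bundle R"
    by (rule R_bundle_triv[OF R.ring_axioms \<E>.semigroupoid_axioms])
  have "topological_semigroupoid (triv_sgpd R RT \<E>)"
  proof (intro topological_semigroupoid.intro topological_semigroupoid_axioms.intro T.\<Lambda>.semigroupoid_axioms)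
    show "continuous_map (atop (triv_sgpd R RT \<E>)) (vtop (triv_sgpd R RT \<E>)) (source (triv_sgpd R RT \<E>))"
      unfolding triv_sgpd_def case_prod_unfold sgpd.simps top_sgpd.simps
      by (intro continuous_pair_intros continuous_map_compose1[OF \<E>.continuous_source];
          (rule continuous_map_sub_id continuous_map_idI)?)
    show "continuous_map (atop (triv_sgpd R RT \<E>)) (vtop (triv_sgpd R RT \<E>)) (range_of (triv_sgpd R RT \<E>))"
      unfolding triv_sgpd_def case_prod_unfold sgpd.simps top_sgpd.simps
      by (intro continuous_pair_intros continuous_map_compose1[OF \<E>.continuous_range];
          (rule continuous_map_sub_id continuous_map_idI)?)
    have *: "(\<lambda>(a, b). sgpd_mult (triv_sgpd R RT \<E>) a b) =
        (\<lambda>p. (fst (fst p) \<otimes>\<^bsub>R\<^esub> fst (snd p), sgpd_mult \<E> (snd (fst p)) (snd (snd p))))"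
      by (simp add: triv_sgpd_def case_prod_unfold)
    show "continuous_map (subtopology (prod_topology (atop (triv_sgpd R RT \<E>)) (atop (triv_sgpd R RT \<E>)))
        (composable (triv_sgpd R RT \<E>))) (atop (triv_sgpd R RT \<E>))
        (\<lambda>(a, b). sgpd_mult (triv_sgpd R RT \<E>) a b)"
      unfolding * triv_sgpd_simps
      by (intro continuous_pair_intros continuous_map_compose2'[OF R.continuous_mult]
          continuous_map_compose2[OF \<E>.continuous_comp];
          (rule continuous_map_sub_id continuous_map_idI)?) (auto simp: composable_triv)
  qed (simp_all add: R.topspace_RT \<E>.topspace_vtop \<E>.topspace_atop)
  then show ?thesis
  proof (intro continuous_bundle.intro continuous_bundle_axioms.intro T.R_bundle_axioms
      R.topological_ring_axioms \<E>.topological_semigroupoid_axioms)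
    show "continuous_map (atop (triv_sgpd R RT \<E>)) (atop \<E>) (proj (triv_bundle R))"
      unfolding triv_bundle_def rbundle.simps triv_sgpd_simps by (rule continuous_map_snd)
    have *: "(\<lambda>(x, y). fib_add (triv_bundle R) x y) = (\<lambda>p. (fst (fst p) \<oplus>\<^bsub>R\<^esub> fst (snd p), snd (fst p)))"
      by (simp add: triv_bundle_def case_prod_unfold)
    show "continuous_map (subtopology (prod_topology (atop (triv_sgpd R RT \<E>)) (atop (triv_sgpd R RT \<E>)))
        {(x, y). proj (triv_bundle R) x = proj (triv_bundle R) y}) (atop (triv_sgpd R RT \<E>))
        (\<lambda>(x, y). fib_add (triv_bundle R) x y)"
      unfolding * triv_sgpd_simps
      by (intro continuous_pair_intros continuous_map_compose2'[OF R.continuous_add];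
          (rule continuous_map_sub_id continuous_map_idI)?)
    have *: "(\<lambda>(r, x). fib_lscal (triv_bundle R) r x) = (\<lambda>p. (fst p \<otimes>\<^bsub>R\<^esub> fst (snd p), snd (snd p)))"
      by (simp add: triv_bundle_def case_prod_unfold)
    show "continuous_map (prod_topology RT (atop (triv_sgpd R RT \<E>))) (atop (triv_sgpd R RT \<E>))
        (\<lambda>(r, x). fib_lscal (triv_bundle R) r x)"
      unfolding * triv_sgpd_simps
      by (intro continuous_pair_intros continuous_map_compose2'[OF R.continuous_mult];
          (rule continuous_map_sub_id continuous_map_idI)?)
    have *: "(\<lambda>(x, r). fib_rscal (triv_bundle R) x r) = (\<lambda>p. (fst (fst p) \<otimes>\<^bsub>R\<^esub> snd p, snd (fst p)))"
      by (simp add: triv_bundle_def case_prod_unfold)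
    show "continuous_map (prod_topology (atop (triv_sgpd R RT \<E>)) RT) (atop (triv_sgpd R RT \<E>))
        (\<lambda>(x, r). fib_rscal (triv_bundle R) x r)"
      unfolding * triv_sgpd_simps
      by (intro continuous_pair_intros continuous_map_compose2'[OF R.continuous_mult];
          (rule continuous_map_sub_id continuous_map_idI)?)
    show "continuous_map (atop \<E>) (atop (triv_sgpd R RT \<E>)) (fib_zero (triv_bundle R))"
      unfolding triv_bundle_def rbundle.simps triv_sgpd_simps
      by (intro continuous_pair_intros;
          (rule continuous_map_sub_id continuous_map_idI)?) (simp add: R.topspace_RT)
  qed
qed

section \<open>The algebra of functions\<close>

locale function_algebra = R: topological_ring R RT + E: etale_semigroupoid \<E>
  for R :: "'r ring" and RT :: "'r topology" and \<E> :: "('q, 'e) top_sgpd" +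
  assumes normal_functions: "locally_R_normal R RT (atop \<E>)"
begin

sublocale Tr: normal_bundle R RT "triv_sgpd R RT \<E>" \<E> "triv_bundle R"
  by (intro normal_bundle.intro normal_bundle_axioms.intro etale_bundle.intro normal_functions
      continuous_bundle_triv R.topological_ring_axioms E.topological_semigroupoid_axioms
      E.etale_semigroupoid_axioms)

abbreviation "Fun \<equiv> R_functions R \<E>"
abbreviation "CcF \<equiv> Cc_functions R RT \<E>"
abbreviation "FAlg \<equiv> semigroupoid_algebra R RT \<E>"
abbreviation "graph \<equiv> graph_section \<E>"

lemma CcF_iff_graph:
  assumes W: "Tr.open_Hausdorff W" and f: "f \<in> carrier Fun"
  shows "f \<in> CcF W \<longleftrightarrow> graph f \<in> Tr.Cc W"
proof -
  have Warr: "W \<subseteq> arrows \<E>" by (rule Tr.open_Hausdorff_arrows[OF W])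
  have cont: "continuous_map (subtopology (atop \<E>) W) RT f \<longleftrightarrow>
      continuous_map (subtopology (atop \<E>) W) (atop (triv_sgpd R RT \<E>)) (graph f)"
  proof
    assume "continuous_map (subtopology (atop \<E>) W) RT f"
    then have "continuous_map (subtopology (atop \<E>) W) (prod_topology RT (atop \<E>)) (\<lambda>e. (f e, e))"
      by (intro continuous_map_pairedI continuous_map_sub_id)
    then show "continuous_map (subtopology (atop \<E>) W) (atop (triv_sgpd R RT \<E>)) (graph f)"
      unfolding triv_sgpd_simps by (rule continuous_map_eq) (use Warr in auto)
  next
    assume "continuous_map (subtopology (atop \<E>) W) (atop (triv_sgpd R RT \<E>)) (graph f)"
    then have "continuous_map (subtopology (atop \<E>) W) RT (\<lambda>e. fst (graph f e))"
      unfolding triv_sgpd_simps by (rule continuous_map_fstI)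
    then show "continuous_map (subtopology (atop \<E>) W) RT f"
      by (rule continuous_map_eq) (use Warr in auto)
  qed
  let ?N = "{e \<in> arrows \<E>. f e \<noteq> \<zero>\<^bsub>R\<^esub>}"
  have N: "{e \<in> arrows \<E>. graph f e \<noteq> fib_zero (triv_bundle R) e} = ?N" by auto
  have zero: "(\<forall>e\<in>arrows \<E> - W. f e = \<zero>\<^bsub>R\<^esub>) \<longleftrightarrow> (\<forall>e\<in>arrows \<E> - W. graph f e = fib_zero (triv_bundle R) e)"
    by auto
  have supp: "compactin (subtopology (atop \<E>) W) (subtopology (atop \<E>) W closure_of {e \<in> W. f e \<noteq> \<zero>\<^bsub>R\<^esub>}) \<longleftrightarrow>
      compactin (atop \<E>) (section_supp \<E> (triv_bundle R) (graph f) \<inter> W)"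
    if "\<forall>e\<in>arrows \<E> - W. f e = \<zero>\<^bsub>R\<^esub>"
  proof -
    have "{e \<in> W. f e \<noteq> \<zero>\<^bsub>R\<^esub>} = ?N" "?N \<subseteq> W" using that Warr by auto
    then show ?thesis
      unfolding section_supp_def N by (simp add: closure_in_open_subspace compactin_subtopology)
  qed
  show ?thesis
    unfolding Cc_functions_def Cc_sections_def
    using cont zero supp f graph_section_closed[OF f, of RT] by blast
qed

definition gensF :: "('e \<Rightarrow> 'r) set" where
  "gensF = (\<Union>W\<in>{W. Tr.open_Hausdorff W}. CcF W)"

lemma CcF_Fun: "f \<in> CcF W \<Longrightarrow> f \<in> carrier Fun"
  by (simp add: Cc_functions_def)

lemma gensF_iff: "f \<in> gensF \<longleftrightarrow> f \<in> carrier Fun \<and> graph f \<in> Tr.gens"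
  using CcF_iff_graph CcF_Fun unfolding gensF_def Tr.gens_def by blast

sublocale Fun: bimodule R Fun by (rule bimodule_R_functions[OF R.ring_axioms])

lemma scalar_closed_gensF: "scalar_closed R Fun gensF"
proof -
  have "lscal Fun r f \<in> gensF \<and> rscal Fun f r \<in> gensF" if "r \<in> carrier R" "f \<in> gensF" for r f
    using that Tr.scalar_closed_gens Fun.lscal_closed[of r f] Fun.rscal_closed[of r f]
    unfolding gensF_iff scalar_closed_def
    by (auto simp: graph_section_ops[where RT = RT] simp del: sections_simps R_functions_simps)
  then show ?thesis by (auto simp: scalar_closed_def gensF_iff simp del: R_functions_simps)
qed

lemma FAlg_eq: "FAlg = Fun\<lparr>carrier := add_span Fun gensF\<rparr>"
  using Fun.generate_eq_add_span[OF scalar_closed_gensF]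
  by (simp add: semigroupoid_algebra_def gensF_def Tr.open_Hausdorff_def)

lemma FAlg_simps [simp]:
  "carrier FAlg = add_span Fun gensF" "f \<oplus>\<^bsub>FAlg\<^esub> g = f \<oplus>\<^bsub>Fun\<^esub> g" "\<zero>\<^bsub>FAlg\<^esub> = \<zero>\<^bsub>Fun\<^esub>"
  "f \<otimes>\<^bsub>FAlg\<^esub> g = f \<otimes>\<^bsub>Fun\<^esub> g" "lscal FAlg = lscal Fun" "rscal FAlg = rscal Fun"
  by (simp_all add: FAlg_eq del: R_functions_simps)

lemma bimodule_FAlg: "bimodule R FAlg"
  unfolding FAlg_eq by (rule Fun.bimodule_add_span[OF scalar_closed_gensF])

lemma FAlg_Fun: "f \<in> carrier FAlg \<Longrightarrow> f \<in> carrier Fun"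
  using Fun.add_span_subset[of gensF] scalar_closed_gensF
  by (auto simp: scalar_closed_def simp del: R_functions_simps)

lemma CcF_FAlg: "Tr.open_Hausdorff W \<Longrightarrow> f \<in> CcF W \<Longrightarrow> f \<in> carrier FAlg"
  by (auto simp: gensF_def intro: add_span.incl)

lemma FAlg_induct [consumes 1, case_names zero Cc add]:
  assumes "f \<in> carrier FAlg" "P \<zero>\<^bsub>Fun\<^esub>"
    and "\<And>f W. Tr.open_Hausdorff W \<Longrightarrow> f \<in> CcF W \<Longrightarrow> P f"
    and "\<And>f g. f \<in> carrier FAlg \<Longrightarrow> g \<in> carrier FAlg \<Longrightarrow> P f \<Longrightarrow> P g \<Longrightarrow> P (f \<oplus>\<^bsub>Fun\<^esub> g)"
  shows "P f"
  using assms(1)[simplified]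
  by induction (use assms in \<open>auto simp: gensF_def simp del: R_functions_simps\<close>)

text \<open>The identification of functions with sections of the trivial bundle is additive and matches the
  generators of the two algebras.\<close>

lemma FAlg_iff_graph: "f \<in> carrier FAlg \<longleftrightarrow> f \<in> carrier Fun \<and> graph f \<in> carrier Tr.Alg"
proof
  assume f: "f \<in> carrier FAlg"
  have "graph f \<in> carrier Tr.Alg" using f
  proof (induction rule: FAlg_induct)
    case zero
    then show ?case unfolding graph_section_ops[where RT = RT] Tr.Alg_simps by (rule add_span.zero)
  next
    case (Cc f W)
    then show ?case using CcF_iff_graph[OF Cc(1) CcF_Fun[OF Cc(2)]] Tr.Cc_Alg by blast
  next
    case (add f g)
    then show ?case unfolding graph_section_ops[where RT = RT] Tr.Alg_simps by (intro add_span.add)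
  qed
  then show "f \<in> carrier Fun \<and> graph f \<in> carrier Tr.Alg" using FAlg_Fun[OF f] by blast
next
  have "\<exists>f\<in>carrier FAlg. graph f = s" if "s \<in> carrier Tr.Alg" for s
    using that
  proof (induction rule: Tr.Alg_induct)
    case zero
    have "\<zero>\<^bsub>Fun\<^esub> \<in> carrier FAlg" by (simp add: add_span.zero del: R_functions_simps)
    then show ?case using graph_section_ops(2)[where RT = RT] by blast
  next
    case (Cc s W)
    obtain f where f: "f \<in> carrier Fun" "s = graph f" using graph_section_surj[OF Tr.Cc_Sec[OF Cc(2)]] .
    then have "f \<in> CcF W" using CcF_iff_graph[OF Cc(1) f(1)] Cc(2) by blast
    then show ?case using CcF_FAlg[OF Cc(1)] f(2) by blast
  next
    case (add s t)
    then obtain f g where "f \<in> carrier FAlg" "graph f = s" "g \<in> carrier FAlg" "graph g = t" by blast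
    then have "f \<oplus>\<^bsub>Fun\<^esub> g \<in> carrier FAlg" "graph (f \<oplus>\<^bsub>Fun\<^esub> g) = s \<oplus>\<^bsub>Tr.Sec\<^esub> t"
      by (auto simp: graph_section_ops(1)[where RT = RT] add_span.add simp del: R_functions_simps sections_simps)
    then show ?case by blast
  qed
  moreover assume "f \<in> carrier Fun \<and> graph f \<in> carrier Tr.Alg"
  ultimately show "f \<in> carrier FAlg" using graph_section_inj FAlg_Fun by metis
qed

lemma graph_mult: "f \<in> carrier FAlg \<Longrightarrow> g \<in> carrier FAlg \<Longrightarrow> graph (f \<otimes>\<^bsub>Fun\<^esub> g) = graph f \<otimes>\<^bsub>Tr.Sec\<^esub> graph g"
  by (rule graph_section_mult[OF R.ring_axioms E.semigroupoid_axioms]) (simp_all only: FAlg_Fun)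

lemma mult_FAlg:
  assumes "f \<in> carrier FAlg" "g \<in> carrier FAlg"
  shows "f \<otimes>\<^bsub>Fun\<^esub> g \<in> carrier FAlg"
proof -
  have "graph f \<otimes>\<^bsub>Tr.Sec\<^esub> graph g \<in> carrier Tr.Alg"
    using assms by (intro Tr.conv_Alg) (simp_all only: FAlg_iff_graph)
  then have G: "graph (f \<otimes>\<^bsub>Fun\<^esub> g) \<in> carrier Tr.Alg" using graph_mult[OF assms] by simp
  have "(f \<otimes>\<^bsub>Fun\<^esub> g) e \<in> carrier R" if "e \<in> arrows \<E>" for e
    using Tr.Alg_Sec[OF G] that by (auto simp: PiE_iff)
  moreover have "f \<otimes>\<^bsub>Fun\<^esub> g \<in> extensional (arrows \<E>)" by (simp add: R_functions_def)
  ultimately have "f \<otimes>\<^bsub>Fun\<^esub> g \<in> carrier Fun" by (simp add: PiE_iff)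
  then show ?thesis using G FAlg_iff_graph by blast
qed

lemma mult_FAlg_add:
  assumes fgh: "f \<in> carrier FAlg" "g \<in> carrier FAlg" "h \<in> carrier FAlg"
  shows "(f \<oplus>\<^bsub>Fun\<^esub> g) \<otimes>\<^bsub>Fun\<^esub> h = f \<otimes>\<^bsub>Fun\<^esub> h \<oplus>\<^bsub>Fun\<^esub> g \<otimes>\<^bsub>Fun\<^esub> h"
    and "h \<otimes>\<^bsub>Fun\<^esub> (f \<oplus>\<^bsub>Fun\<^esub> g) = h \<otimes>\<^bsub>Fun\<^esub> f \<oplus>\<^bsub>Fun\<^esub> h \<otimes>\<^bsub>Fun\<^esub> g"
proof -
  have G: "graph x \<in> carrier Tr.Alg" if "x \<in> carrier FAlg" for x using that FAlg_iff_graph by blast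
  note Gs = G[OF fgh(1)] G[OF fgh(2)] G[OF fgh(3)]
  have sum: "x \<oplus>\<^bsub>Fun\<^esub> y \<in> carrier FAlg" if "x \<in> carrier FAlg" "y \<in> carrier FAlg" for x y
    using that by (simp add: add_span.add del: R_functions_simps)
  show "(f \<oplus>\<^bsub>Fun\<^esub> g) \<otimes>\<^bsub>Fun\<^esub> h = f \<otimes>\<^bsub>Fun\<^esub> h \<oplus>\<^bsub>Fun\<^esub> g \<otimes>\<^bsub>Fun\<^esub> h"
  proof (rule graph_section_inj[OF FAlg_Fun FAlg_Fun])
    show "graph ((f \<oplus>\<^bsub>Fun\<^esub> g) \<otimes>\<^bsub>Fun\<^esub> h) = graph (f \<otimes>\<^bsub>Fun\<^esub> h \<oplus>\<^bsub>Fun\<^esub> g \<otimes>\<^bsub>Fun\<^esub> h)"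
      unfolding graph_section_ops(1)[where RT = RT] graph_mult[OF sum[OF fgh(1,2)] fgh(3)]
        graph_mult[OF fgh(1,3)] graph_mult[OF fgh(2,3)]
      by (intro Tr.conv_add_left Tr.Alg_Sec Tr.fibre_finite_Alg Gs)
  qed (intro mult_FAlg sum fgh)+
  show "h \<otimes>\<^bsub>Fun\<^esub> (f \<oplus>\<^bsub>Fun\<^esub> g) = h \<otimes>\<^bsub>Fun\<^esub> f \<oplus>\<^bsub>Fun\<^esub> h \<otimes>\<^bsub>Fun\<^esub> g"
  proof (rule graph_section_inj[OF FAlg_Fun FAlg_Fun])
    show "graph (h \<otimes>\<^bsub>Fun\<^esub> (f \<oplus>\<^bsub>Fun\<^esub> g)) = graph (h \<otimes>\<^bsub>Fun\<^esub> f \<oplus>\<^bsub>Fun\<^esub> h \<otimes>\<^bsub>Fun\<^esub> g)"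
      unfolding graph_section_ops(1)[where RT = RT] graph_mult[OF fgh(3) sum[OF fgh(1,2)]]
        graph_mult[OF fgh(3,1)] graph_mult[OF fgh(3,2)]
      by (intro Tr.conv_add_right Tr.Alg_Sec Tr.fibre_finite_Alg Gs)
  qed (intro mult_FAlg sum fgh)+
qed

end

(* From here on, sections and functions are elements of abstract carriers; unfolding the carriers
   would replace closure properties by pointwise conditions. *)
declare sections_simps(1) [simp del] R_functions_simps(1) [simp del]

lemma Fun_value: "f \<in> carrier (R_functions R \<E>) \<Longrightarrow> e \<in> arrows \<E> \<Longrightarrow> f e \<in> carrier R"
  by (auto simp: R_functions_simps(1))

section \<open>Symmetric bundles\<close>

context R_bundle
begin

text \<open>A scalar on the right of \<open>\<alpha>(a)\<close> is one on the left of \<open>\<beta>(b)\<close>, which by symmetry may be moved to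
  the right of \<open>\<beta>(b)\<close>, and thus of the product.\<close>

lemma conv_symmetric:
  assumes sym: "\<forall>\<gamma>\<in>arrows \<Gamma>. symmetric_bimodule R (fibre \<Lambda> \<pi> \<gamma>)"
    and sec: "\<alpha> \<in> carrier Sec" "\<beta> \<in> carrier Sec" and fin: "fibre_finite \<Gamma> \<pi> \<alpha>" "fibre_finite \<Gamma> \<pi> \<beta>"
    and r: "r \<in> carrier R"
  shows "rscal Sec \<alpha> r \<otimes>\<^bsub>Sec\<^esub> \<beta> = rscal Sec (\<alpha> \<otimes>\<^bsub>Sec\<^esub> \<beta>) r"
    and "\<alpha> \<otimes>\<^bsub>Sec\<^esub> rscal Sec \<beta> r = rscal Sec (\<alpha> \<otimes>\<^bsub>Sec\<^esub> \<beta>) r"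
    and "lscal Sec r \<alpha> = rscal Sec \<alpha> r"
proof -
  interpret S: bimodule R Sec by (rule bimodule_sections)
  have lr: "fib_lscal \<pi> r x = fib_rscal \<pi> x r" if "x \<in> arrows \<Lambda>" "proj \<pi> x \<in> arrows \<Gamma>" for x
    using sym that(2) r that(1) by (simp add: symmetric_bimodule_def)
  show "lscal Sec r \<alpha> = rscal Sec \<alpha> r"
    using lr Sec_value[OF sec(1)] by (auto intro!: restrict_ext)
  have proj_arr: "x \<in> arrows \<Lambda> \<Longrightarrow> proj \<pi> x \<in> arrows \<Gamma>" for x
    using rigid by (auto simp: rigid_hom_def sgpd_hom_def)
  have h: "fib_rscal \<pi> x r \<in> arrows \<Lambda> \<and> proj \<pi> (fib_rscal \<pi> x r) = proj \<pi> x" if "x \<in> arrows \<Lambda>" for x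
    using fib_rules(9)[OF proj_arr[OF that] r, of x] that by auto
  have h_add: "fib_rscal \<pi> (fib_add \<pi> x y) r = fib_add \<pi> (fib_rscal \<pi> x r) (fib_rscal \<pi> y r)"
    if "x \<in> arrows \<Lambda>" "y \<in> arrows \<Lambda>" "proj \<pi> x = proj \<pi> y" for x y
    by (rule fib_rules(10)[OF proj_arr[OF that(1)] r]) (use that in simp_all)
  have arr: "a \<in> arrows \<Gamma>" "b \<in> arrows \<Gamma>" if "(a, b) \<in> composable \<Gamma>" for a b
    using that by (auto simp: composable_def)
  note val = Sec_value[OF sec(1)] Sec_value[OF sec(2)]
  have m2: "sgpd_mult \<Lambda> (\<alpha> a) (rscal Sec \<beta> r b) = fib_rscal \<pi> (sgpd_mult \<Lambda> (\<alpha> a) (\<beta> b)) r"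
    if "(a, b) \<in> composable \<Gamma>" for a b
    using comp_rscal[OF that, of "\<alpha> a" "\<beta> b" r] val arr[OF that] r by simp
  have m1: "sgpd_mult \<Lambda> (rscal Sec \<alpha> r a) (\<beta> b) = fib_rscal \<pi> (sgpd_mult \<Lambda> (\<alpha> a) (\<beta> b)) r"
    if "(a, b) \<in> composable \<Gamma>" for a b
    using comp_balanced[OF that, of "\<alpha> a" "\<beta> b" r] lr[of "\<beta> b"] m2[OF that] val arr[OF that] r by simp
  have eq: "(\<lambda>\<gamma>\<in>arrows \<Gamma>. fib_rscal \<pi> ((\<alpha> \<otimes>\<^bsub>Sec\<^esub> \<beta>) \<gamma>) r) = rscal Sec (\<alpha> \<otimes>\<^bsub>Sec\<^esub> \<beta>) r" by simp
  show "rscal Sec \<alpha> r \<otimes>\<^bsub>Sec\<^esub> \<beta> = rscal Sec (\<alpha> \<otimes>\<^bsub>Sec\<^esub> \<beta>) r"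
    unfolding eq[symmetric]
    by (rule conv_scalar[OF sec S.rscal_closed[OF r sec(1)] sec(2) fin _ _ h h_add m1])
      (auto simp: r fib_rules)
  show "\<alpha> \<otimes>\<^bsub>Sec\<^esub> rscal Sec \<beta> r = rscal Sec (\<alpha> \<otimes>\<^bsub>Sec\<^esub> \<beta>) r"
    unfolding eq[symmetric]
    by (rule conv_scalar[OF sec sec(1) S.rscal_closed[OF r sec(2)] fin _ _ h h_add m2])
      (auto simp: r fib_rules)
qed

end

lemma (in function_algebra) mult_FAlg_scal:
  assumes "cring R" and r: "r \<in> carrier R" and fg: "f \<in> carrier FAlg" "g \<in> carrier FAlg"
  shows "lscal Fun r f \<otimes>\<^bsub>Fun\<^esub> g = lscal Fun r (f \<otimes>\<^bsub>Fun\<^esub> g)" "f \<otimes>\<^bsub>Fun\<^esub> lscal Fun r g = lscal Fun r (f \<otimes>\<^bsub>Fun\<^esub> g)"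
proof -
  interpret C: cring R by fact
  interpret FA: bimodule R FAlg by (rule bimodule_FAlg)
  have sym: "\<forall>e\<in>arrows \<E>. symmetric_bimodule R (fibre (triv_sgpd R RT \<E>) (triv_bundle R) e)"
    unfolding symmetric_bimodule_def using Tr.fibre_bimodule by (auto simp: C.m_comm)
  have G: "graph x \<in> carrier Tr.Alg" if "x \<in> carrier FAlg" for x using that FAlg_iff_graph by blast
  note Gs = Tr.Alg_Sec[OF G[OF fg(1)]] Tr.Alg_Sec[OF G[OF fg(2)]]
    Tr.fibre_finite_Alg[OF G[OF fg(1)]] Tr.fibre_finite_Alg[OF G[OF fg(2)]]
  have prod: "graph f \<otimes>\<^bsub>Tr.Sec\<^esub> graph g \<in> carrier Tr.Sec"
    by (rule Tr.conv_closed[OF Gs(1,2)])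
  have fin: "fibre_finite \<E> (triv_bundle R) (graph f \<otimes>\<^bsub>Tr.Sec\<^esub> graph g)"
    by (intro Tr.fibre_finite_Alg Tr.conv_Alg G fg)
  have scal: "lscal Fun r x \<in> carrier FAlg" if "x \<in> carrier FAlg" for x
    using FA.lscal_closed[OF r that] by (simp del: FAlg_simps(1) R_functions_simps)
  note s = Tr.conv_symmetric[OF sym _ _ _ _ r]
  show "lscal Fun r f \<otimes>\<^bsub>Fun\<^esub> g = lscal Fun r (f \<otimes>\<^bsub>Fun\<^esub> g)"
  proof (rule graph_section_inj[OF FAlg_Fun FAlg_Fun])
    show "graph (lscal Fun r f \<otimes>\<^bsub>Fun\<^esub> g) = graph (lscal Fun r (f \<otimes>\<^bsub>Fun\<^esub> g))"
      unfolding graph_mult[OF scal[OF fg(1)] fg(2)] graph_section_ops(3)[where RT = RT] graph_mult[OF fg]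
        s(3)[OF Gs(1,1,3,3)] s(3)[OF prod prod fin fin] s(1)[OF Gs] ..
  qed (intro mult_FAlg scal fg)+
  show "f \<otimes>\<^bsub>Fun\<^esub> lscal Fun r g = lscal Fun r (f \<otimes>\<^bsub>Fun\<^esub> g)"
  proof (rule graph_section_inj[OF FAlg_Fun FAlg_Fun])
    show "graph (f \<otimes>\<^bsub>Fun\<^esub> lscal Fun r g) = graph (lscal Fun r (f \<otimes>\<^bsub>Fun\<^esub> g))"
      unfolding graph_mult[OF fg(1) scal[OF fg(2)]] graph_section_ops(3)[where RT = RT] graph_mult[OF fg]
        s(3)[OF Gs(2,2,4,4)] s(3)[OF prod prod fin fin] s(2)[OF Gs] ..
  qed (intro mult_FAlg scal fg)+
qed

section \<open>The tensor product map\<close>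

locale bundle_pair = P: normal_bundle R RT \<Lambda> \<Gamma> \<pi> + F: function_algebra R RT \<E>
  for R :: "'r ring" and RT :: "'r topology"
    and \<Lambda> :: "('p, 'l) top_sgpd" and \<Gamma> :: "('o, 'g) top_sgpd" and \<pi> :: "('r, 'g, 'l) rbundle"
    and \<E> :: "('q, 'e) top_sgpd"
begin

sublocale Q: continuous_bundle R RT "prod_sgpd \<Lambda> \<E>" "prod_sgpd \<Gamma> \<E>" "prod_bundle \<pi>"
  by (rule continuous_bundle_prod[OF P.continuous_bundle_axioms F.E.topological_semigroupoid_axioms])

sublocale TP: bimodule_pair R P.Alg F.FAlg
  by (intro bimodule_pair.intro P.bimodule_Alg F.bimodule_FAlg)

declare P.Alg_simps(1) [simp del] Q.Alg_simps(1) [simp del] F.FAlg_simps(1) [simp del] F.Tr.Alg_simps(1) [simp del]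

text \<open>The section that corresponds to the pure tensor of \<open>\<alpha>\<close> and \<open>f\<close>.\<close>

definition outer :: "('g \<Rightarrow> 'l) \<Rightarrow> ('e \<Rightarrow> 'r) \<Rightarrow> 'g \<times> 'e \<Rightarrow> 'l \<times> 'e" where
  "outer \<alpha> f = restrict (\<lambda>(\<gamma>, e). (fib_rscal \<pi> (\<alpha> \<gamma>) (f e), e)) (arrows \<Gamma> \<times> arrows \<E>)"

lemma outer_apply [simp]:
  "\<gamma> \<in> arrows \<Gamma> \<Longrightarrow> e \<in> arrows \<E> \<Longrightarrow> outer \<alpha> f (\<gamma>, e) = (fib_rscal \<pi> (\<alpha> \<gamma>) (f e), e)"
  by (simp add: outer_def)

lemma outer_Sec:
  assumes "\<alpha> \<in> carrier P.Sec" "f \<in> carrier F.Fun"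
  shows "outer \<alpha> f \<in> carrier Q.Sec"
  by (subst sections_simps(1)) (use assms in \<open>auto simp: outer_def P.fib_rules P.Sec_value Fun_value\<close>)

lemma Q_Sec_eqI:
  "s \<in> carrier Q.Sec \<Longrightarrow> t \<in> carrier Q.Sec \<Longrightarrow>
    (\<And>\<gamma> e. \<gamma> \<in> arrows \<Gamma> \<Longrightarrow> e \<in> arrows \<E> \<Longrightarrow> s (\<gamma>, e) = t (\<gamma>, e)) \<Longrightarrow> s = t"
  by (rule Q.Sec_eqI) auto

lemma Q_open_Hausdorff:
  "P.open_Hausdorff V \<Longrightarrow> F.Tr.open_Hausdorff W \<Longrightarrow> Q.open_Hausdorff (V \<times> W)"
  by (simp add: P.open_Hausdorff_def F.Tr.open_Hausdorff_def Q.open_Hausdorff_def subtopology_Times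
      Hausdorff_space_prod_topology openin_prod_Times_iff)

lemma CcF_compact:
  assumes W: "F.Tr.open_Hausdorff W" and f: "f \<in> F.CcF W"
  obtains L where "compactin (atop \<E>) L" "L \<subseteq> W" "\<forall>e\<in>arrows \<E> - L. f e = \<zero>\<^bsub>R\<^esub>"
proof -
  have "graph_section \<E> f \<in> F.Tr.Cc W" using F.CcF_iff_graph[OF W F.CcF_Fun[OF f]] f by blast
  then obtain L where "compactin (atop \<E>) L" "L \<subseteq> W"
      "\<forall>e\<in>arrows \<E> - L. graph_section \<E> f e = fib_zero (triv_bundle R) e"
    unfolding F.Tr.Cc_iff[OF W] by blast
  then show thesis using that by auto
qed

lemma outer_Cc:
  assumes V: "P.open_Hausdorff V" and W: "F.Tr.open_Hausdorff W"
    and \<alpha>: "\<alpha> \<in> P.Cc V" and f: "f \<in> F.CcF W"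
  shows "outer \<alpha> f \<in> Q.Cc (V \<times> W)"
proof -
  obtain K where K: "compactin (atop \<Gamma>) K" "K \<subseteq> V" "\<forall>\<gamma>\<in>arrows \<Gamma> - K. \<alpha> \<gamma> = fib_zero \<pi> \<gamma>"
    using \<alpha> unfolding P.Cc_iff[OF V] by blast
  obtain L where L: "compactin (atop \<E>) L" "L \<subseteq> W" "\<forall>e\<in>arrows \<E> - L. f e = \<zero>\<^bsub>R\<^esub>"
    by (rule CcF_compact[OF W f])
  note sec = P.Cc_Sec[OF \<alpha>] F.CcF_Fun[OF f]
  have arr: "V \<subseteq> arrows \<Gamma>" "W \<subseteq> arrows \<E>"
    using P.open_Hausdorff_arrows[OF V] F.Tr.open_Hausdorff_arrows[OF W] by auto
  show ?thesis
    unfolding Q.Cc_iff[OF Q_open_Hausdorff[OF V W]]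
  proof (intro conjI exI[of _ "K \<times> L"] outer_Sec sec ballI)
    let ?X = "subtopology (atop (prod_sgpd \<Gamma> \<E>)) (V \<times> W)"
    have X: "?X = prod_topology (subtopology (atop \<Gamma>) V) (subtopology (atop \<E>) W)"
      by (simp add: subtopology_Times)
    have cf: "continuous_map (subtopology (atop \<E>) W) RT f" using f by (simp add: Cc_functions_def)
    have "continuous_map ?X (atop \<Lambda>) (\<lambda>p. fib_rscal \<pi> (\<alpha> (fst p)) (f (snd p)))"
      unfolding X
      by (rule continuous_map_compose2'[OF P.continuous_fib_rscal
          continuous_map_compose1[OF P.Cc_cont[OF \<alpha>] continuous_map_fst]
          continuous_map_compose1[OF cf continuous_map_snd]])
    moreover have "continuous_map ?X (atop \<E>) snd"
      by (simp add: continuous_map_from_subtopology continuous_map_snd)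
    ultimately have "continuous_map ?X (atop (prod_sgpd \<Lambda> \<E>)) (\<lambda>p. (fib_rscal \<pi> (\<alpha> (fst p)) (f (snd p)), snd p))"
      by (simp add: continuous_map_pairedI)
    then show "continuous_map ?X (atop (prod_sgpd \<Lambda> \<E>)) (outer \<alpha> f)"
      by (rule continuous_map_eq) (use arr in \<open>auto simp: subset_iff\<close>)
    show "compactin (atop (prod_sgpd \<Gamma> \<E>)) (K \<times> L)" using K(1) L(1) by (simp add: compactin_Times)
    show "K \<times> L \<subseteq> V \<times> W" using K(2) L(2) by blast
    show "outer \<alpha> f p = fib_zero (prod_bundle \<pi>) p" if "p \<in> arrows (prod_sgpd \<Gamma> \<E>) - K \<times> L" for p
      using that K(3) L(3) sec by (cases p) (auto simp: P.fib_rules P.Sec_value Fun_value)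
  qed
qed

lemma outer_add_left:
  assumes "\<alpha> \<in> carrier P.Sec" "\<beta> \<in> carrier P.Sec" "f \<in> carrier F.Fun"
  shows "outer (\<alpha> \<oplus>\<^bsub>P.Sec\<^esub> \<beta>) f = outer \<alpha> f \<oplus>\<^bsub>Q.Sec\<^esub> outer \<beta> f"
  by (rule ext) (use assms in \<open>auto simp: outer_def restrict_def P.fib_rules P.Sec_value Fun_value\<close>)

lemma outer_add_right:
  assumes "\<alpha> \<in> carrier P.Sec" "f \<in> carrier F.Fun" "g \<in> carrier F.Fun"
  shows "outer \<alpha> (f \<oplus>\<^bsub>F.Fun\<^esub> g) = outer \<alpha> f \<oplus>\<^bsub>Q.Sec\<^esub> outer \<alpha> g"
  by (rule ext) (use assms in \<open>auto simp: outer_def restrict_def P.fib_rules P.Sec_value Fun_value\<close>)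

lemma outer_balanced:
  assumes "\<alpha> \<in> carrier P.Sec" "f \<in> carrier F.Fun" "r \<in> carrier R"
  shows "outer (rscal P.Sec \<alpha> r) f = outer \<alpha> (lscal F.Fun r f)"
  by (rule ext) (use assms in \<open>auto simp: outer_def restrict_def P.fib_rules P.Sec_value Fun_value\<close>)

lemma outer_scal:
  assumes "\<alpha> \<in> carrier P.Sec" "f \<in> carrier F.Fun" "r \<in> carrier R"
  shows "outer (lscal P.Sec r \<alpha>) f = lscal Q.Sec r (outer \<alpha> f)"
    and "outer \<alpha> (rscal F.Fun f r) = rscal Q.Sec (outer \<alpha> f) r"
  by (rule ext, use assms in \<open>auto simp: outer_def restrict_def P.fib_rules P.Sec_value Fun_value\<close>)+

lemma outer_zero:
  assumes "\<alpha> \<in> carrier P.Sec" "f \<in> carrier F.Fun"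
  shows "outer \<zero>\<^bsub>P.Sec\<^esub> f = \<zero>\<^bsub>Q.Sec\<^esub>" "outer \<alpha> \<zero>\<^bsub>F.Fun\<^esub> = \<zero>\<^bsub>Q.Sec\<^esub>"
  by (rule ext, use assms in \<open>auto simp: outer_def restrict_def P.fib_rules P.Sec_value Fun_value\<close>)+

lemma outer_Alg:
  assumes "\<alpha> \<in> carrier P.Alg" "f \<in> carrier F.FAlg"
  shows "outer \<alpha> f \<in> carrier Q.Alg"
proof -
  interpret QA: bimodule R Q.Alg by (rule Q.bimodule_Alg)
  have closed: "\<zero>\<^bsub>Q.Sec\<^esub> \<in> carrier Q.Alg"
    "\<And>s t. s \<in> carrier Q.Alg \<Longrightarrow> t \<in> carrier Q.Alg \<Longrightarrow> s \<oplus>\<^bsub>Q.Sec\<^esub> t \<in> carrier Q.Alg"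
    using QA.M.zero_closed QA.M.a_closed unfolding Q.Alg_simps(2,3) .
  have 1: "outer \<alpha> f \<in> carrier Q.Alg" if V: "P.open_Hausdorff V" "\<alpha> \<in> P.Cc V" for V \<alpha>
    using assms(2)
  proof (induction rule: F.FAlg_induct)
    case zero
    then show ?case unfolding outer_zero(2)[OF P.Cc_Sec[OF V(2)] F.Fun.M.zero_closed] by (rule closed)
  next
    case (Cc f W)
    then show ?case using outer_Cc[OF V(1) Cc(1) V(2) Cc(2)] Q.Cc_Alg Q_open_Hausdorff V(1) by blast
  next
    case (add f g)
    then show ?case
      unfolding outer_add_right[OF P.Cc_Sec[OF V(2)] F.FAlg_Fun[OF add(1)] F.FAlg_Fun[OF add(2)]]
      by (intro closed)
  qed
  note f = F.FAlg_Fun[OF assms(2)]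
  show ?thesis
    using assms(1)
  proof (induction rule: P.Alg_induct)
    case zero
    then show ?case unfolding outer_zero(1)[OF _ f, OF bimodule.axioms(2)[OF P.bimodule_sections, THEN abelian_group.axioms(1), THEN abelian_monoid.zero_closed]] by (rule closed)
  next
    case (Cc \<alpha> V)
    then show ?case by (rule 1)
  next
    case (add \<alpha> \<beta>)
    then show ?case unfolding outer_add_left[OF P.Alg_Sec[OF add(1)] P.Alg_Sec[OF add(2)] f] by (intro closed)
  qed
qed

abbreviation "is_T \<equiv> is_tensor_section_map R RT \<Lambda> \<Gamma> \<pi> \<E>"

lemma is_T_pure:
  assumes "is_T T" "\<alpha> \<in> carrier P.Alg" "f \<in> carrier F.FAlg"
  shows "T (TP.pure \<alpha> f) = outer \<alpha> f"
proof (rule Q_Sec_eqI)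
  have "T \<in> carrier TP.MN \<rightarrow> carrier Q.Alg"
    using assms(1) by (auto simp: is_tensor_section_map_def bimod_hom_def)
  then show "T (TP.pure \<alpha> f) \<in> carrier Q.Sec" using TP.pure_closed[OF assms(2,3)] Q.Alg_Sec by blast
  show "outer \<alpha> f \<in> carrier Q.Sec" by (intro outer_Sec P.Alg_Sec F.FAlg_Fun assms)
  show "T (TP.pure \<alpha> f) (\<gamma>, e) = outer \<alpha> f (\<gamma>, e)" if "\<gamma> \<in> arrows \<Gamma>" "e \<in> arrows \<E>" for \<gamma> e
    using assms that by (simp add: is_tensor_section_map_def)
qed

lemma is_T_hom:
  assumes "is_T T"
  shows "T \<in> carrier TP.MN \<rightarrow>\<^sub>E carrier Q.Alg"
    and "X \<in> carrier TP.MN \<Longrightarrow> Y \<in> carrier TP.MN \<Longrightarrow> T (X \<oplus>\<^bsub>TP.MN\<^esub> Y) = T X \<oplus>\<^bsub>Q.Alg\<^esub> T Y"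
  using assms unfolding is_tensor_section_map_def bimod_hom_def by blast+

lemma is_T_zero:
  assumes "is_T T"
  shows "T \<zero>\<^bsub>TP.MN\<^esub> = \<zero>\<^bsub>Q.Alg\<^esub>"
  by (rule additive_zero[OF TP.T.abelian_group_axioms bimodule.axioms(2)[OF Q.bimodule_Alg]])
    (use is_T_hom[OF assms] in auto)

lemma is_T_unique:
  assumes "is_T T" "is_T T'"
  shows "T = T'"
proof (rule PiE_ext[OF is_T_hom(1)[OF assms(1)] is_T_hom(1)[OF assms(2)]])
  fix X assume "X \<in> carrier TP.MN"
  then show "T X = T' X"
    by (induction rule: TP.tensor_induct) (simp_all only: is_T_zero is_T_hom is_T_pure assms)
qed

lemma is_T_exists: "\<exists>T. is_T T"
proof -
  interpret QA: bimodule R Q.Alg by (rule Q.bimodule_Alg)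
  have "\<exists>h \<in> carrier TP.MN \<rightarrow>\<^sub>E carrier Q.Alg.
    (\<forall>X\<in>carrier TP.MN. \<forall>Y\<in>carrier TP.MN. h (X \<oplus>\<^bsub>TP.MN\<^esub> Y) = h X \<oplus>\<^bsub>Q.Alg\<^esub> h Y) \<and>
    (\<forall>\<alpha>\<in>carrier P.Alg. \<forall>f\<in>carrier F.FAlg. h (TP.pure \<alpha> f) = outer \<alpha> f)"
  proof (rule TP.tensor_lift[OF QA.M.abelian_group_axioms, of outer])
    show "outer \<alpha> f \<in> carrier Q.Alg" if "\<alpha> \<in> carrier P.Alg" "f \<in> carrier F.FAlg" for \<alpha> f
      using that by (rule outer_Alg)
    show "outer (\<alpha> \<oplus>\<^bsub>P.Alg\<^esub> \<beta>) f = outer \<alpha> f \<oplus>\<^bsub>Q.Alg\<^esub> outer \<beta> f"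
      if "\<alpha> \<in> carrier P.Alg" "\<beta> \<in> carrier P.Alg" "f \<in> carrier F.FAlg" for \<alpha> \<beta> f
      unfolding P.Alg_simps Q.Alg_simps by (intro outer_add_left P.Alg_Sec F.FAlg_Fun that)
    show "outer \<alpha> (f \<oplus>\<^bsub>F.FAlg\<^esub> g) = outer \<alpha> f \<oplus>\<^bsub>Q.Alg\<^esub> outer \<alpha> g"
      if "\<alpha> \<in> carrier P.Alg" "f \<in> carrier F.FAlg" "g \<in> carrier F.FAlg" for \<alpha> f g
      unfolding F.FAlg_simps Q.Alg_simps by (intro outer_add_right P.Alg_Sec F.FAlg_Fun that)
    show "outer (rscal P.Alg \<alpha> r) f = outer \<alpha> (lscal F.FAlg r f)"
      if "\<alpha> \<in> carrier P.Alg" "r \<in> carrier R" "f \<in> carrier F.FAlg" for \<alpha> r f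
      unfolding P.Alg_simps F.FAlg_simps by (intro outer_balanced P.Alg_Sec F.FAlg_Fun that)
  qed
  then obtain h where h: "h \<in> carrier TP.MN \<rightarrow>\<^sub>E carrier Q.Alg"
    and h_add: "\<And>X Y. X \<in> carrier TP.MN \<Longrightarrow> Y \<in> carrier TP.MN \<Longrightarrow> h (X \<oplus>\<^bsub>TP.MN\<^esub> Y) = h X \<oplus>\<^bsub>Q.Alg\<^esub> h Y"
    and h_pure: "\<And>\<alpha> f. \<alpha> \<in> carrier P.Alg \<Longrightarrow> f \<in> carrier F.FAlg \<Longrightarrow> h (TP.pure \<alpha> f) = outer \<alpha> f"
    by auto
  have h_zero: "h \<zero>\<^bsub>TP.MN\<^esub> = \<zero>\<^bsub>Q.Alg\<^esub>"
    by (rule additive_zero[OF TP.T.abelian_group_axioms QA.M.abelian_group_axioms]) (use h h_add in auto)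
  have h_cl: "h X \<in> carrier Q.Alg" if "X \<in> carrier TP.MN" for X using h that by auto
  have l: "lscal TP.MN r X \<in> carrier TP.MN \<and> h (lscal TP.MN r X) = lscal Q.Alg r (h X)"
    if r: "r \<in> carrier R" and X: "X \<in> carrier TP.MN" for r X
    using X
  proof (induction rule: TP.tensor_induct)
    case zero
    then show ?case using r by (simp only: TP.scal_zero TP.T.zero_closed h_zero QA.lscal_zero simp_thms)
  next
    case (pure \<alpha> f)
    have "lscal P.Alg r \<alpha> \<in> carrier P.Alg" using r pure TP.M.lscal_closed by blast
    then show ?case using pure r outer_scal(1)[OF P.Alg_Sec[OF pure(1)] F.FAlg_Fun[OF pure(2)] r]
      by (simp only: TP.scal_pure TP.pure_closed h_pure P.Alg_simps(5) Q.Alg_simps(5) simp_thms)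
  next
    case (add X Y)
    then show ?case using r h_cl
      by (simp only: TP.scal_add h_add QA.lscal_add TP.T.a_closed simp_thms)
  qed
  have rr: "rscal TP.MN X r \<in> carrier TP.MN \<and> h (rscal TP.MN X r) = rscal Q.Alg (h X) r"
    if r: "r \<in> carrier R" and X: "X \<in> carrier TP.MN" for r X
    using X
  proof (induction rule: TP.tensor_induct)
    case zero
    then show ?case using r by (simp only: TP.scal_zero TP.T.zero_closed h_zero QA.rscal_zero simp_thms)
  next
    case (pure \<alpha> f)
    have "rscal F.FAlg f r \<in> carrier F.FAlg" using r pure TP.N.rscal_closed by blast
    then show ?case using pure r outer_scal(2)[OF P.Alg_Sec[OF pure(1)] F.FAlg_Fun[OF pure(2)] r]
      by (simp only: TP.scal_pure TP.pure_closed h_pure F.FAlg_simps(6) Q.Alg_simps(6) simp_thms)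
  next
    case (add X Y)
    then show ?case using r h_cl
      by (simp only: TP.scal_add h_add QA.rscal_add TP.T.a_closed simp_thms)
  qed
  have "h \<in> bimod_hom R TP.MN Q.Alg"
    using h h_add l rr unfolding bimod_hom_def by blast
  moreover have "h (TP.pure \<alpha> f) (\<gamma>, e) = (fib_rscal \<pi> (\<alpha> \<gamma>) (f e), e)"
    if "\<alpha> \<in> carrier P.Alg" "f \<in> carrier F.FAlg" "\<gamma> \<in> arrows \<Gamma>" "e \<in> arrows \<E>" for \<alpha> f \<gamma> e
    using that by (simp add: h_pure)
  ultimately have "is_T h" unfolding is_tensor_section_map_def by blast
  then show ?thesis by blast
qed

end

section \<open>Multiplicativity\<close>

context bundle_pair
begin

lemma fibre_finite_outer:
  assumes "fibre_finite \<Gamma> \<pi> \<alpha>" "fibre_finite \<E> (triv_bundle R) (graph_section \<E> f)"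
    and sec: "\<alpha> \<in> carrier P.Sec" "f \<in> carrier F.Fun"
  shows "fibre_finite (prod_sgpd \<Gamma> \<E>) (prod_bundle \<pi>) (outer \<alpha> f)"
  unfolding fibre_finite_def
proof (intro allI conjI)
  have nz: "\<alpha> a \<noteq> fib_zero \<pi> a \<and> graph_section \<E> f c \<noteq> fib_zero (triv_bundle R) c"
    if "a \<in> arrows \<Gamma>" "c \<in> arrows \<E>" "outer \<alpha> f (a, c) \<noteq> fib_zero (prod_bundle \<pi>) (a, c)" for a c
    using that sec by (auto simp: P.fib_rules P.Sec_value Fun_value)
  fix v
  show "finite {a \<in> arrows (prod_sgpd \<Gamma> \<E>). range_of (prod_sgpd \<Gamma> \<E>) a = v \<and> outer \<alpha> f a \<noteq> fib_zero (prod_bundle \<pi>) a}"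
  proof (rule finite_subset)
    show "{a \<in> arrows (prod_sgpd \<Gamma> \<E>). range_of (prod_sgpd \<Gamma> \<E>) a = v \<and> outer \<alpha> f a \<noteq> fib_zero (prod_bundle \<pi>) a} \<subseteq>
       {a \<in> arrows \<Gamma>. range_of \<Gamma> a = fst v \<and> \<alpha> a \<noteq> fib_zero \<pi> a} \<times>
       {c \<in> arrows \<E>. range_of \<E> c = snd v \<and> graph_section \<E> f c \<noteq> fib_zero (triv_bundle R) c}"
      using nz by (auto simp del: outer_apply prod_bundle_simps)
    show "finite \<dots>" using assms by (auto simp: fibre_finite_def)
  qed
  show "finite {a \<in> arrows (prod_sgpd \<Gamma> \<E>). source (prod_sgpd \<Gamma> \<E>) a = v \<and> outer \<alpha> f a \<noteq> fib_zero (prod_bundle \<pi>) a}"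
  proof (rule finite_subset)
    show "{a \<in> arrows (prod_sgpd \<Gamma> \<E>). source (prod_sgpd \<Gamma> \<E>) a = v \<and> outer \<alpha> f a \<noteq> fib_zero (prod_bundle \<pi>) a} \<subseteq>
       {a \<in> arrows \<Gamma>. source \<Gamma> a = fst v \<and> \<alpha> a \<noteq> fib_zero \<pi> a} \<times>
       {c \<in> arrows \<E>. source \<E> c = snd v \<and> graph_section \<E> f c \<noteq> fib_zero (triv_bundle R) c}"
      using nz by (auto simp del: outer_apply prod_bundle_simps)
    show "finite \<dots>" using assms by (auto simp: fibre_finite_def)
  qed
qed

lemma graph_fibre_finite:
  "f \<in> carrier F.FAlg \<Longrightarrow> fibre_finite \<E> (triv_bundle R) (graph_section \<E> f)"
  using F.FAlg_iff_graph F.Tr.fibre_finite_Alg by blast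

lemma fibre_finite_is_T:
  assumes T: "is_T T" and X: "X \<in> carrier TP.MN"
  shows "fibre_finite (prod_sgpd \<Gamma> \<E>) (prod_bundle \<pi>) (T X)"
  using X
proof (induction rule: TP.tensor_induct)
  case zero
  show ?case unfolding is_T_zero[OF T] Q.Alg_simps by (rule Q.fibre_finite_zero)
next
  case (pure \<alpha> f)
  show ?case
    unfolding is_T_pure[OF T pure]
    by (intro fibre_finite_outer P.fibre_finite_Alg graph_fibre_finite P.Alg_Sec F.FAlg_Fun pure)
next
  case (add X Y)
  then show ?case unfolding is_T_hom(2)[OF T add(1,2)] Q.Alg_simps by (intro Q.fibre_finite_add)
qed

context
  assumes cring: "cring R" and sym: "\<forall>\<gamma>\<in>arrows \<Gamma>. symmetric_bimodule R (fibre \<Lambda> \<pi> \<gamma>)"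
begin

lemma outer_mult_summand:
  assumes ab: "(a, b) \<in> composable \<Gamma>" and xy: "x \<in> arrows \<Lambda>" "proj \<pi> x = a" "y \<in> arrows \<Lambda>" "proj \<pi> y = b"
    and rs: "r \<in> carrier R" "s \<in> carrier R"
  shows "sgpd_mult \<Lambda> (fib_rscal \<pi> x r) (fib_rscal \<pi> y s) = fib_rscal \<pi> (sgpd_mult \<Lambda> x y) (r \<otimes>\<^bsub>R\<^esub> s)"
proof -
  interpret C: cring R by (rule cring)
  have arr: "a \<in> arrows \<Gamma>" "b \<in> arrows \<Gamma>" using ab by (auto simp: composable_def)
  have xr: "fib_rscal \<pi> x r \<in> carrier (fibre \<Lambda> \<pi> a)" using P.fib_rules(9)[OF arr(1), of r x] xy rs by simp
  have y: "y \<in> carrier (fibre \<Lambda> \<pi> b)" using xy by simp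
  have x: "x \<in> carrier (fibre \<Lambda> \<pi> a)" using xy by simp
  have "sgpd_mult \<Lambda> (fib_rscal \<pi> x r) (fib_rscal \<pi> y s) = fib_rscal \<pi> (sgpd_mult \<Lambda> (fib_rscal \<pi> x r) y) s"
    by (rule P.comp_rscal[OF ab xr y rs(2)])
  also have "sgpd_mult \<Lambda> (fib_rscal \<pi> x r) y = sgpd_mult \<Lambda> x (fib_lscal \<pi> r y)"
    by (rule P.comp_balanced[OF ab x y rs(1)])
  also have "fib_lscal \<pi> r y = fib_rscal \<pi> y r"
    using sym arr(2) y rs by (simp add: symmetric_bimodule_def)
  also have "sgpd_mult \<Lambda> x (fib_rscal \<pi> y r) = fib_rscal \<pi> (sgpd_mult \<Lambda> x y) r"
    by (rule P.comp_rscal[OF ab x y rs(1)])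
  also have "fib_rscal \<pi> (fib_rscal \<pi> (sgpd_mult \<Lambda> x y) r) s = fib_rscal \<pi> (sgpd_mult \<Lambda> x y) (r \<otimes>\<^bsub>R\<^esub> s)"
    using P.fib_rules(12)[OF P.\<Gamma>.comp_closed[OF ab] rs, of "sgpd_mult \<Lambda> x y"] P.comp_fibres[OF ab xy] by simp
  finally show ?thesis .
qed

text \<open>The factorisations of \<open>(\<gamma>, e)\<close> are the pairs of a factorisation of \<open>\<gamma>\<close> and one of \<open>e\<close>. The sum over
  these pairs is a product of two sums because the action of \<open>R\<close> on a fibre is additive in both
  arguments.\<close>

lemma outer_mult:
  assumes \<alpha>: "\<alpha> \<in> carrier P.Alg" and \<beta>: "\<beta> \<in> carrier P.Alg"
    and f: "f \<in> carrier F.FAlg" and g: "g \<in> carrier F.FAlg"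
  shows "outer \<alpha> f \<otimes>\<^bsub>Q.Sec\<^esub> outer \<beta> g = outer (\<alpha> \<otimes>\<^bsub>P.Sec\<^esub> \<beta>) (f \<otimes>\<^bsub>F.Fun\<^esub> g)"
proof (rule Q_Sec_eqI)
  note sec = P.Alg_Sec[OF \<alpha>] P.Alg_Sec[OF \<beta>] F.FAlg_Fun[OF f] F.FAlg_Fun[OF g]
  note outer = outer_Sec[OF sec(1,3)] outer_Sec[OF sec(2,4)]
  show "outer \<alpha> f \<otimes>\<^bsub>Q.Sec\<^esub> outer \<beta> g \<in> carrier Q.Sec" by (rule Q.conv_closed[OF outer])
  show "outer (\<alpha> \<otimes>\<^bsub>P.Sec\<^esub> \<beta>) (f \<otimes>\<^bsub>F.Fun\<^esub> g) \<in> carrier Q.Sec"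
    by (intro outer_Sec P.conv_closed sec F.FAlg_Fun F.mult_FAlg f g)
  fix \<gamma> e assume \<gamma>: "\<gamma> \<in> arrows \<Gamma>" and e: "e \<in> arrows \<E>"
  then have \<gamma>e: "(\<gamma>, e) \<in> arrows (prod_sgpd \<Gamma> \<E>)" by simp
  interpret H: abelian_group "fibre \<Lambda> \<pi> \<gamma>" by (rule P.fib_abelian[OF \<gamma>])
  interpret G: abelian_group "fibre (prod_sgpd \<Lambda> \<E>) (prod_bundle \<pi>) (\<gamma>, e)" by (rule Q.fib_abelian[OF \<gamma>e])
  let ?H = "fibre \<Lambda> \<pi> \<gamma>" and ?G = "fibre (prod_sgpd \<Lambda> \<E>) (prod_bundle \<pi>) (\<gamma>, e)"
  define P1 where "P1 = conv_pairs \<Gamma> \<pi> \<alpha> \<beta> \<gamma>"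
  define P2 where "P2 = {(c, d) \<in> composable \<E>. sgpd_mult \<E> c d = e \<and> f c \<noteq> \<zero>\<^bsub>R\<^esub> \<and> g d \<noteq> \<zero>\<^bsub>R\<^esub>}"
  have fin1: "finite P1"
    unfolding P1_def by (intro P.\<Gamma>.finite_conv_pairs P.fibre_finite_Alg \<alpha> \<beta>)
  have "P2 = conv_pairs \<E> (triv_bundle R) (graph_section \<E> f) (graph_section \<E> g) e"
    by (auto simp: P2_def conv_pairs_def composable_def)
  then have fin2: "finite P2"
    using F.E.finite_conv_pairs[OF graph_fibre_finite[OF f] graph_fibre_finite[OF g]] by simp
  have comp1: "(a, b) \<in> composable \<Gamma>" "sgpd_mult \<Gamma> a b = \<gamma>" "a \<in> arrows \<Gamma>" "b \<in> arrows \<Gamma>"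
    if "(a, b) \<in> P1" for a b using that by (auto simp: P1_def conv_pairs_def composable_def)
  have comp2: "(c, d) \<in> composable \<E>" "sgpd_mult \<E> c d = e" "c \<in> arrows \<E>" "d \<in> arrows \<E>"
    if "(c, d) \<in> P2" for c d using that by (auto simp: P2_def composable_def)
  define u where "u = (\<lambda>(a, b). sgpd_mult \<Lambda> (\<alpha> a) (\<beta> b))"
  define v where "v = (\<lambda>(c, d). f c \<otimes>\<^bsub>R\<^esub> g d)"
  have u: "u p \<in> carrier ?H" if "p \<in> P1" for p
    using P.conv_summand_closed[OF sec(1,2), of P1 \<gamma>] comp1 that unfolding u_def by blast
  have v: "v q \<in> carrier R" if "q \<in> P2" for q
    using that comp2 Fun_value[OF sec(3)] Fun_value[OF sec(4)] by (cases q) (auto simp: v_def)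
  \<comment> \<open>regroups a pair of factorisations as a factorisation of a pair\<close>
  define \<sigma> :: "('g \<times> 'g) \<times> ('e \<times> 'e) \<Rightarrow> ('g \<times> 'e) \<times> ('g \<times> 'e)"
    where "\<sigma> = (\<lambda>((a, b), (c, d)). ((a, c), (b, d)))"
  let ?term = "\<lambda>(p, q). sgpd_mult (prod_sgpd \<Lambda> \<E>) (outer \<alpha> f p) (outer \<beta> g q)"
  have P: "finite (\<sigma> ` (P1 \<times> P2))"
    "\<sigma> ` (P1 \<times> P2) \<subseteq> {(p, q) \<in> composable (prod_sgpd \<Gamma> \<E>). sgpd_mult (prod_sgpd \<Gamma> \<E>) p q = (\<gamma>, e)}"
    using fin1 fin2 comp1 comp2 by (auto simp: \<sigma>_def composable_prod)
  have cp: "conv_pairs (prod_sgpd \<Gamma> \<E>) (prod_bundle \<pi>) (outer \<alpha> f) (outer \<beta> g) (\<gamma>, e) \<subseteq> \<sigma> ` (P1 \<times> P2)"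
  proof
    fix z assume z: "z \<in> conv_pairs (prod_sgpd \<Gamma> \<E>) (prod_bundle \<pi>) (outer \<alpha> f) (outer \<beta> g) (\<gamma>, e)"
    obtain a c b d where zz: "z = ((a, c), (b, d))" by (metis prod.collapse)
    have ab: "(a, b) \<in> composable \<Gamma>" "sgpd_mult \<Gamma> a b = \<gamma>" "(c, d) \<in> composable \<E>" "sgpd_mult \<E> c d = e"
      and nz: "outer \<alpha> f (a, c) \<noteq> fib_zero (prod_bundle \<pi>) (a, c)" "outer \<beta> g (b, d) \<noteq> fib_zero (prod_bundle \<pi>) (b, d)"
      using z by (simp_all add: zz conv_pairs_def composable_prod)
    have arr: "a \<in> arrows \<Gamma>" "b \<in> arrows \<Gamma>" "c \<in> arrows \<E>" "d \<in> arrows \<E>"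
      using ab by (auto simp: composable_def)
    have "\<alpha> a \<noteq> fib_zero \<pi> a" "f c \<noteq> \<zero>\<^bsub>R\<^esub>" "\<beta> b \<noteq> fib_zero \<pi> b" "g d \<noteq> \<zero>\<^bsub>R\<^esub>"
      using nz arr sec by (auto simp: P.fib_rules P.Sec_value Fun_value)
    then have "((a, b), (c, d)) \<in> P1 \<times> P2" using ab by (simp add: P1_def P2_def conv_pairs_def)
    then show "z \<in> \<sigma> ` (P1 \<times> P2)" by (force simp: zz \<sigma>_def)
  qed
  have "(outer \<alpha> f \<otimes>\<^bsub>Q.Sec\<^esub> outer \<beta> g) (\<gamma>, e) = finsum ?G ?term (\<sigma> ` (P1 \<times> P2))"
    by (rule Q.conv_eq[OF \<gamma>e outer P cp])
  also have "\<dots> = finsum ?G (\<lambda>z. ?term (\<sigma> z)) (P1 \<times> P2)"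
    by (rule G.finsum_reindex[OF Q.conv_summand_closed[OF outer P(2)]]) (auto simp: \<sigma>_def inj_on_def)
  also have "\<dots> = finsum ?G (\<lambda>z. ((\<lambda>(p, q). fib_rscal \<pi> (u p) (v q)) z, e)) (P1 \<times> P2)"
  proof (rule G.finsum_cong'[OF refl])
    have uv: "fib_rscal \<pi> (u p) (v q) \<in> arrows \<Lambda> \<and> proj \<pi> (fib_rscal \<pi> (u p) (v q)) = \<gamma>"
      if "p \<in> P1" "q \<in> P2" for p q
      using P.fib_rules(9)[OF \<gamma> v[OF that(2)], of "u p"] u[OF that(1)] by simp
    then show "(\<lambda>z. ((\<lambda>(p, q). fib_rscal \<pi> (u p) (v q)) z, e)) \<in> P1 \<times> P2 \<rightarrow> carrier ?G"
      using e by auto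
    fix z assume "z \<in> P1 \<times> P2"
    then obtain a b c d where z: "z = ((a, b), (c, d))" "(a, b) \<in> P1" "(c, d) \<in> P2" by auto
    show "?term (\<sigma> z) = ((\<lambda>(p, q). fib_rscal \<pi> (u p) (v q)) z, e)"
      using comp1[OF z(2)] comp2[OF z(3)] sec
        outer_mult_summand[OF comp1(1)[OF z(2)], of "\<alpha> a" "\<beta> b" "f c" "g d"]
      by (simp add: z(1) \<sigma>_def u_def v_def P.Sec_value Fun_value)
  qed
  also have "\<dots> = (finsum ?H (\<lambda>(p, q). fib_rscal \<pi> (u p) (v q)) (P1 \<times> P2), e)"
  proof (rule additive_finsum[OF H.abelian_group_axioms G.abelian_group_axioms, of "\<lambda>x. (x, e)", symmetric])
    show "(\<lambda>(p, q). fib_rscal \<pi> (u p) (v q)) \<in> P1 \<times> P2 \<rightarrow> carrier ?H"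
      using P.fib_rules(9)[OF \<gamma> v] u by auto
  qed (use e in auto)
  also have "finsum ?H (\<lambda>(p, q). fib_rscal \<pi> (u p) (v q)) (P1 \<times> P2) =
      finsum ?H (\<lambda>p. finsum ?H (\<lambda>q. fib_rscal \<pi> (u p) (v q)) P2) P1"
    by (rule finsum_Times[OF H.abelian_group_axioms fin1 fin2])
      (use P.fib_rules(9)[OF \<gamma> v] u in auto)
  also have "\<dots> = finsum ?H (\<lambda>p. fib_rscal \<pi> (u p) (finsum R v P2)) P1"
  proof (rule H.finsum_cong'[OF refl])
    have V: "finsum R v P2 \<in> carrier R" using v by (intro P.R.finsum_closed) auto
    then show "(\<lambda>p. fib_rscal \<pi> (u p) (finsum R v P2)) \<in> P1 \<rightarrow> carrier ?H"
      using P.fib_rules(9)[OF \<gamma> V] u by auto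
    fix p assume p: "p \<in> P1"
    show "finsum ?H (\<lambda>q. fib_rscal \<pi> (u p) (v q)) P2 = fib_rscal \<pi> (u p) (finsum R v P2)"
      by (rule additive_finsum[OF P.R.abelian_group_axioms H.abelian_group_axioms, symmetric])
        (use u[OF p] v \<gamma> in \<open>auto simp: P.fib_rules\<close>)
  qed
  also have "\<dots> = fib_rscal \<pi> (finsum ?H u P1) (finsum R v P2)"
  proof (rule additive_finsum[OF H.abelian_group_axioms H.abelian_group_axioms,
        of "\<lambda>x. fib_rscal \<pi> x (finsum R v P2)", symmetric])
    have "finsum R v P2 \<in> carrier R" using v by (intro P.R.finsum_closed) auto
    then show "(\<lambda>x. fib_rscal \<pi> x (finsum R v P2)) \<in> carrier ?H \<rightarrow> carrier ?H"
      "\<And>x y. x \<in> carrier ?H \<Longrightarrow> y \<in> carrier ?H \<Longrightarrow> fib_rscal \<pi> (x \<oplus>\<^bsub>?H\<^esub> y) (finsum R v P2) =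
        fib_rscal \<pi> x (finsum R v P2) \<oplus>\<^bsub>?H\<^esub> fib_rscal \<pi> y (finsum R v P2)"
      using \<gamma> by (auto simp: P.fib_rules)
  qed (use u in auto)
  also have "finsum ?H u P1 = (\<alpha> \<otimes>\<^bsub>P.Sec\<^esub> \<beta>) \<gamma>"
    using \<gamma> by (simp add: sections_mult u_def P1_def)
  also have "finsum R v P2 = (f \<otimes>\<^bsub>F.Fun\<^esub> g) e"
    using e by (simp add: R_functions_def v_def P2_def)
  finally show "(outer \<alpha> f \<otimes>\<^bsub>Q.Sec\<^esub> outer \<beta> g) (\<gamma>, e) = outer (\<alpha> \<otimes>\<^bsub>P.Sec\<^esub> \<beta>) (f \<otimes>\<^bsub>F.Fun\<^esub> g) (\<gamma>, e)"
    using \<gamma> e by simp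
qed

lemma algebra_pair: "algebra_pair R P.Alg F.FAlg"
proof
  fix \<alpha> \<beta> \<delta> assume A: "\<alpha> \<in> carrier P.Alg" "\<beta> \<in> carrier P.Alg" "\<delta> \<in> carrier P.Alg"
  show "(\<alpha> \<oplus>\<^bsub>P.Alg\<^esub> \<beta>) \<otimes>\<^bsub>P.Alg\<^esub> \<delta> = \<alpha> \<otimes>\<^bsub>P.Alg\<^esub> \<delta> \<oplus>\<^bsub>P.Alg\<^esub> \<beta> \<otimes>\<^bsub>P.Alg\<^esub> \<delta>"
    unfolding P.Alg_simps by (intro P.conv_add_left P.Alg_Sec P.fibre_finite_Alg A)
  show "\<delta> \<otimes>\<^bsub>P.Alg\<^esub> (\<alpha> \<oplus>\<^bsub>P.Alg\<^esub> \<beta>) = \<delta> \<otimes>\<^bsub>P.Alg\<^esub> \<alpha> \<oplus>\<^bsub>P.Alg\<^esub> \<delta> \<otimes>\<^bsub>P.Alg\<^esub> \<beta>"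
    unfolding P.Alg_simps by (intro P.conv_add_right P.Alg_Sec P.fibre_finite_Alg A)
next
  fix f g h assume A: "f \<in> carrier F.FAlg" "g \<in> carrier F.FAlg" "h \<in> carrier F.FAlg"
  show "(f \<oplus>\<^bsub>F.FAlg\<^esub> g) \<otimes>\<^bsub>F.FAlg\<^esub> h = f \<otimes>\<^bsub>F.FAlg\<^esub> h \<oplus>\<^bsub>F.FAlg\<^esub> g \<otimes>\<^bsub>F.FAlg\<^esub> h"
    unfolding F.FAlg_simps by (rule F.mult_FAlg_add(1)[OF A])
  show "h \<otimes>\<^bsub>F.FAlg\<^esub> (f \<oplus>\<^bsub>F.FAlg\<^esub> g) = h \<otimes>\<^bsub>F.FAlg\<^esub> f \<oplus>\<^bsub>F.FAlg\<^esub> h \<otimes>\<^bsub>F.FAlg\<^esub> g"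
    unfolding F.FAlg_simps by (rule F.mult_FAlg_add(2)[OF A])
next
  fix r \<alpha> \<beta> assume A: "r \<in> carrier R" "\<alpha> \<in> carrier P.Alg" "\<beta> \<in> carrier P.Alg"
  note B = sym P.Alg_Sec[OF A(2)] P.Alg_Sec[OF A(3)] P.fibre_finite_Alg[OF A(2)] P.fibre_finite_Alg[OF A(3)] A(1)
  show "rscal P.Alg \<alpha> r \<otimes>\<^bsub>P.Alg\<^esub> \<beta> = rscal P.Alg (\<alpha> \<otimes>\<^bsub>P.Alg\<^esub> \<beta>) r \<and>
      \<alpha> \<otimes>\<^bsub>P.Alg\<^esub> rscal P.Alg \<beta> r = rscal P.Alg (\<alpha> \<otimes>\<^bsub>P.Alg\<^esub> \<beta>) r"
    unfolding P.Alg_simps using P.conv_symmetric(1,2)[OF B] by blast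
next
  fix r f g assume A: "r \<in> carrier R" "f \<in> carrier F.FAlg" "g \<in> carrier F.FAlg"
  show "lscal F.FAlg r f \<otimes>\<^bsub>F.FAlg\<^esub> g = lscal F.FAlg r (f \<otimes>\<^bsub>F.FAlg\<^esub> g) \<and>
      f \<otimes>\<^bsub>F.FAlg\<^esub> lscal F.FAlg r g = lscal F.FAlg r (f \<otimes>\<^bsub>F.FAlg\<^esub> g)"
    unfolding F.FAlg_simps using F.mult_FAlg_scal[OF cring A] by blast
qed (simp_all only: P.Alg_simps(4) F.FAlg_simps(4) P.conv_Alg F.mult_FAlg)

lemma is_T_mult:
  assumes T: "is_T T" and X: "X \<in> carrier TP.MN" and Y: "Y \<in> carrier TP.MN"
  shows "T (X \<otimes>\<^bsub>TP.MN\<^esub> Y) = T X \<otimes>\<^bsub>Q.Alg\<^esub> T Y"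
proof -
  interpret A: algebra_pair R P.Alg F.FAlg by (rule algebra_pair)
  have TQ: "T X \<in> carrier Q.Sec" if "X \<in> carrier TP.MN" for X
    using is_T_hom(1)[OF T] that Q.Alg_Sec by blast
  note fin = fibre_finite_is_T[OF T]
  have conv_0: "\<zero>\<^bsub>Q.Alg\<^esub> \<otimes>\<^bsub>Q.Alg\<^esub> T X = \<zero>\<^bsub>Q.Alg\<^esub>" "T X \<otimes>\<^bsub>Q.Alg\<^esub> \<zero>\<^bsub>Q.Alg\<^esub> = \<zero>\<^bsub>Q.Alg\<^esub>"
    if "X \<in> carrier TP.MN" for X
    using Q.conv_zero[OF TQ[OF that]] unfolding Q.Alg_simps by blast+
  have 1: "T (TP.pure \<alpha> f \<otimes>\<^bsub>TP.MN\<^esub> Y) = T (TP.pure \<alpha> f) \<otimes>\<^bsub>Q.Alg\<^esub> T Y"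
    if \<alpha>f: "\<alpha> \<in> carrier P.Alg" "f \<in> carrier F.FAlg" for \<alpha> f
    using Y
  proof (induction rule: TP.tensor_induct)
    case zero
    show ?case unfolding A.mult_zero(2)[OF TP.pure_closed[OF \<alpha>f]] is_T_zero[OF T] conv_0(2)[OF TP.pure_closed[OF \<alpha>f]] ..
  next
    case (pure \<beta> g)
    show ?case
      unfolding A.mult_pure[OF \<alpha>f pure] is_T_pure[OF T \<alpha>f] is_T_pure[OF T pure]
        is_T_pure[OF T A.multM_closed[OF \<alpha>f(1) pure(1)] A.multN_closed[OF \<alpha>f(2) pure(2)]]
      unfolding P.Alg_simps(4) F.FAlg_simps(4) Q.Alg_simps(4)
      by (rule outer_mult[OF \<alpha>f(1) pure(1) \<alpha>f(2) pure(2), symmetric])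
  next
    case (add Y Z)
    note p = TP.pure_closed[OF \<alpha>f]
    have distr: "T (TP.pure \<alpha> f) \<otimes>\<^bsub>Q.Alg\<^esub> (T Y \<oplus>\<^bsub>Q.Alg\<^esub> T Z) =
        T (TP.pure \<alpha> f) \<otimes>\<^bsub>Q.Alg\<^esub> T Y \<oplus>\<^bsub>Q.Alg\<^esub> T (TP.pure \<alpha> f) \<otimes>\<^bsub>Q.Alg\<^esub> T Z"
      unfolding Q.Alg_simps by (intro Q.conv_add_right TQ fin p add)
    show ?case
      unfolding A.mult_add(2)[OF add(1,2) p]
        is_T_hom(2)[OF T A.mult_closed[OF p add(1)] A.mult_closed[OF p add(2)]] is_T_hom(2)[OF T add(1,2)] add.IH
      by (rule distr[symmetric])
  qed
  show ?thesis
    using X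
  proof (induction rule: TP.tensor_induct)
    case zero
    show ?case unfolding A.mult_zero(1)[OF Y] is_T_zero[OF T] conv_0(1)[OF Y] ..
  next
    case (pure \<alpha> f)
    then show ?case by (rule 1)
  next
    case (add X Z)
    have distr: "(T X \<oplus>\<^bsub>Q.Alg\<^esub> T Z) \<otimes>\<^bsub>Q.Alg\<^esub> T Y = T X \<otimes>\<^bsub>Q.Alg\<^esub> T Y \<oplus>\<^bsub>Q.Alg\<^esub> T Z \<otimes>\<^bsub>Q.Alg\<^esub> T Y"
      unfolding Q.Alg_simps by (intro Q.conv_add_left TQ fin Y add)
    show ?case
      unfolding A.mult_add(1)[OF add(1,2) Y]
        is_T_hom(2)[OF T A.mult_closed[OF add(1) Y] A.mult_closed[OF add(2) Y]] is_T_hom(2)[OF T add(1,2)] add.IH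
      by (rule distr[symmetric])
  qed
qed

end

end

section \<open>Surjectivity\<close>

context continuous_bundle
begin

definition zero_outside :: "('g \<Rightarrow> 'l) \<Rightarrow> 'g set \<Rightarrow> 'g \<Rightarrow> 'l" where
  "zero_outside s D = (\<lambda>\<gamma>\<in>arrows \<Gamma>. if \<gamma> \<in> D then s \<gamma> else fib_zero \<pi> \<gamma>)"

lemma zero_outside_Sec: "s \<in> carrier Sec \<Longrightarrow> zero_outside s D \<in> carrier Sec"
  by (subst sections_simps(1)) (auto simp: zero_outside_def Sec_value)

lemma zero_outside_Un:
  assumes s: "s \<in> carrier Sec"
  shows "zero_outside s (D \<union> D') = (zero_outside s D \<oplus>\<^bsub>Sec\<^esub> zero_outside s D') \<oplus>\<^bsub>Sec\<^esub> (\<ominus>\<^bsub>Sec\<^esub> zero_outside s (D \<inter> D'))"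
proof -
  interpret S: bimodule R Sec by (rule bimodule_sections)
  note cl = zero_outside_Sec[OF s]
  have eq: "zero_outside s (D \<union> D') \<oplus>\<^bsub>Sec\<^esub> zero_outside s (D \<inter> D') = zero_outside s D \<oplus>\<^bsub>Sec\<^esub> zero_outside s D'"
    by (rule Sec_eqI[OF S.M.a_closed[OF cl cl] S.M.a_closed[OF cl cl]])
      (auto simp: zero_outside_def fib_rules Sec_value[OF s])
  have "(zero_outside s (D \<union> D') \<oplus>\<^bsub>Sec\<^esub> zero_outside s (D \<inter> D')) \<oplus>\<^bsub>Sec\<^esub> (\<ominus>\<^bsub>Sec\<^esub> zero_outside s (D \<inter> D')) = zero_outside s (D \<union> D')"
    by (simp only: S.M.a_assoc[OF cl cl S.M.a_inv_closed[OF cl]] S.M.r_neg[OF cl] S.M.r_zero[OF cl])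
  then show ?thesis by (simp only: eq)
qed

end

text \<open>Slices embed into the product. Thus two boxes that meet inside a Hausdorff set have sides whose
  unions are Hausdorff.\<close>

lemma Hausdorff_horizontal_slice:
  assumes Z: "Hausdorff_space (subtopology (prod_topology X Y) Z)" and y: "y \<in> topspace Y"
    and U: "U \<subseteq> topspace X" "\<And>u. u \<in> U \<Longrightarrow> (u, y) \<in> Z"
  shows "Hausdorff_space (subtopology X U)"
proof (rule Hausdorff_space_injective_preimage[OF Z])
  show "continuous_map (subtopology X U) (subtopology (prod_topology X Y) Z) (\<lambda>u. (u, y))"
    using U y by (auto simp: continuous_map_in_subtopology intro!: continuous_map_pairedI continuous_map_sub_id)
qed (auto simp: inj_on_def)

lemma Hausdorff_vertical_slice:
  assumes Z: "Hausdorff_space (subtopology (prod_topology X Y) Z)" and x: "x \<in> topspace X"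
    and U: "U \<subseteq> topspace Y" "\<And>u. u \<in> U \<Longrightarrow> (x, u) \<in> Z"
  shows "Hausdorff_space (subtopology Y U)"
proof (rule Hausdorff_space_injective_preimage[OF Z])
  show "continuous_map (subtopology Y U) (subtopology (prod_topology X Y) Z) (\<lambda>u. (x, u))"
    using U x by (auto simp: continuous_map_in_subtopology intro!: continuous_map_pairedI continuous_map_sub_id)
qed (auto simp: inj_on_def)

lemma compactin_Int_Hausdorff:
  assumes "Hausdorff_space (subtopology X (K \<union> L))" "compactin X K" "compactin X L"
  shows "compactin X (K \<inter> L)"
proof -
  have KL: "compactin (subtopology X (K \<union> L)) K" "compactin (subtopology X (K \<union> L)) L"
    using assms by (auto simp: compactin_subtopology)
  have "compactin (subtopology X (K \<union> L)) (K \<inter> L)"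
    by (rule compact_Int_closedin[OF KL(1) compactin_imp_closedin[OF assms(1) KL(2)]])
  then show ?thesis by (simp add: compactin_subtopology)
qed

context bundle_pair
begin

lemma indicator_CcF:
  assumes W: "F.Tr.open_Hausdorff W" "compactin (atop \<E>) W"
  shows "(\<lambda>e\<in>arrows \<E>. if e \<in> W then \<one>\<^bsub>R\<^esub> else \<zero>\<^bsub>R\<^esub>) \<in> F.CcF W" (is "?ind \<in> _")
proof -
  have Warr: "W \<subseteq> arrows \<E>" by (rule F.Tr.open_Hausdorff_arrows[OF W(1)])
  have "continuous_map (subtopology (atop \<E>) W) RT (\<lambda>_. \<one>\<^bsub>R\<^esub>)" by (simp add: P.R.topspace_RT)
  then have cont: "continuous_map (subtopology (atop \<E>) W) RT ?ind"
    by (rule continuous_map_eq) (use Warr in auto)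
  have "compactin (atop \<E>) (atop \<E> closure_of {e \<in> W. ?ind e \<noteq> \<zero>\<^bsub>R\<^esub>} \<inter> W)"
    using W Warr F.E.topspace_atop
    by (subst compactin_closure_in_Hausdorff_iff) (auto simp: F.Tr.open_Hausdorff_def)
  then have "compactin (subtopology (atop \<E>) W) (subtopology (atop \<E>) W closure_of {e \<in> W. ?ind e \<noteq> \<zero>\<^bsub>R\<^esub>})"
    by (subst closure_in_open_subspace) (auto simp: compactin_subtopology)
  then show ?thesis
    using cont Warr by (auto simp: Cc_functions_def R_functions_simps(1))
qed

text \<open>A section is pure on a box if it does not depend on the second variable there. The sides are
  compact open, so that \<open>\<alpha>\<close> and the indicator function of the second side, extended by zero, are
  compactly supported and have the section on the box as their product.\<close>

definition pure_box :: "('g \<times> 'e) set \<Rightarrow> ('g \<times> 'e \<Rightarrow> 'l \<times> 'e) \<Rightarrow> ('g \<times> 'e) set \<Rightarrow> bool" where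
  "pure_box Z s D \<longleftrightarrow> (\<exists>U W \<alpha>. D = U \<times> W \<and> D \<subseteq> Z \<and>
     P.open_Hausdorff U \<and> compactin (atop \<Gamma>) U \<and> F.Tr.open_Hausdorff W \<and> compactin (atop \<E>) W \<and>
     continuous_map (subtopology (atop \<Gamma>) U) (atop \<Lambda>) \<alpha> \<and> (\<forall>\<gamma>\<in>U. proj \<pi> (\<alpha> \<gamma>) = \<gamma>) \<and>
     (\<forall>\<gamma>\<in>U. \<forall>e\<in>W. s (\<gamma>, e) = (\<alpha> \<gamma>, e)))"

lemma zero_outside_pure_box:
  assumes D: "pure_box Z s D"
  obtains \<alpha> f where "\<alpha> \<in> carrier P.Alg" "f \<in> carrier F.FAlg" "Q.zero_outside s D = outer \<alpha> f"
proof -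
  obtain U W \<alpha> where b: "D = U \<times> W" "P.open_Hausdorff U" "compactin (atop \<Gamma>) U"
    "F.Tr.open_Hausdorff W" "compactin (atop \<E>) W"
    "continuous_map (subtopology (atop \<Gamma>) U) (atop \<Lambda>) \<alpha>" "\<forall>\<gamma>\<in>U. proj \<pi> (\<alpha> \<gamma>) = \<gamma>"
    "\<forall>\<gamma>\<in>U. \<forall>e\<in>W. s (\<gamma>, e) = (\<alpha> \<gamma>, e)"
    using D unfolding pure_box_def by blast
  have Uarr: "U \<subseteq> arrows \<Gamma>" and Warr: "W \<subseteq> arrows \<E>"
    using P.open_Hausdorff_arrows F.Tr.open_Hausdorff_arrows b by auto
  define \<alpha>' where "\<alpha>' = (\<lambda>\<gamma>\<in>arrows \<Gamma>. if \<gamma> \<in> U then \<alpha> \<gamma> else fib_zero \<pi> \<gamma>)"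
  define ind where "ind = (\<lambda>e\<in>arrows \<E>. if e \<in> W then \<one>\<^bsub>R\<^esub> else \<zero>\<^bsub>R\<^esub>)"
  have \<alpha>\<Lambda>: "\<alpha> \<gamma> \<in> arrows \<Lambda>" if "\<gamma> \<in> U" for \<gamma>
    using continuous_map_image_subset_topspace[OF b(6)] that Uarr
    by (auto simp: P.\<Lambda>.topspace_atop P.\<Gamma>.topspace_atop)
  have "\<alpha>' \<in> carrier P.Sec"
    by (subst sections_simps(1)) (use \<alpha>\<Lambda> b(7) in \<open>auto simp: \<alpha>'_def\<close>)
  moreover have "continuous_map (subtopology (atop \<Gamma>) U) (atop \<Lambda>) \<alpha>'"
    by (rule continuous_map_eq[OF b(6)]) (use Uarr in \<open>auto simp: \<alpha>'_def\<close>)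
  ultimately have "\<alpha>' \<in> P.Cc U"
    unfolding P.Cc_iff[OF b(2)] using b(3) by (auto simp: \<alpha>'_def)
  then have \<alpha>': "\<alpha>' \<in> carrier P.Alg" by (rule P.Cc_Alg[OF b(2)])
  have ind: "ind \<in> carrier F.FAlg"
    unfolding ind_def by (rule F.CcF_FAlg[OF b(4) indicator_CcF[OF b(4,5)]])
  have "Q.zero_outside s D = outer \<alpha>' ind"
    unfolding Q.zero_outside_def outer_def
    by (rule ext) (use b(7,8) \<alpha>\<Lambda> in \<open>auto simp: restrict_def b(1) \<alpha>'_def ind_def P.fib_rules split: if_splits\<close>)
  then show thesis using that \<alpha>' ind by blast
qed

text \<open>The sides of the two boxes need not lie in a common Hausdorff set. But if the boxes meet, then
  the union of the first sides, and that of the second ones, embeds into \<open>Z\<close> as a slice through a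
  common point. This makes the intersections of the sides compact.\<close>

lemma pure_box_Int:
  assumes Z: "Q.open_Hausdorff Z" and D: "pure_box Z s D" "pure_box Z s D'" and ne: "D \<inter> D' \<noteq> {}"
  shows "pure_box Z s (D \<inter> D')"
proof -
  obtain U W \<alpha> where b: "D = U \<times> W" "D \<subseteq> Z" "P.open_Hausdorff U" "compactin (atop \<Gamma>) U"
    "F.Tr.open_Hausdorff W" "compactin (atop \<E>) W"
    "continuous_map (subtopology (atop \<Gamma>) U) (atop \<Lambda>) \<alpha>" "\<forall>\<gamma>\<in>U. proj \<pi> (\<alpha> \<gamma>) = \<gamma>"
    "\<forall>\<gamma>\<in>U. \<forall>e\<in>W. s (\<gamma>, e) = (\<alpha> \<gamma>, e)"
    using D(1) unfolding pure_box_def by blast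
  obtain U' W' where b': "D' = U' \<times> W'" "D' \<subseteq> Z" "P.open_Hausdorff U'" "compactin (atop \<Gamma>) U'"
    "F.Tr.open_Hausdorff W'" "compactin (atop \<E>) W'"
    using D(2) unfolding pure_box_def by blast
  have arr: "U \<subseteq> arrows \<Gamma>" "U' \<subseteq> arrows \<Gamma>" "W \<subseteq> arrows \<E>" "W' \<subseteq> arrows \<E>"
    using P.open_Hausdorff_arrows F.Tr.open_Hausdorff_arrows b b' by auto
  obtain \<gamma> e where p: "\<gamma> \<in> U \<inter> U'" "e \<in> W \<inter> W'" using ne b(1) b'(1) by auto
  have ZH: "Hausdorff_space (subtopology (prod_topology (atop \<Gamma>) (atop \<E>)) Z)"
    using Z by (simp add: Q.open_Hausdorff_def)
  have "Hausdorff_space (subtopology (atop \<Gamma>) (U \<union> U'))"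
    by (rule Hausdorff_horizontal_slice[OF ZH, of e])
      (use b b' arr p in \<open>auto simp: P.\<Gamma>.topspace_atop F.E.topspace_atop\<close>)
  then have cU: "compactin (atop \<Gamma>) (U \<inter> U')" by (rule compactin_Int_Hausdorff[OF _ b(4) b'(4)])
  have "Hausdorff_space (subtopology (atop \<E>) (W \<union> W'))"
    by (rule Hausdorff_vertical_slice[OF ZH, of \<gamma>])
      (use b b' arr p in \<open>auto simp: P.\<Gamma>.topspace_atop F.E.topspace_atop\<close>)
  then have cW: "compactin (atop \<E>) (W \<inter> W')" by (rule compactin_Int_Hausdorff[OF _ b(6) b'(6)])
  have oU: "P.open_Hausdorff (U \<inter> U')"
    by (rule P.open_Hausdorff_mono[OF b(3)]) (use b(3) b'(3) in \<open>auto simp: P.open_Hausdorff_def\<close>)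
  have oW: "F.Tr.open_Hausdorff (W \<inter> W')"
    by (rule F.Tr.open_Hausdorff_mono[OF b(5)]) (use b(5) b'(5) in \<open>auto simp: F.Tr.open_Hausdorff_def\<close>)
  have "continuous_map (subtopology (atop \<Gamma>) (U \<inter> U')) (atop \<Lambda>) \<alpha>"
    by (rule continuous_map_from_subtopology_mono[OF b(7)]) auto
  moreover have "D \<inter> D' = (U \<inter> U') \<times> (W \<inter> W')" using b(1) b'(1) by auto
  ultimately show ?thesis
    unfolding pure_box_def using cU cW oU oW b(2,8,9)
    by (intro exI[of _ "U \<inter> U'"] exI[of _ "W \<inter> W'"] exI[of _ \<alpha>]) auto
qed

context
  fixes T assumes T: "is_T T"
begin

lemma range_T:
  shows "\<zero>\<^bsub>Q.Sec\<^esub> \<in> T ` carrier TP.MN"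
    and "s \<in> T ` carrier TP.MN \<Longrightarrow> t \<in> T ` carrier TP.MN \<Longrightarrow> s \<oplus>\<^bsub>Q.Sec\<^esub> t \<in> T ` carrier TP.MN"
    and "s \<in> T ` carrier TP.MN \<Longrightarrow> \<ominus>\<^bsub>Q.Sec\<^esub> s \<in> T ` carrier TP.MN"
    and "\<alpha> \<in> carrier P.Alg \<Longrightarrow> f \<in> carrier F.FAlg \<Longrightarrow> outer \<alpha> f \<in> T ` carrier TP.MN"
proof -
  interpret QA: bimodule R Q.Alg by (rule Q.bimodule_Alg)
  interpret QS: bimodule R Q.Sec by (rule Q.bimodule_sections)
  show "\<zero>\<^bsub>Q.Sec\<^esub> \<in> T ` carrier TP.MN"
    using is_T_zero[OF T] TP.T.zero_closed unfolding Q.Alg_simps(3) by (metis imageI)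
  show "s \<oplus>\<^bsub>Q.Sec\<^esub> t \<in> T ` carrier TP.MN" if st: "s \<in> T ` carrier TP.MN" "t \<in> T ` carrier TP.MN" for s t
  proof -
    obtain X Y where "X \<in> carrier TP.MN" "Y \<in> carrier TP.MN" "s = T X" "t = T Y" using st by blast
    then show ?thesis
      using is_T_hom(2)[OF T, of X Y] TP.T.a_closed[of X Y] unfolding Q.Alg_simps(2) by (metis imageI)
  qed
  show "\<ominus>\<^bsub>Q.Sec\<^esub> s \<in> T ` carrier TP.MN" if s: "s \<in> T ` carrier TP.MN"
  proof -
    obtain X where X: "X \<in> carrier TP.MN" "s = T X" using s by blast
    have TX: "T X \<in> carrier Q.Sec" "T (\<ominus>\<^bsub>TP.MN\<^esub> X) \<in> carrier Q.Sec"
      using is_T_hom(1)[OF T] X Q.Alg_Sec TP.T.a_inv_closed by blast+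
    have "T (\<ominus>\<^bsub>TP.MN\<^esub> X) \<oplus>\<^bsub>Q.Sec\<^esub> T X = \<zero>\<^bsub>Q.Sec\<^esub>"
      using is_T_hom(2)[OF T TP.T.a_inv_closed[OF X(1)] X(1)] is_T_zero[OF T] TP.T.l_neg[OF X(1)]
      unfolding Q.Alg_simps by metis
    then have "\<ominus>\<^bsub>Q.Sec\<^esub> s = T (\<ominus>\<^bsub>TP.MN\<^esub> X)" using TX X by (metis QS.M.minus_equality)
    then show ?thesis using X(1) TP.T.a_inv_closed by blast
  qed
  show "outer \<alpha> f \<in> T ` carrier TP.MN" if "\<alpha> \<in> carrier P.Alg" "f \<in> carrier F.FAlg"
    using is_T_pure[OF T that] TP.pure_closed[OF that] by (metis imageI)
qed

text \<open>Inclusion and exclusion, by induction on the number of boxes: when \<open>D\<close> is removed from the family,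
  its intersections with the remaining boxes form a family that is no larger than the remaining one.\<close>

lemma zero_outside_Union_pure_boxes:
  assumes Z: "Q.open_Hausdorff Z" and s: "s \<in> carrier Q.Sec"
    and "finite \<D>" "\<forall>D\<in>\<D>. D = {} \<or> pure_box Z s D"
  shows "Q.zero_outside s (\<Union>\<D>) \<in> T ` carrier TP.MN"
  using assms(3,4)
proof (induction "card \<D>" arbitrary: \<D> rule: less_induct)
  case less
  have empty: "Q.zero_outside s {} \<in> T ` carrier TP.MN"
  proof -
    have "Q.zero_outside s {} = \<zero>\<^bsub>Q.Sec\<^esub>" by (simp add: Q.zero_outside_def)
    then show ?thesis using range_T(1) by (simp only:)
  qed
  show ?case
  proof (cases "\<D> = {}")
    case True
    then show ?thesis using empty by simp
  next
    case False
    then obtain D where D: "D \<in> \<D>" by blast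
    define \<F> where "\<F> = \<D> - {D}"
    have \<D>: "\<D> = insert D \<F>" "D \<notin> \<F>" using D by (auto simp: \<F>_def)
    have fin: "finite \<F>" using less(2) by (simp add: \<F>_def)
    have card: "card \<F> < card \<D>" using fin \<D> by simp
    have 1: "Q.zero_outside s D \<in> T ` carrier TP.MN"
    proof (cases "D = {}")
      case False
      then have "pure_box Z s D" using less(3) D by blast
      then show ?thesis using range_T(4) by (metis zero_outside_pure_box)
    qed (use empty in simp)
    have 2: "Q.zero_outside s (\<Union>\<F>) \<in> T ` carrier TP.MN"
      by (rule less(1)[OF card fin]) (use less(3) \<F>_def in blast)
    have 3: "Q.zero_outside s (\<Union>((\<lambda>E. D \<inter> E) ` \<F>)) \<in> T ` carrier TP.MN"
    proof (rule less(1))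
      show "card ((\<lambda>E. D \<inter> E) ` \<F>) < card \<D>" using card_image_le[OF fin] card by (rule le_less_trans)
      show "\<forall>E\<in>(\<lambda>E. D \<inter> E) ` \<F>. E = {} \<or> pure_box Z s E"
      proof clarify
        fix E assume E: "E \<in> \<F>" "\<not> pure_box Z s (D \<inter> E)"
        then have "\<not> (pure_box Z s D \<and> pure_box Z s E)" if "D \<inter> E \<noteq> {}"
          using pure_box_Int[OF Z _ _ that] by blast
        then show "D \<inter> E = {}" using less(3) D E(1) by (auto simp: \<F>_def)
      qed
    qed (use fin in simp)
    have "\<Union>\<D> = D \<union> \<Union>\<F>" "\<Union>((\<lambda>E. D \<inter> E) ` \<F>) = D \<inter> \<Union>\<F>" using \<D> by auto
    then show ?thesis
      using Q.zero_outside_Un[OF s, of D "\<Union>\<F>"] range_T(2)[OF range_T(2)[OF 1 2] range_T(3)[OF 3]] by (simp only:)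
  qed
qed

text \<open>Since the bundle projection is a local homeomorphism, a section of the product bundle is
  locally the composite of the projection to the first variable and a local inverse of the bundle
  projection.\<close>

lemma pure_box_nbhd:
  assumes amp: "ample_semigroupoid \<Gamma>" "ample_semigroupoid \<E>"
    and lh: "local_homeomorphism (atop \<Lambda>) (atop \<Gamma>) (proj \<pi>)"
    and Z: "Q.open_Hausdorff Z" and s: "s \<in> Q.Cc Z" and p: "p \<in> Z"
  shows "\<exists>D. openin (atop (prod_sgpd \<Gamma> \<E>)) D \<and> p \<in> D \<and> pure_box Z s D"
proof -
  interpret A1: ample_semigroupoid \<Gamma> by fact
  interpret A2: ample_semigroupoid \<E> by fact
  note sSec = Q.Cc_Sec[OF s]
  obtain \<gamma> e where pe: "p = (\<gamma>, e)" by (cases p)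
  have Zarr: "Z \<subseteq> arrows \<Gamma> \<times> arrows \<E>" using Q.open_Hausdorff_arrows[OF Z] by simp
  have s_val: "fst (s (\<gamma>', e')) \<in> arrows \<Lambda>" "proj \<pi> (fst (s (\<gamma>', e'))) = \<gamma>'" "snd (s (\<gamma>', e')) = e'"
    if "(\<gamma>', e') \<in> Z" for \<gamma>' e'
    using Q.Sec_value[OF sSec, of "(\<gamma>', e')"] that Zarr
    by (cases "s (\<gamma>', e')"; auto)+
  have "fst (s (\<gamma>, e)) \<in> topspace (atop \<Lambda>)" using s_val(1) p pe by (simp add: P.\<Lambda>.topspace_atop)
  then obtain Y where Y: "openin (atop \<Lambda>) Y" "fst (s (\<gamma>, e)) \<in> Y"
      "homeomorphic_map (subtopology (atop \<Lambda>) Y) (subtopology (atop \<Gamma>) (proj \<pi> ` Y)) (proj \<pi>)"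
    using lh unfolding local_homeomorphism_def by blast
  have "Y \<subseteq> topspace (atop \<Lambda>)" using Y(1) openin_subset by blast
  then have inj: "inj_on (proj \<pi>) Y" using Y(3) by (simp add: homeomorphic_map_def Int_absorb1)
  obtain t where t: "continuous_map (subtopology (atop \<Gamma>) (proj \<pi> ` Y)) (subtopology (atop \<Lambda>) Y) t"
    and tY: "\<And>x. x \<in> Y \<Longrightarrow> t (proj \<pi> x) = x"
    by (rule local_homeomorphism_local_section[OF lh P.continuous_proj Y(1) inj]) blast
  have Zop: "openin (prod_topology (atop \<Gamma>) (atop \<E>)) Z" using Z by (simp add: Q.open_Hausdorff_def)
  have "continuous_map (subtopology (prod_topology (atop \<Gamma>) (atop \<E>)) Z) (atop \<Lambda>) (\<lambda>p. fst (s p))"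
    using continuous_map_fstI[OF Q.Cc_cont[OF s, simplified]] .
  from openin_continuous_map_preimage[OF this Y(1)]
  have "openin (subtopology (prod_topology (atop \<Gamma>) (atop \<E>)) Z) {p \<in> Z. fst (s p) \<in> Y}"
    by (rule back_subst[of "openin _"]) (use openin_subset[OF Zop] in auto)
  then have N: "openin (prod_topology (atop \<Gamma>) (atop \<E>)) {p \<in> Z. fst (s p) \<in> Y}"
    using Zop openin_open_subtopology by blast
  have "(\<gamma>, e) \<in> {p \<in> Z. fst (s p) \<in> Y}" using p pe Y(2) by simp
  with N obtain U0 W0 where UW0: "openin (atop \<Gamma>) U0" "openin (atop \<E>) W0" "\<gamma> \<in> U0" "e \<in> W0"
    "U0 \<times> W0 \<subseteq> {p \<in> Z. fst (s p) \<in> Y}"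
    unfolding openin_prod_topology_alt by meson
  obtain U where U: "openin (atop \<Gamma>) U" "compactin (atop \<Gamma>) U" "bisection \<Gamma> U" "\<gamma> \<in> U" "U \<subseteq> U0"
    using A1.compact_open_bisections[OF UW0(1,3)] by blast
  obtain W where W: "openin (atop \<E>) W" "compactin (atop \<E>) W" "bisection \<E> W" "e \<in> W" "W \<subseteq> W0"
    using A2.compact_open_bisections[OF UW0(2,4)] by blast
  have UW: "(\<gamma>', e') \<in> Z" "fst (s (\<gamma>', e')) \<in> Y" if "\<gamma>' \<in> U" "e' \<in> W" for \<gamma>' e'
    using UW0(5) U(5) W(5) that by blast+
  have st: "s (\<gamma>', e') = (t \<gamma>', e')" if "\<gamma>' \<in> U" "e' \<in> W" for \<gamma>' e'
    using tY[OF UW(2)[OF that]] s_val[OF UW(1)[OF that]] by (metis prod.collapse)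
  have UY: "U \<subseteq> proj \<pi> ` Y"
  proof
    fix \<gamma>' assume "\<gamma>' \<in> U"
    then show "\<gamma>' \<in> proj \<pi> ` Y" using UW[OF _ W(4)] s_val(2) by (metis imageI)
  qed
  have "continuous_map (subtopology (atop \<Gamma>) U) (atop \<Lambda>) t"
    using t continuous_map_from_subtopology_mono[OF _ UY] by (auto simp: continuous_map_in_subtopology)
  moreover have "\<forall>\<gamma>'\<in>U. proj \<pi> (t \<gamma>') = \<gamma>'" using UY tY by auto
  moreover have "P.open_Hausdorff U" "F.Tr.open_Hausdorff W"
    using P.open_bisection_Hausdorff[of U] F.Tr.open_bisection_Hausdorff[of W] U W
    by (auto simp: P.open_bisection_def F.Tr.open_bisection_def)
  ultimately have "pure_box Z s (U \<times> W)"
    unfolding pure_box_def using U(2) W(2) UW(1) st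
    by (intro exI[of _ U] exI[of _ W] exI[of _ t]) auto
  moreover have "openin (atop (prod_sgpd \<Gamma> \<E>)) (U \<times> W)"
    using U(1) W(1) by (simp add: openin_prod_Times_iff)
  ultimately show ?thesis using U(4) W(4) pe by blast
qed

lemma T_surjective:
  assumes amp: "ample_semigroupoid \<Gamma>" "ample_semigroupoid \<E>"
    and lh: "local_homeomorphism (atop \<Lambda>) (atop \<Gamma>) (proj \<pi>)"
  shows "T ` carrier TP.MN = carrier Q.Alg"
proof
  show "T ` carrier TP.MN \<subseteq> carrier Q.Alg" using is_T_hom(1)[OF T] by auto
  show "carrier Q.Alg \<subseteq> T ` carrier TP.MN"
  proof
    fix s assume "s \<in> carrier Q.Alg"
    then show "s \<in> T ` carrier TP.MN"
    proof (induction rule: Q.Alg_induct)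
      case zero
      show ?case by (rule range_T(1))
    next
      case (Cc s Z)
      obtain K where K: "compactin (atop (prod_sgpd \<Gamma> \<E>)) K" "K \<subseteq> Z"
        "\<forall>p\<in>arrows (prod_sgpd \<Gamma> \<E>) - K. s p = fib_zero (prod_bundle \<pi>) p"
        using Cc(2) unfolding Q.Cc_iff[OF Cc(1)] by blast
      have "\<forall>p\<in>K. \<exists>D. openin (atop (prod_sgpd \<Gamma> \<E>)) D \<and> p \<in> D \<and> pure_box Z s D"
        using pure_box_nbhd[OF amp lh Cc] K(2) by blast
      then obtain \<D> where \<D>: "finite \<D>" "\<forall>D\<in>\<D>. openin (atop (prod_sgpd \<Gamma> \<E>)) D \<and> pure_box Z s D"
          "K \<subseteq> \<Union>\<D>"
        by (rule compactin_finite_subcover[OF K(1)])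
      have "Q.zero_outside s (\<Union>\<D>) = s"
      proof (rule Q.Sec_eqI[OF Q.zero_outside_Sec[OF Q.Cc_Sec[OF Cc(2)]] Q.Cc_Sec[OF Cc(2)]])
        fix p assume p: "p \<in> arrows (prod_sgpd \<Gamma> \<E>)"
        then have "s p = fib_zero (prod_bundle \<pi>) p" if "p \<notin> \<Union>\<D>" using K(3) \<D>(3) that by blast
        then show "Q.zero_outside s (\<Union>\<D>) p = s p"
          using p by (auto simp: Q.zero_outside_def simp del: prod_bundle_simps prod_sgpd_simps Union_iff)
      qed
      moreover have "Q.zero_outside s (\<Union>\<D>) \<in> T ` carrier TP.MN"
        by (rule zero_outside_Union_pure_boxes[OF Cc(1) Q.Cc_Sec[OF Cc(2)] \<D>(1)]) (use \<D>(2) in blast)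
      ultimately show ?case by simp
    next
      case (add s t)
      then show ?case by (intro range_T(2))
    qed
  qed
qed

end

end

section \<open>Injectivity\<close>

context bundle_pair
begin

text \<open>The kernel consists of the sums of pure tensors for which all the sums on the right-hand side
  vanish.\<close>

lemma is_T_value:
  assumes T: "is_T T" and m: "m \<in> {..<k::nat} \<rightarrow> carrier P.Alg" and n: "n \<in> {..<k} \<rightarrow> carrier F.FAlg"
    and \<gamma>: "\<gamma> \<in> arrows \<Gamma>" and e: "e \<in> arrows \<E>"
  shows "fst (T (finsum TP.MN (\<lambda>i. TP.pure (m i) (n i)) {..<k}) (\<gamma>, e)) =
    finsum (fibre \<Lambda> \<pi> \<gamma>) (\<lambda>i. fib_rscal \<pi> (m i \<gamma>) (n i e)) {..<k}"
proof -
  have val: "T X (\<gamma>, e) \<in> carrier (fibre (prod_sgpd \<Lambda> \<E>) (prod_bundle \<pi>) (\<gamma>, e))" if "X \<in> carrier TP.MN" for X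
    using Q.Sec_value[of "T X" "(\<gamma>, e)"] is_T_hom(1)[OF T] that Q.Alg_Sec \<gamma> e by (simp, blast)
  interpret H: abelian_group "fibre \<Lambda> \<pi> \<gamma>" by (rule P.fib_abelian[OF \<gamma>])
  have "fst (T (finsum TP.MN (\<lambda>i. TP.pure (m i) (n i)) {..<k}) (\<gamma>, e)) =
      finsum (fibre \<Lambda> \<pi> \<gamma>) (\<lambda>i. fst (T (TP.pure (m i) (n i)) (\<gamma>, e))) {..<k}"
  proof (rule additive_finsum[OF TP.T.abelian_group_axioms H.abelian_group_axioms,
        of "\<lambda>X. fst (T X (\<gamma>, e))"])
    show "(\<lambda>X. fst (T X (\<gamma>, e))) \<in> carrier TP.MN \<rightarrow> carrier (fibre \<Lambda> \<pi> \<gamma>)"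
    proof
      fix X assume "X \<in> carrier TP.MN"
      from val[OF this] show "fst (T X (\<gamma>, e)) \<in> carrier (fibre \<Lambda> \<pi> \<gamma>)" by (cases "T X (\<gamma>, e)") simp
    qed
    show "fst (T (X \<oplus>\<^bsub>TP.MN\<^esub> Y) (\<gamma>, e)) = fst (T X (\<gamma>, e)) \<oplus>\<^bsub>fibre \<Lambda> \<pi> \<gamma>\<^esub> fst (T Y (\<gamma>, e))"
      if "X \<in> carrier TP.MN" "Y \<in> carrier TP.MN" for X Y
      using \<gamma> e by (cases "T X (\<gamma>, e)"; cases "T Y (\<gamma>, e)") (simp add: is_T_hom(2)[OF T that])
    show "(\<lambda>i. TP.pure (m i) (n i)) \<in> {..<k} \<rightarrow> carrier TP.MN" using m n by (auto simp: Pi_iff)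
  qed
  also have "\<dots> = finsum (fibre \<Lambda> \<pi> \<gamma>) (\<lambda>i. fib_rscal \<pi> (m i \<gamma>) (n i e)) {..<k}"
  proof (rule H.finsum_cong'[OF refl])
    show "(\<lambda>i. fib_rscal \<pi> (m i \<gamma>) (n i e)) \<in> {..<k} \<rightarrow> carrier (fibre \<Lambda> \<pi> \<gamma>)"
    proof
      fix i assume i: "i \<in> {..<k}"
      have "m i \<in> carrier P.Sec" "n i \<in> carrier F.Fun"
        using m n i P.Alg_Sec F.FAlg_Fun by blast+
      then show "fib_rscal \<pi> (m i \<gamma>) (n i e) \<in> carrier (fibre \<Lambda> \<pi> \<gamma>)"
        using \<gamma> e by (simp add: P.fib_rules P.Sec_value Fun_value)
    qed
    show "fst (T (TP.pure (m i) (n i)) (\<gamma>, e)) = fib_rscal \<pi> (m i \<gamma>) (n i e)" if "i \<in> {..<k}" for i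
      using m n that \<gamma> e by (simp add: Pi_iff is_T_pure[OF T])
  qed
  finally show ?thesis .
qed

lemma is_T_injI:
  assumes T: "is_T T"
    and ker: "\<And>(k::nat) m n. m \<in> {..<k} \<rightarrow> carrier P.Alg \<Longrightarrow> n \<in> {..<k} \<rightarrow> carrier F.FAlg \<Longrightarrow>
      T (finsum TP.MN (\<lambda>i. TP.pure (m i) (n i)) {..<k}) = \<zero>\<^bsub>Q.Alg\<^esub> \<Longrightarrow>
      finsum TP.MN (\<lambda>i. TP.pure (m i) (n i)) {..<k} = \<zero>\<^bsub>TP.MN\<^esub>"
  shows "inj_on T (carrier TP.MN)"
proof (rule inj_onI)
  interpret QA: bimodule R Q.Alg by (rule Q.bimodule_Alg)
  have kernel: "X = \<zero>\<^bsub>TP.MN\<^esub>" if X: "X \<in> carrier TP.MN" "T X = \<zero>\<^bsub>Q.Alg\<^esub>" for X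
  proof -
    obtain k :: nat and m n where "m \<in> {..<k} \<rightarrow> carrier P.Alg" "n \<in> {..<k} \<rightarrow> carrier F.FAlg"
      "X = finsum TP.MN (\<lambda>i. TP.pure (m i) (n i)) {..<k}"
      using TP.tensor_finite_sum[OF X(1)] by blast
    then show ?thesis using ker[of m k n] X(2) by blast
  qed
  fix X Y assume XY: "X \<in> carrier TP.MN" "Y \<in> carrier TP.MN" "T X = T Y"
  have TXY: "T X \<in> carrier Q.Alg" "T Y \<in> carrier Q.Alg" using is_T_hom(1)[OF T] XY by blast+
  have "T (\<ominus>\<^bsub>TP.MN\<^esub> Y) = \<ominus>\<^bsub>Q.Alg\<^esub> T Y"
    by (rule additive_neg[OF TP.T.abelian_group_axioms QA.M.abelian_group_axioms])
      (use is_T_hom[OF T] XY(2) in auto)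
  then have "T (X \<oplus>\<^bsub>TP.MN\<^esub> \<ominus>\<^bsub>TP.MN\<^esub> Y) = \<zero>\<^bsub>Q.Alg\<^esub>"
    using is_T_hom(2)[OF T XY(1) TP.T.a_inv_closed[OF XY(2)]] XY(3) QA.M.r_neg[OF TXY(2)] by metis
  then have "X \<oplus>\<^bsub>TP.MN\<^esub> \<ominus>\<^bsub>TP.MN\<^esub> Y = \<zero>\<^bsub>TP.MN\<^esub>"
    using XY by (intro kernel) auto
  then show "X = Y" using XY by (metis TP.T.a_inv_closed TP.T.minus_equality TP.T.minus_minus TP.T.a_comm)
qed

lemma finsum_Alg_value:
  assumes "h \<in> I \<rightarrow> carrier P.Alg" "\<gamma> \<in> arrows \<Gamma>"
  shows "finsum P.Alg h I \<gamma> = finsum (fibre \<Lambda> \<pi> \<gamma>) (\<lambda>i. h i \<gamma>) I"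
proof (rule additive_finsum[of P.Alg _ "\<lambda>\<alpha>. \<alpha> \<gamma>"])
  show "abelian_group P.Alg" using bimodule.axioms(2)[OF P.bimodule_Alg] .
  show "abelian_group (fibre \<Lambda> \<pi> \<gamma>)" by (rule P.fib_abelian[OF assms(2)])
qed (use assms P.Sec_value[OF P.Alg_Sec] in auto)

lemma finsum_FAlg_value:
  assumes "h \<in> I \<rightarrow> carrier F.FAlg" "e \<in> arrows \<E>"
  shows "finsum F.FAlg h I e = finsum R (\<lambda>i. h i e) I"
proof (rule additive_finsum[of F.FAlg _ "\<lambda>f. f e"])
  show "abelian_group F.FAlg" using bimodule.axioms(2)[OF F.bimodule_FAlg] .
  show "abelian_group R" by (rule P.R.abelian_group_axioms)
qed (use assms Fun_value[OF F.FAlg_Fun] in auto)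

text \<open>If \<open>n\<^sub>k\<close> has an invertible value at \<open>e\<close>, then the relation at \<open>e\<close> says that \<open>m\<^sub>k\<close> is a
  combination of the other \<open>m\<^sub>i\<close>. Substitution into the last summand turns the sum into one of \<open>k\<close> pure
  tensors, with \<open>n\<^sub>i\<close> replaced by \<open>n\<^sub>i - c\<^sub>i n\<^sub>k\<close>.\<close>

lemma T_injective_field:
  assumes T: "is_T T" and "field R"
  shows "inj_on T (carrier TP.MN)"
proof (rule is_T_injI[OF T])
  interpret K: field R by fact
  fix k :: nat and m n
  assume "m \<in> {..<k} \<rightarrow> carrier P.Alg" "n \<in> {..<k} \<rightarrow> carrier F.FAlg"
    "T (finsum TP.MN (\<lambda>i. TP.pure (m i) (n i)) {..<k}) = \<zero>\<^bsub>Q.Alg\<^esub>"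
  then show "finsum TP.MN (\<lambda>i. TP.pure (m i) (n i)) {..<k} = \<zero>\<^bsub>TP.MN\<^esub>"
  proof (induction k arbitrary: n)
    case 0
    then show ?case by simp
  next
    case (Suc k)
    have mk: "m i \<in> carrier P.Alg" and nk: "n i \<in> carrier F.FAlg" if "i < Suc k" for i
      using Suc.prems(1,2) that by auto
    have drop: "finsum TP.MN (\<lambda>i. TP.pure (m i) (n' i)) {..<Suc k} = finsum TP.MN (\<lambda>i. TP.pure (m i) (n' i)) {..<k}"
      if n': "n' \<in> {..<Suc k} \<rightarrow> carrier F.FAlg" and n'k: "n' k = \<zero>\<^bsub>F.FAlg\<^esub>" for n'
    proof -
      have cl: "TP.pure (m i) (n' i) \<in> carrier TP.MN" if "i < Suc k" for i
        using TP.pure_closed[OF mk[OF that]] n' that by blast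
      have "finsum TP.MN (\<lambda>i. TP.pure (m i) (n' i)) {..<Suc k} =
          TP.pure (m k) (n' k) \<oplus>\<^bsub>TP.MN\<^esub> finsum TP.MN (\<lambda>i. TP.pure (m i) (n' i)) {..<k}"
        unfolding lessThan_Suc by (rule TP.T.finsum_insert) (use cl in auto)
      also have "TP.pure (m k) (n' k) = \<zero>\<^bsub>TP.MN\<^esub>"
        unfolding n'k by (rule TP.pure_zero_right[OF mk[OF lessI]])
      also have "\<zero>\<^bsub>TP.MN\<^esub> \<oplus>\<^bsub>TP.MN\<^esub> finsum TP.MN (\<lambda>i. TP.pure (m i) (n' i)) {..<k} =
          finsum TP.MN (\<lambda>i. TP.pure (m i) (n' i)) {..<k}"
        by (rule TP.T.l_zero, rule TP.T.finsum_closed) (use cl in auto)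
      finally show ?thesis .
    qed
    show ?case
    proof (cases "\<forall>e\<in>arrows \<E>. n k e = \<zero>\<^bsub>R\<^esub>")
      case True
      have "n k = \<zero>\<^bsub>F.FAlg\<^esub>"
      proof (rule PiE_ext)
        show "n k \<in> arrows \<E> \<rightarrow>\<^sub>E carrier R" "\<zero>\<^bsub>F.FAlg\<^esub> \<in> arrows \<E> \<rightarrow>\<^sub>E carrier R"
          using F.FAlg_Fun[OF nk[of k]] F.FAlg_Fun[OF TP.N.M.zero_closed] by (simp_all only: R_functions_simps(1) lessI)
      qed (use True in simp)
      note eq = drop[OF Suc.prems(2) this]
      show ?thesis unfolding eq
        by (rule Suc.IH) (use Suc.prems in \<open>auto simp: eq\<close>)
    next
      case False
      then obtain e where e: "e \<in> arrows \<E>" "n k e \<noteq> \<zero>\<^bsub>R\<^esub>" by blast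
      have nR: "n i e \<in> carrier R" if "i < Suc k" for i
        using Fun_value[OF F.FAlg_Fun[OF nk[OF that]] e(1)] .
      define u where "u = inv\<^bsub>R\<^esub> (n k e)"
      have unit: "n k e \<in> Units R" using e(2) nR[of k] by (simp add: K.field_Units)
      have u: "u \<in> carrier R" "n k e \<otimes>\<^bsub>R\<^esub> u = \<one>\<^bsub>R\<^esub>" using unit by (simp_all add: u_def)
      \<comment> \<open>normalised so that \<open>c k = 1\<close>: the relation at \<open>e\<close> then reads \<open>\<Sum> m i c i = 0\<close>\<close>
      define c where "c i = n i e \<otimes>\<^bsub>R\<^esub> u" for i
      have c: "c i \<in> carrier R" if "i < Suc k" for i using nR[OF that] u(1) by (simp add: c_def)
      define S where "S = finsum P.Alg (\<lambda>i. rscal P.Alg (m i) (c i)) {..<Suc k}"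
      have mc: "(\<lambda>i. rscal P.Alg (m i) (c i)) \<in> {..<Suc k} \<rightarrow> carrier P.Alg"
        using mk c by (auto intro!: TP.M.rscal_closed simp del: P.Alg_simps)
      have S_Alg: "S \<in> carrier P.Alg" unfolding S_def using mc by (rule TP.M.M.finsum_closed)
      have S0: "S = \<zero>\<^bsub>P.Alg\<^esub>"
      proof (rule P.Sec_eqI[OF P.Alg_Sec[OF S_Alg] P.Alg_Sec[OF TP.M.M.zero_closed]])
        fix \<gamma> assume \<gamma>: "\<gamma> \<in> arrows \<Gamma>"
        interpret H: bimodule R "fibre \<Lambda> \<pi> \<gamma>" by (rule P.fibre_bimodule[OF \<gamma>])
        have m\<gamma>: "m i \<gamma> \<in> carrier (fibre \<Lambda> \<pi> \<gamma>)" if "i < Suc k" for i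
          using P.Sec_value[OF P.Alg_Sec[OF mk[OF that]] \<gamma>] by simp
        have "S \<gamma> = finsum (fibre \<Lambda> \<pi> \<gamma>) (\<lambda>i. rscal P.Alg (m i) (c i) \<gamma>) {..<Suc k}"
          unfolding S_def by (rule finsum_Alg_value[OF mc \<gamma>])
        also have "\<dots> = finsum (fibre \<Lambda> \<pi> \<gamma>) (\<lambda>i. fib_rscal \<pi> (fib_rscal \<pi> (m i \<gamma>) (n i e)) u) {..<Suc k}"
        proof (rule H.M.finsum_cong'[OF refl])
          show "(\<lambda>i. fib_rscal \<pi> (fib_rscal \<pi> (m i \<gamma>) (n i e)) u) \<in> {..<Suc k} \<rightarrow> carrier (fibre \<Lambda> \<pi> \<gamma>)"
            using H.rscal_closed m\<gamma> nR u(1) by (auto simp: P.fib_rules \<gamma>)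
          show "rscal P.Alg (m i) (c i) \<gamma> = fib_rscal \<pi> (fib_rscal \<pi> (m i \<gamma>) (n i e)) u"
            if "i \<in> {..<Suc k}" for i
            using that \<gamma> nR[of i] u(1) m\<gamma>[of i] H.rscal_mult[of "n i e" u "m i \<gamma>"]
            by (simp add: c_def P.Alg_simps(6))
        qed
        also have "\<dots> = fib_rscal \<pi> (finsum (fibre \<Lambda> \<pi> \<gamma>) (\<lambda>i. fib_rscal \<pi> (m i \<gamma>) (n i e)) {..<Suc k}) u"
          by (rule additive_finsum[OF H.M.abelian_group_axioms H.M.abelian_group_axioms,
                of "\<lambda>x. fib_rscal \<pi> x u", symmetric])
            (use m\<gamma> nR u(1) \<gamma> in \<open>auto simp: P.fib_rules\<close>)
        also have "finsum (fibre \<Lambda> \<pi> \<gamma>) (\<lambda>i. fib_rscal \<pi> (m i \<gamma>) (n i e)) {..<Suc k} = fib_zero \<pi> \<gamma>"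
          using is_T_value[OF T Suc.prems(1,2) \<gamma> e(1)] Suc.prems(3) \<gamma> e(1) by simp
        finally show "S \<gamma> = \<zero>\<^bsub>P.Alg\<^esub> \<gamma>" using \<gamma> u(1) by (simp add: P.fib_rules)
      qed
      \<comment> \<open>adding \<open>0 = - (\<Sum> m i c i) \<otimes> n k\<close> cancels the last summand\<close>
      define n' where "n' i = n i \<oplus>\<^bsub>F.FAlg\<^esub> \<ominus>\<^bsub>F.FAlg\<^esub> lscal F.FAlg (c i) (n k)" for i
      have cn: "lscal F.FAlg (c i) (n k) \<in> carrier F.FAlg" if "i < Suc k" for i
        using TP.N.lscal_closed[OF c[OF that] nk[of k]] by simp
      have n'_cl: "n' \<in> {..<Suc k} \<rightarrow> carrier F.FAlg"
        using nk cn by (auto simp: n'_def simp del: F.FAlg_simps)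
      have ck: "c k = \<one>\<^bsub>R\<^esub>" using u by (simp add: c_def)
      have n'k: "n' k = \<zero>\<^bsub>F.FAlg\<^esub>"
        unfolding n'_def ck TP.N.lscal_one[OF nk[OF lessI]] by (rule TP.N.M.r_neg[OF nk[OF lessI]])
      have pS: "finsum TP.MN (\<lambda>i. TP.pure (m i) (lscal F.FAlg (c i) (n k))) {..<Suc k} = \<zero>\<^bsub>TP.MN\<^esub>"
      proof -
        have "finsum TP.MN (\<lambda>i. TP.pure (m i) (lscal F.FAlg (c i) (n k))) {..<Suc k} =
            finsum TP.MN (\<lambda>i. TP.pure (rscal P.Alg (m i) (c i)) (n k)) {..<Suc k}"
        proof (rule TP.T.finsum_cong'[OF refl])
          show "(\<lambda>i. TP.pure (rscal P.Alg (m i) (c i)) (n k)) \<in> {..<Suc k} \<rightarrow> carrier TP.MN"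
            using TP.pure_closed[OF _ nk[OF lessI]] mc by blast
          show "TP.pure (m i) (lscal F.FAlg (c i) (n k)) = TP.pure (rscal P.Alg (m i) (c i)) (n k)"
            if "i \<in> {..<Suc k}" for i
            using that by (intro TP.pure_balanced[symmetric] mk c nk) auto
        qed
        also have "\<dots> = TP.pure S (n k)"
          unfolding S_def
          by (rule TP.pure_finsum_left[OF mc nk[OF lessI], symmetric])
        also have "\<dots> = \<zero>\<^bsub>TP.MN\<^esub>" unfolding S0 by (rule TP.pure_zero_left[OF nk[OF lessI]])
        finally show ?thesis .
      qed
      have split: "TP.pure (m i) (n i) = TP.pure (m i) (n' i) \<oplus>\<^bsub>TP.MN\<^esub> TP.pure (m i) (lscal F.FAlg (c i) (n k))"
        if i: "i < Suc k" for i
      proof -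
        have "n' i \<oplus>\<^bsub>F.FAlg\<^esub> lscal F.FAlg (c i) (n k) = n i"
          unfolding n'_def
          by (simp only: TP.N.M.a_assoc[OF nk[OF i] TP.N.M.a_inv_closed[OF cn[OF i]] cn[OF i]]
              TP.N.M.l_neg[OF cn[OF i]] TP.N.M.r_zero[OF nk[OF i]])
        then show ?thesis
          using TP.pure_add_right[OF mk[OF i] _ cn[OF i], of "n' i"] n'_cl i by (metis PiE lessThan_iff)
      qed
      have cl1: "(\<lambda>i. TP.pure (m i) (n' i)) \<in> {..<Suc k} \<rightarrow> carrier TP.MN"
        using mk n'_cl by (auto simp: Pi_iff simp del: P.Alg_simps F.FAlg_simps)
      have cl2: "(\<lambda>i. TP.pure (m i) (lscal F.FAlg (c i) (n k))) \<in> {..<Suc k} \<rightarrow> carrier TP.MN"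
        using mk cn by (auto simp del: P.Alg_simps F.FAlg_simps)
      have "finsum TP.MN (\<lambda>i. TP.pure (m i) (n i)) {..<Suc k} =
          finsum TP.MN (\<lambda>i. TP.pure (m i) (n' i) \<oplus>\<^bsub>TP.MN\<^esub> TP.pure (m i) (lscal F.FAlg (c i) (n k))) {..<Suc k}"
        by (rule TP.T.finsum_cong'[OF refl])
          (use cl1 cl2 split in \<open>auto simp: Pi_iff simp del: P.Alg_simps F.FAlg_simps\<close>)
      also have "\<dots> = finsum TP.MN (\<lambda>i. TP.pure (m i) (n' i)) {..<Suc k} \<oplus>\<^bsub>TP.MN\<^esub> \<zero>\<^bsub>TP.MN\<^esub>"
        unfolding TP.T.finsum_addf[OF cl1 cl2] pS ..
      also have "\<dots> = finsum TP.MN (\<lambda>i. TP.pure (m i) (n' i)) {..<Suc k}"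
        by (rule TP.T.r_zero, rule TP.T.finsum_closed, rule cl1)
      also have "\<dots> = finsum TP.MN (\<lambda>i. TP.pure (m i) (n' i)) {..<k}"
        by (rule drop[OF n'_cl n'k])
      finally have eq: "finsum TP.MN (\<lambda>i. TP.pure (m i) (n i)) {..<Suc k} =
        finsum TP.MN (\<lambda>i. TP.pure (m i) (n' i)) {..<k}" .
      show ?thesis
        unfolding eq
        by (rule Suc.IH) (use Suc.prems(1,3) n'_cl in \<open>auto simp: eq\<close>)
    qed
  qed
qed

text \<open>Compact sets are closed in a Hausdorff space, so that the extension of a function by zero is
  continuous.\<close>

lemma FAlg_Hausdorff:
  assumes H: "Hausdorff_space (atop \<E>)" and f: "f \<in> carrier F.FAlg"
  shows "continuous_map (atop \<E>) RT f" and "\<exists>K. compactin (atop \<E>) K \<and> (\<forall>e\<in>arrows \<E> - K. f e = \<zero>\<^bsub>R\<^esub>)"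
proof -
  have const: "continuous_map X RT (\<lambda>_. \<zero>\<^bsub>R\<^esub>)" for X :: "'e topology" by (simp add: P.R.topspace_RT)
  have "continuous_map (atop \<E>) RT f \<and> (\<exists>K. compactin (atop \<E>) K \<and> (\<forall>e\<in>arrows \<E> - K. f e = \<zero>\<^bsub>R\<^esub>))"
    using f
  proof (induction rule: F.FAlg_induct)
    case zero
    have "continuous_map (atop \<E>) RT \<zero>\<^bsub>F.Fun\<^esub>"
      by (rule continuous_map_eq[OF const]) (simp add: F.E.topspace_atop)
    moreover have "compactin (atop \<E>) {}" by simp
    moreover have "\<forall>e\<in>arrows \<E> - {}. \<zero>\<^bsub>F.Fun\<^esub> e = \<zero>\<^bsub>R\<^esub>" by simp
    ultimately show ?case by blast
  next
    case (Cc f W)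
    obtain K where K: "compactin (atop \<E>) K" "K \<subseteq> W" "\<forall>e\<in>arrows \<E> - K. f e = \<zero>\<^bsub>R\<^esub>"
      by (rule CcF_compact[OF Cc])
    have W: "openin (atop \<E>) W" using Cc(1) by (simp add: F.Tr.open_Hausdorff_def)
    have cK: "closedin (atop \<E>) K" by (rule compactin_imp_closedin[OF H K(1)])
    have "continuous_map (atop \<E>) RT f"
    proof (rule continuous_map_locally)
      fix x assume x: "x \<in> topspace (atop \<E>)"
      show "\<exists>U. openin (atop \<E>) U \<and> x \<in> U \<and> continuous_map (subtopology (atop \<E>) U) RT f"
      proof (cases "x \<in> W")
        case True
        moreover have "continuous_map (subtopology (atop \<E>) W) RT f" using Cc(2) by (simp add: Cc_functions_def)
        ultimately show ?thesis using W by blast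
      next
        case False
        have "continuous_map (subtopology (atop \<E>) (topspace (atop \<E>) - K)) RT f"
          by (rule continuous_map_eq[OF const]) (use K(3) in \<open>auto simp: F.E.topspace_atop\<close>)
        moreover have "openin (atop \<E>) (topspace (atop \<E>) - K)" using cK by blast
        ultimately show ?thesis using x False K(2) by blast
      qed
    qed
    then show ?case using K by blast
  next
    case (add f g)
    then obtain K L where K: "compactin (atop \<E>) K" "\<forall>e\<in>arrows \<E> - K. f e = \<zero>\<^bsub>R\<^esub>"
      and L: "compactin (atop \<E>) L" "\<forall>e\<in>arrows \<E> - L. g e = \<zero>\<^bsub>R\<^esub>" by blast
    have "continuous_map (atop \<E>) RT (\<lambda>e. f e \<oplus>\<^bsub>R\<^esub> g e)"
      using add by (intro continuous_map_compose2'[OF P.R.continuous_add]) auto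
    then have "continuous_map (atop \<E>) RT (f \<oplus>\<^bsub>F.Fun\<^esub> g)"
      by (rule continuous_map_eq) (simp add: F.E.topspace_atop)
    moreover have "compactin (atop \<E>) (K \<union> L)" by (rule compactin_Un[OF K(1) L(1)])
    moreover have "\<forall>e\<in>arrows \<E> - (K \<union> L). (f \<oplus>\<^bsub>F.Fun\<^esub> g) e = \<zero>\<^bsub>R\<^esub>" using K(2) L(2) by simp
    ultimately show ?case by blast
  qed
  then show "continuous_map (atop \<E>) RT f" "\<exists>K. compactin (atop \<E>) K \<and> (\<forall>e\<in>arrows \<E> - K. f e = \<zero>\<^bsub>R\<^esub>)"
    by auto
qed

text \<open>The common level sets of finitely many continuous functions with discrete values are open and
  closed, and those with a nonzero value are compact and finite in number. In terms of their indicator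
  functions, the coefficient at the level set of \<open>e\<close> is the section \<open>\<gamma> \<mapsto> \<Sigma> m\<^sub>i(\<gamma>)n\<^sub>i(e)\<close>, which vanishes on
  the kernel.\<close>

lemma T_injective_discrete:
  assumes T: "is_T T" and disc: "RT = discrete_topology (carrier R)" and H: "Hausdorff_space (atop \<E>)"
  shows "inj_on T (carrier TP.MN)"
proof (rule is_T_injI[OF T])
  fix k :: nat and m n
  assume m: "m \<in> {..<k} \<rightarrow> carrier P.Alg" and n: "n \<in> {..<k} \<rightarrow> carrier F.FAlg"
    and TX: "T (finsum TP.MN (\<lambda>i. TP.pure (m i) (n i)) {..<k}) = \<zero>\<^bsub>Q.Alg\<^esub>"
  have mi: "m i \<in> carrier P.Alg" and ni: "n i \<in> carrier F.FAlg" if "i < k" for i using m n that by auto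
  have nR: "n i e \<in> carrier R" if "i < k" "e \<in> arrows \<E>" for i e
    by (rule Fun_value[OF F.FAlg_Fun[OF ni[OF that(1)]] that(2)])
  have top: "topspace (atop \<E>) = arrows \<E>" by (rule F.E.topspace_atop)
  define v where "v e = restrict (\<lambda>i. n i e) {..<k}" for e
  define level where "level w = {e \<in> arrows \<E>. v e = w}" for w
  have v_eq: "v e = v e' \<longleftrightarrow> (\<forall>i<k. n i e = n i e')" for e e'
    by (auto simp: v_def restrict_def fun_eq_iff)
  have open_level: "openin (atop \<E>) (level w)" for w
  proof (cases "level w = {}")
    case False
    then obtain e where e: "e \<in> arrows \<E>" "w = v e" by (auto simp: level_def)
    have "openin (atop \<E>) {e' \<in> topspace (atop \<E>). n i e' \<in> {n i e}}" if "i \<in> {..<k}" for i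
      by (rule openin_continuous_map_preimage[OF FAlg_Hausdorff(1)[OF H ni]])
        (use that nR e(1) in \<open>auto simp: disc\<close>)
    then have "openin (atop \<E>) ((\<Inter>i\<in>{..<k}. {e' \<in> topspace (atop \<E>). n i e' \<in> {n i e}}) \<inter> topspace (atop \<E>))"
      by (intro openin_INT) auto
    moreover have "(\<Inter>i\<in>{..<k}. {e' \<in> topspace (atop \<E>). n i e' \<in> {n i e}}) \<inter> topspace (atop \<E>) = level w"
      by (auto simp: level_def e(2) v_eq top)
    ultimately show ?thesis by simp
  qed simp
  have closed_level: "closedin (atop \<E>) (level w)" for w
  proof -
    have "openin (atop \<E>) (\<Union>(level ` (- {w})))" using open_level by (intro openin_Union) auto
    moreover have "topspace (atop \<E>) - level w = \<Union>(level ` (- {w}))" by (auto simp: level_def top)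
    moreover have "level w \<subseteq> topspace (atop \<E>)" by (auto simp: level_def top)
    ultimately show ?thesis by (simp add: closedin_def)
  qed
  have "\<forall>i\<in>{..<k}. \<exists>K. compactin (atop \<E>) K \<and> (\<forall>e\<in>arrows \<E> - K. n i e = \<zero>\<^bsub>R\<^esub>)"
    using FAlg_Hausdorff(2)[OF H ni] by blast
  from bchoice[OF this] obtain L where L: "\<forall>i\<in>{..<k}. compactin (atop \<E>) (L i) \<and> (\<forall>e\<in>arrows \<E> - L i. n i e = \<zero>\<^bsub>R\<^esub>)"
    by blast
  define K where "K = (\<Union>i\<in>{..<k}. L i)"
  have K: "compactin (atop \<E>) K" unfolding K_def by (rule compactin_Union) (use L in auto)
  have supp: "e \<in> K" if "e \<in> arrows \<E>" "i < k" "n i e \<noteq> \<zero>\<^bsub>R\<^esub>" for i e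
    using L that by (auto simp: K_def)
  have Karr: "K \<subseteq> arrows \<E>" using compactin_subset_topspace[OF K] top by simp
  have fin_v: "finite (v ` K)"
  proof -
    have "\<forall>e\<in>K. \<exists>U. openin (atop \<E>) U \<and> e \<in> U \<and> (\<exists>w. U = level w)"
      using open_level Karr by (auto simp: level_def)
    then obtain \<F> where \<F>: "finite \<F>" "\<forall>U\<in>\<F>. openin (atop \<E>) U \<and> (\<exists>w. U = level w)" "K \<subseteq> \<Union>\<F>"
      by (rule compactin_finite_subcover[OF K])
    have "finite (v ` U)" if U: "U \<in> \<F>" for U
    proof -
      have "\<exists>w. U = level w" using bspec[OF \<F>(2) U] by (rule conjunct2)
      then obtain w where "U = level w" by (rule exE)
      then have "v ` U \<subseteq> {w}" by (auto simp: level_def)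
      then show ?thesis by (rule finite_subset) simp
    qed
    then have "finite (\<Union>U\<in>\<F>. v ` U)" using \<F>(1) by blast
    then show ?thesis by (rule rev_finite_subset) (use \<F>(3) in auto)
  qed
  define \<W> where "\<W> = {w \<in> v ` K. \<exists>i<k. w i \<noteq> \<zero>\<^bsub>R\<^esub>}"
  have fin: "finite \<W>" using fin_v by (simp add: \<W>_def)
  have wR: "w i \<in> carrier R" if "w \<in> \<W>" "i < k" for w i
    using that nR Karr by (auto simp: \<W>_def v_def)
  define ind where "ind w = (\<lambda>e\<in>arrows \<E>. if e \<in> level w then \<one>\<^bsub>R\<^esub> else \<zero>\<^bsub>R\<^esub>)" for w
  have ind: "ind w \<in> carrier F.FAlg" if w: "w \<in> \<W>" for w
  proof -
    have oH: "F.Tr.open_Hausdorff (level w)"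
      using open_level Hausdorff_space_subtopology[OF H] by (simp add: F.Tr.open_Hausdorff_def)
    have "level w \<subseteq> K"
    proof
      fix e assume e: "e \<in> level w"
      obtain i where i: "i < k" "w i \<noteq> \<zero>\<^bsub>R\<^esub>" using w by (auto simp: \<W>_def)
      then have "n i e \<noteq> \<zero>\<^bsub>R\<^esub>" using e by (auto simp: level_def v_def)
      then show "e \<in> K" using supp i(1) e by (simp add: level_def)
    qed
    then have "compactin (atop \<E>) (level w)" by (rule closed_compactin[OF K _ closed_level])
    then show ?thesis unfolding ind_def by (rule F.CcF_FAlg[OF oH indicator_CcF[OF oH]])
  qed
  have wind: "lscal F.FAlg (w i) (ind w) \<in> carrier F.FAlg" if "w \<in> \<W>" "i < k" for w i
    by (rule TP.N.lscal_closed[OF wR[OF that] ind[OF that(1)]])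
  have expand: "n i = finsum F.FAlg (\<lambda>w. lscal F.FAlg (w i) (ind w)) \<W>" if i: "i < k" for i
  proof (rule PiE_ext)
    have cl: "(\<lambda>w. lscal F.FAlg (w i) (ind w)) \<in> \<W> \<rightarrow> carrier F.FAlg" using wind i by blast
    show "n i \<in> arrows \<E> \<rightarrow>\<^sub>E carrier R" "finsum F.FAlg (\<lambda>w. lscal F.FAlg (w i) (ind w)) \<W> \<in> arrows \<E> \<rightarrow>\<^sub>E carrier R"
      using F.FAlg_Fun[OF ni[OF i]] F.FAlg_Fun[OF TP.N.M.finsum_closed[OF cl]] unfolding R_functions_simps(1) .
    fix e assume e: "e \<in> arrows \<E>"
    have "finsum F.FAlg (\<lambda>w. lscal F.FAlg (w i) (ind w)) \<W> e = finsum R (\<lambda>w. lscal F.FAlg (w i) (ind w) e) \<W>"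
      by (rule finsum_FAlg_value[OF cl e])
    also have "\<dots> = finsum R (\<lambda>w. if v e = w then w i else \<zero>\<^bsub>R\<^esub>) \<W>"
      by (rule P.R.finsum_cong'[OF refl])
        (use wR i e in \<open>auto simp: F.FAlg_simps(5) ind_def level_def\<close>)
    also have "\<dots> = n i e"
    proof (cases "v e \<in> \<W>")
      case True
      have "finsum R (\<lambda>w. if v e = w then w i else \<zero>\<^bsub>R\<^esub>) \<W> = v e i"
        by (rule P.R.finsum_singleton[OF True fin]) (use wR i in auto)
      then show ?thesis using i by (simp add: v_def)
    next
      case False
      have "n i e = \<zero>\<^bsub>R\<^esub>"
      proof (rule ccontr)
        assume ne: "n i e \<noteq> \<zero>\<^bsub>R\<^esub>"
        have "v e i \<noteq> \<zero>\<^bsub>R\<^esub>" using i ne by (simp add: v_def)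
        then have "v e \<in> \<W>"
          unfolding \<W>_def mem_Collect_eq by (intro conjI imageI exI[of _ i] supp[OF e i ne] i)
        then show False using False by blast
      qed
      moreover have "finsum R (\<lambda>w. if v e = w then w i else \<zero>\<^bsub>R\<^esub>) \<W> = finsum R (\<lambda>w. \<zero>\<^bsub>R\<^esub>) \<W>"
        by (rule P.R.finsum_cong'[OF refl]) (use False in auto)
      ultimately show ?thesis by (simp add: P.R.finsum_zero)
    qed
    finally show "n i e = finsum F.FAlg (\<lambda>w. lscal F.FAlg (w i) (ind w)) \<W> e" by (rule sym)
  qed
  have mw: "(\<lambda>i. rscal P.Alg (m i) (w i)) \<in> {..<k} \<rightarrow> carrier P.Alg" if "w \<in> \<W>" for w
    using TP.M.rscal_closed[OF wR[OF that] mi] by blast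
  have coeff: "finsum P.Alg (\<lambda>i. rscal P.Alg (m i) (w i)) {..<k} = \<zero>\<^bsub>P.Alg\<^esub>" if w: "w \<in> \<W>" for w
  proof (rule P.Sec_eqI[OF P.Alg_Sec[OF TP.M.M.finsum_closed[OF mw[OF w]]] P.Alg_Sec[OF TP.M.M.zero_closed]])
    fix \<gamma> assume \<gamma>: "\<gamma> \<in> arrows \<Gamma>"
    obtain e where e: "e \<in> arrows \<E>" "w = v e" using w Karr by (auto simp: \<W>_def)
    interpret G: abelian_group "fibre \<Lambda> \<pi> \<gamma>" by (rule P.fib_abelian[OF \<gamma>])
    have "finsum P.Alg (\<lambda>i. rscal P.Alg (m i) (w i)) {..<k} \<gamma> =
        finsum (fibre \<Lambda> \<pi> \<gamma>) (\<lambda>i. rscal P.Alg (m i) (w i) \<gamma>) {..<k}"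
      by (rule finsum_Alg_value[OF mw[OF w] \<gamma>])
    also have "\<dots> = finsum (fibre \<Lambda> \<pi> \<gamma>) (\<lambda>i. fib_rscal \<pi> (m i \<gamma>) (n i e)) {..<k}"
    proof (rule G.finsum_cong'[OF refl])
      show "(\<lambda>i. fib_rscal \<pi> (m i \<gamma>) (n i e)) \<in> {..<k} \<rightarrow> carrier (fibre \<Lambda> \<pi> \<gamma>)"
        using \<gamma> P.Sec_value[OF P.Alg_Sec[OF mi] \<gamma>] nR e(1) by (auto simp: P.fib_rules)
    qed (use \<gamma> e in \<open>auto simp: P.Alg_simps(6) v_def\<close>)
    also have "\<dots> = fib_zero \<pi> \<gamma>"
      using is_T_value[OF T m n \<gamma> e(1)] TX \<gamma> e(1) by simp
    finally show "finsum P.Alg (\<lambda>i. rscal P.Alg (m i) (w i)) {..<k} \<gamma> = \<zero>\<^bsub>P.Alg\<^esub> \<gamma>" using \<gamma> by simp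
  qed
  have cl: "TP.pure (rscal P.Alg (m i) (w i)) (ind w) \<in> carrier TP.MN" if "i \<in> {..<k}" "w \<in> \<W>" for i w
    using mw[OF that(2)] that ind[OF that(2)] by (intro TP.pure_closed) auto
  have "finsum TP.MN (\<lambda>i. TP.pure (m i) (n i)) {..<k} =
      finsum TP.MN (\<lambda>i. finsum TP.MN (\<lambda>w. TP.pure (rscal P.Alg (m i) (w i)) (ind w)) \<W>) {..<k}"
  proof (rule TP.T.finsum_cong'[OF refl])
    show "(\<lambda>i. finsum TP.MN (\<lambda>w. TP.pure (rscal P.Alg (m i) (w i)) (ind w)) \<W>) \<in> {..<k} \<rightarrow> carrier TP.MN"
      by (intro Pi_I TP.T.finsum_closed cl)
    fix i assume "i \<in> {..<k}"
    then have i: "i < k" by simp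
    have "TP.pure (m i) (n i) = finsum TP.MN (\<lambda>w. TP.pure (m i) (lscal F.FAlg (w i) (ind w))) \<W>"
      by (subst expand[OF i], rule TP.pure_finsum_right[OF mi[OF i]]) (rule Pi_I, rule wind[OF _ i])
    also have "\<dots> = finsum TP.MN (\<lambda>w. TP.pure (rscal P.Alg (m i) (w i)) (ind w)) \<W>"
    proof (rule TP.T.finsum_cong'[OF refl])
      show "(\<lambda>w. TP.pure (rscal P.Alg (m i) (w i)) (ind w)) \<in> \<W> \<rightarrow> carrier TP.MN" using cl i by blast
      show "TP.pure (m i) (lscal F.FAlg (w i) (ind w)) = TP.pure (rscal P.Alg (m i) (w i)) (ind w)"
        if "w \<in> \<W>" for w
        by (rule TP.pure_balanced[OF mi[OF i] wR[OF that i] ind[OF that], symmetric])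
    qed
    finally show "TP.pure (m i) (n i) = finsum TP.MN (\<lambda>w. TP.pure (rscal P.Alg (m i) (w i)) (ind w)) \<W>" .
  qed
  also have "\<dots> = finsum TP.MN (\<lambda>w. finsum TP.MN (\<lambda>i. TP.pure (rscal P.Alg (m i) (w i)) (ind w)) {..<k}) \<W>"
    by (rule finsum_swap[OF TP.T.abelian_group_axioms finite_lessThan fin cl])
  also have "\<dots> = finsum TP.MN (\<lambda>w. \<zero>\<^bsub>TP.MN\<^esub>) \<W>"
  proof (rule TP.T.finsum_cong'[OF refl])
    fix w assume w: "w \<in> \<W>"
    have "finsum TP.MN (\<lambda>i. TP.pure (rscal P.Alg (m i) (w i)) (ind w)) {..<k} =
        TP.pure (finsum P.Alg (\<lambda>i. rscal P.Alg (m i) (w i)) {..<k}) (ind w)"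
      by (rule TP.pure_finsum_left[OF mw[OF w] ind[OF w], symmetric])
    also have "\<dots> = \<zero>\<^bsub>TP.MN\<^esub>" unfolding coeff[OF w] by (rule TP.pure_zero_left[OF ind[OF w]])
    finally show "finsum TP.MN (\<lambda>i. TP.pure (rscal P.Alg (m i) (w i)) (ind w)) {..<k} = \<zero>\<^bsub>TP.MN\<^esub>" .
  qed simp
  also have "\<dots> = \<zero>\<^bsub>TP.MN\<^esub>" by (rule TP.T.finsum_zero)
  finally show "finsum TP.MN (\<lambda>i. TP.pure (m i) (n i)) {..<k} = \<zero>\<^bsub>TP.MN\<^esub>" .
qed

end

theorem theorem5p3:
  fixes R :: "'r ring" and RT :: "'r topology"
    and \<Lambda> :: "('p, 'l) top_sgpd" and \<Gamma> :: "('o, 'g) top_sgpd" and \<E> :: "('q, 'e) top_sgpd"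
    and \<pi> :: "('r, 'g, 'l) rbundle"
  assumes "topological_ring R RT"
    and "continuous_bundle R RT \<Lambda> \<Gamma> \<pi>"
    and "etale_semigroupoid \<Gamma>" and "locally_R_normal R RT (atop \<Gamma>)"
    and "etale_semigroupoid \<E>" and "locally_R_normal R RT (atop \<E>)"
  shows "(\<exists>!T. is_tensor_section_map R RT \<Lambda> \<Gamma> \<pi> \<E> T) \<and>
    (\<forall>T. is_tensor_section_map R RT \<Lambda> \<Gamma> \<pi> \<E> T \<longrightarrow>
      (cring R \<and> (\<forall>\<gamma>\<in>arrows \<Gamma>. symmetric_bimodule R (fibre \<Lambda> \<pi> \<gamma>)) \<longrightarrow>
        T \<in> algebra_hom R
          (tensor R (sectional_algebra R \<Lambda> \<Gamma> \<pi>) (semigroupoid_algebra R RT \<E>))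
          (sectional_algebra R (prod_sgpd \<Lambda> \<E>) (prod_sgpd \<Gamma> \<E>) (prod_bundle \<pi>))) \<and>
      (ample_semigroupoid \<Gamma> \<and> ample_semigroupoid \<E> \<and>
       local_homeomorphism (atop \<Lambda>) (atop \<Gamma>) (proj \<pi>) \<longrightarrow>
        T ` carrier (tensor R (sectional_algebra R \<Lambda> \<Gamma> \<pi>) (semigroupoid_algebra R RT \<E>)) =
          carrier (sectional_algebra R (prod_sgpd \<Lambda> \<E>) (prod_sgpd \<Gamma> \<E>) (prod_bundle \<pi>))) \<and>
      (RT = discrete_topology (carrier R) \<and> ample_semigroupoid \<E> \<and> Hausdorff_space (atop \<E>) \<longrightarrow>
        inj_on T (carrier (tensor R (sectional_algebra R \<Lambda> \<Gamma> \<pi>) (semigroupoid_algebra R RT \<E>)))) \<and>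
      (field R \<longrightarrow>
        inj_on T (carrier (tensor R (sectional_algebra R \<Lambda> \<Gamma> \<pi>) (semigroupoid_algebra R RT \<E>)))))"
proof -
  interpret bundle_pair R RT \<Lambda> \<Gamma> \<pi> \<E>
    by (intro bundle_pair.intro normal_bundle.intro etale_bundle.intro normal_bundle_axioms.intro
        function_algebra.intro function_algebra_axioms.intro assms)
  have "T \<in> algebra_hom R TP.MN Q.Alg"
    if "is_T T" "cring R" "\<forall>\<gamma>\<in>arrows \<Gamma>. symmetric_bimodule R (fibre \<Lambda> \<pi> \<gamma>)" for T
    using that is_T_mult unfolding algebra_hom_def is_tensor_section_map_def by blast
  then show ?thesis
    using is_T_exists is_T_unique T_surjective T_injective_discrete T_injective_field by blast
qed

end
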